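(* For ${\rm APP}=\{{\rm APP}_d\}_{d\in\mathbb N}$ in the average case setting: with the absolute error criterion, ${\rm APP}$ is EXP-QPT for $\Lambda^{\rm all}$ iff it is EXP-QPT for $\Lambda^{\rm std}$. Moreover, for $\star\in\{{\rm ABS},{\rm NOR}\}$, if ${\rm APP}$ is EXP-QPT for $\Lambda^{\rm all}$ with criterion $\star$, then it is EXP-QPT for $\Lambda^{\rm std}$ with criterion $\star$ and ${\rm EXP}\text{-}t^{\star}(\Lambda^{\rm all})={\rm EXP}\text{-}t^{\star}(\Lambda^{\rm std})$.
   Context: Setting (average case approximation). For each $d\in\mathbb N$: $D_d\subset\mathbb R^d$ is a Borel set of positive Lebesgue measure, $\rho_d$ is a probability density on $D_d$, and $G_d=L_2(D_d,\rho_d(x)\,dx)$. $F_d$ is a separable Banach space of real-valued functions on $D_d$, continuously embedded in $G_d$, such that every point evaluation $f\mapsto f(x)$, $x\in D_d$, is a continuous linear functional on $F_d$; $F_d$ carries a zero-mean Gaussian measure $\mu_d$. ${\rm APP}_d:F_d\to G_d$, ${\rm APP}_d f=f$. $\Lambda^{\rm all}$ is the class of all continuous linear functionals on $F_d$, $\Lambda^{\rm std}$ the class of point evaluations. For $\Lambda\in\{\Lambda^{\rm all},\Lambda^{\rm std}\}$, an algorithm is $A_{n,d}f=\phi_{n,d}(L_1(f),\dots,L_n(f))$ with $L_i\in\Lambda$ and $\phi_{n,d}:\mathbb R^n\to G_d$ measurable; its average case error is $e^{\rm avg}(A_{n,d})=\big(\int_{F_d}\|f-A_{n,d}f\|_{G_d}^2\,\mu_d(df)\big)^{1/2}$,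 and $e^{\rm avg}(n,d;\Lambda)$ is the infimum of $e^{\rm avg}(A_{n,d})$ over all such algorithms using $n$ functionals from $\Lambda$ (for $n=0$, $A_{0,d}=0$). Set $\Gamma_d=(e^{\rm avg}(0,d;\Lambda))^2$ (same for both classes). Information complexity: $n^{\star}(\varepsilon,d;\Lambda)=\min\{n\ge0:\ e^{\rm avg}(n,d;\Lambda)\le\varepsilon\,{\rm CRI}_d\}$, with ${\rm CRI}_d=1$ for $\star={\rm ABS}$ and ${\rm CRI}_d=\sqrt{\Gamma_d}$ for $\star={\rm NOR}$. EXP-QPT for $\Lambda$ (criterion $\star$): there exist $C>0$, $t\ge0$ with $n^{\star}(\varepsilon,d;\Lambda)\le C\exp\big(t(1+\ln d)(1+\ln(1+\ln\varepsilon^{-1}))\big)$ for all $d\in\mathbb N$, $\varepsilon\in(0,1)$; the exponent ${\rm EXP}\text{-}t^{\star}(\Lambda)$ is the infimum of all such $t$. *)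

theory Defs
  imports "HOL-Probability.Probability"
begin

text \<open>Points of R^d are represented as functions nat => real, extensional on {..<d}
  (the space of the product measure below).  Elements of F_d are real-valued functions
  on such points (taken to vanish outside D_d).\<close>

type_synonym pt = "nat \<Rightarrow> real"
type_synonym fn = "pt \<Rightarrow> real"

record avg_setting =
  Dom   :: "nat \<Rightarrow> pt set"
  dens  :: "nat \<Rightarrow> pt \<Rightarrow> real"
  Fsp   :: "nat \<Rightarrow> fn set"
  Fnorm :: "nat \<Rightarrow> fn \<Rightarrow> real"
  gmeas :: "nat \<Rightarrow> fn measure"

definition lebd :: "nat \<Rightarrow> pt measure" where
  "lebd d = PiM {..<d} (\<lambda>_. lborel)"

text \<open>The measure rho_d(x) dx on D_d, defining G_d = L_2(D_d, rho_d(x) dx).\<close>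
definition nuG :: "avg_setting \<Rightarrow> nat \<Rightarrow> pt measure" where
  "nuG S d = density (lebd d) (\<lambda>x. ennreal (dens S d x) * indicator (Dom S d) x)"

definition Gnorm2 :: "avg_setting \<Rightarrow> nat \<Rightarrow> fn \<Rightarrow> ennreal" where
  "Gnorm2 S d g = (\<integral>\<^sup>+ x. ennreal ((g x)\<^sup>2) \<partial>nuG S d)"

definition F_open :: "avg_setting \<Rightarrow> nat \<Rightarrow> fn set \<Rightarrow> bool" where
  "F_open S d U \<longleftrightarrow> U \<subseteq> Fsp S d \<and>
     (\<forall>f\<in>U. \<exists>e>0. \<forall>g\<in>Fsp S d. Fnorm S d (\<lambda>x. g x - f x) < e \<longrightarrow> g \<in> U)"

definition F_borel :: "avg_setting \<Rightarrow> nat \<Rightarrow> fn set set" where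
  "F_borel S d = sigma_sets (Fsp S d) {U. F_open S d U}"

definition Lam_all :: "avg_setting \<Rightarrow> nat \<Rightarrow> (fn \<Rightarrow> real) set" where
  "Lam_all S d = {L.
     (\<forall>f\<in>Fsp S d. \<forall>g\<in>Fsp S d. L (\<lambda>x. f x + g x) = L f + L g) \<and>
     (\<forall>c. \<forall>f\<in>Fsp S d. L (\<lambda>x. c * f x) = c * L f) \<and>
     (\<exists>C. \<forall>f\<in>Fsp S d. \<bar>L f\<bar> \<le> C * Fnorm S d f)}"

definition Lam_std :: "avg_setting \<Rightarrow> nat \<Rightarrow> (fn \<Rightarrow> real) set" where
  "Lam_std S d = {L. \<exists>x\<in>Dom S d. L = (\<lambda>f. f x)}"

datatype info_class = Info_all | Info_std

definition Lam :: "avg_setting \<Rightarrow> info_class \<Rightarrow> nat \<Rightarrow> (fn \<Rightarrow> real) set" where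
  "Lam S c d = (case c of Info_all \<Rightarrow> Lam_all S d | Info_std \<Rightarrow> Lam_std S d)"

definition centered_gauss :: "real \<Rightarrow> real measure" where
  "centered_gauss s = (if s = 0 then return borel 0 else density lborel (normal_density 0 s))"

definition valid_setting :: "avg_setting \<Rightarrow> bool" where
  "valid_setting S \<longleftrightarrow> (\<forall>d\<ge>1.
     \<comment> \<open>D_d Borel with positive Lebesgue measure\<close>
     Dom S d \<in> sets (lebd d) \<and> emeasure (lebd d) (Dom S d) > 0 \<and>
     \<comment> \<open>rho_d probability density on D_d\<close>
     dens S d \<in> borel_measurable (lebd d) \<and> (\<forall>x\<in>Dom S d. dens S d x \<ge> 0) \<and>
     (\<integral>\<^sup>+ x. ennreal (dens S d x) * indicator (Dom S d) x \<partial>lebd d) = 1 \<and>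
     \<comment> \<open>F_d: linear space of functions on D_d\<close>
     (\<forall>f\<in>Fsp S d. \<forall>x. x \<notin> Dom S d \<longrightarrow> f x = 0) \<and>
     (\<lambda>x. 0) \<in> Fsp S d \<and>
     (\<forall>f\<in>Fsp S d. \<forall>g\<in>Fsp S d. (\<lambda>x. f x + g x) \<in> Fsp S d) \<and>
     (\<forall>c. \<forall>f\<in>Fsp S d. (\<lambda>x. c * f x) \<in> Fsp S d) \<and>
     \<comment> \<open>norm axioms\<close>
     (\<forall>f\<in>Fsp S d. Fnorm S d f \<ge> 0 \<and> (Fnorm S d f = 0 \<longleftrightarrow> f = (\<lambda>x. 0))) \<and>
     (\<forall>c. \<forall>f\<in>Fsp S d. Fnorm S d (\<lambda>x. c * f x) = \<bar>c\<bar> * Fnorm S d f) \<and>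
     (\<forall>f\<in>Fsp S d. \<forall>g\<in>Fsp S d. Fnorm S d (\<lambda>x. f x + g x) \<le> Fnorm S d f + Fnorm S d g) \<and>
     \<comment> \<open>completeness (Banach)\<close>
     (\<forall>s. (\<forall>n. s n \<in> Fsp S d) \<and>
          (\<forall>e>0. \<exists>N. \<forall>m\<ge>N. \<forall>n\<ge>N. Fnorm S d (\<lambda>x. s m x - s n x) < e) \<longrightarrow>
          (\<exists>f\<in>Fsp S d. (\<lambda>n. Fnorm S d (\<lambda>x. s n x - f x)) \<longlonglongrightarrow> 0)) \<and>
     \<comment> \<open>separability\<close>
     (\<exists>Q. countable Q \<and> Q \<subseteq> Fsp S d \<and>
          (\<forall>f\<in>Fsp S d. \<forall>e>0. \<exists>q\<in>Q. Fnorm S d (\<lambda>x. f x - q x) < e)) \<and>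
     \<comment> \<open>continuous embedding into G_d\<close>
     (\<forall>f\<in>Fsp S d. f \<in> borel_measurable (lebd d)) \<and>
     (\<exists>C. \<forall>f\<in>Fsp S d. Gnorm2 S d f \<le> ennreal (C * (Fnorm S d f)\<^sup>2)) \<and>
     \<comment> \<open>continuity of point evaluations\<close>
     (\<forall>x\<in>Dom S d. \<exists>C. \<forall>f\<in>Fsp S d. \<bar>f x\<bar> \<le> C * Fnorm S d f) \<and>
     \<comment> \<open>zero-mean Gaussian (probability) measure on the Borel sets of F_d\<close>
     prob_space (gmeas S d) \<and> space (gmeas S d) = Fsp S d \<and> sets (gmeas S d) = F_borel S d \<and>
     (\<forall>L\<in>Lam_all S d. \<exists>s\<ge>0. distr (gmeas S d) borel L = centered_gauss s))"

text \<open>Admissible algorithms using n functionals from Lambda: a pair (L, phi) with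
  L_i in Lambda for i < n and phi : R^n -> G_d measurable (jointly measurable, every
  value phi y in G_d).  The algorithm is A f = phi (L_0 f, ..., L_{n-1} f).\<close>
definition algs :: "avg_setting \<Rightarrow> info_class \<Rightarrow> nat \<Rightarrow> nat \<Rightarrow>
    ((nat \<Rightarrow> fn \<Rightarrow> real) \<times> ((nat \<Rightarrow> real) \<Rightarrow> pt \<Rightarrow> real)) set" where
  "algs S c d n = {(L, \<phi>).
     (\<forall>i<n. L i \<in> Lam S c d) \<and>
     (\<lambda>(y, x). \<phi> y x) \<in> borel_measurable (PiM {..<n} (\<lambda>_. lborel) \<Otimes>\<^sub>M lebd d) \<and>
     (\<forall>y \<in> space (PiM {..<n} (\<lambda>_. lborel)). Gnorm2 S d (\<phi> y) < \<infinity>)}"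

definition alg_apply :: "nat \<Rightarrow> (nat \<Rightarrow> fn \<Rightarrow> real) \<Rightarrow> ((nat \<Rightarrow> real) \<Rightarrow> pt \<Rightarrow> real) \<Rightarrow> fn \<Rightarrow> fn" where
  "alg_apply n L \<phi> f = \<phi> (restrict (\<lambda>i. L i f) {..<n})"

definition err2 :: "avg_setting \<Rightarrow> nat \<Rightarrow> (fn \<Rightarrow> fn) \<Rightarrow> ennreal" where
  "err2 S d A = (\<integral>\<^sup>+ f. Gnorm2 S d (\<lambda>x. f x - A f x) \<partial>gmeas S d)"

definition min_err2 :: "avg_setting \<Rightarrow> info_class \<Rightarrow> nat \<Rightarrow> nat \<Rightarrow> ennreal" where
  "min_err2 S c n d = (if n = 0 then err2 S d (\<lambda>f x. 0)
     else (INF a \<in> algs S c d n. err2 S d (alg_apply n (fst a) (snd a))))"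

definition Gamma :: "avg_setting \<Rightarrow> nat \<Rightarrow> ennreal" where
  "Gamma S d = err2 S d (\<lambda>f x. 0)"

datatype criterion = ABS | NOR

definition CRI2 :: "avg_setting \<Rightarrow> criterion \<Rightarrow> nat \<Rightarrow> ennreal" where
  "CRI2 S crit d = (case crit of ABS \<Rightarrow> 1 | NOR \<Rightarrow> Gamma S d)"

text \<open>Information complexity n^star(eps,d;Lambda) (infinity if no n works); since errors are
  nonnegative, e(n) <= eps * CRI_d iff e(n)^2 <= eps^2 * CRI_d^2.\<close>
definition info_compl :: "avg_setting \<Rightarrow> info_class \<Rightarrow> criterion \<Rightarrow> real \<Rightarrow> nat \<Rightarrow> enat" where
  "info_compl S c crit \<epsilon> d =
     (INF n \<in> {n. min_err2 S c n d \<le> ennreal (\<epsilon>\<^sup>2) * CRI2 S crit d}. enat n)"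

definition exp_qpt_bound :: "real \<Rightarrow> real \<Rightarrow> nat \<Rightarrow> real \<Rightarrow> real" where
  "exp_qpt_bound C t d \<epsilon> = C * exp (t * (1 + ln (real d)) * (1 + ln (1 + ln (1 / \<epsilon>))))"

definition exp_qpt_holds :: "avg_setting \<Rightarrow> info_class \<Rightarrow> criterion \<Rightarrow> real \<Rightarrow> real \<Rightarrow> bool" where
  "exp_qpt_holds S c crit C t \<longleftrightarrow>
     (\<forall>d\<ge>1. \<forall>\<epsilon>. 0 < \<epsilon> \<and> \<epsilon> < 1 \<longrightarrow> info_compl S c crit \<epsilon> d \<le> exp_qpt_bound C t d \<epsilon>)"

definition EXP_QPT :: "avg_setting \<Rightarrow> info_class \<Rightarrow> criterion \<Rightarrow> bool" where
  "EXP_QPT S c crit \<longleftrightarrow> (\<exists>C>0. \<exists>t\<ge>0. exp_qpt_holds S c crit C t)"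

definition EXP_t :: "avg_setting \<Rightarrow> info_class \<Rightarrow> criterion \<Rightarrow> real" where
  "EXP_t S c crit = Inf {t. t \<ge> 0 \<and> (\<exists>C>0. exp_qpt_holds S c crit C t)}"

end

theory Submission
  imports Defs
begin

text \<open>
  For a Gaussian measure the conditional expectation of \<open>f x\<close> given finitely many continuous
  functionals is linear, so any algorithm using \<open>m\<close> functionals is at least as bad as the
  orthogonal projection onto some subspace \<open>V\<close> of \<open>G\<^sub>d\<close> of dimension \<open>r \<le> m\<close>.  Let \<open>tail\<close> be
  the mean square error of that projection.  Function values do almost as well:
  splitting off one sample point after another, each chosen at least as well as the average with
  respect to the normalised diagonal of the reproducing kernel of the remaining subspace (volume
  sampling), gives \<open>r\<close> points and error at most \<open>(r + 1) tail\<close>.  Relaxed Kaczmarz steps with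
  relaxation parameter \<open>\<gamma>\<close>, again at points not worse than the average, contract the error
  inside \<open>V\<close> by the factor \<open>1 - \<gamma> / r\<close> down to the level \<open>\<gamma> tail\<close>.  Hence \<open>O(m\<^sup>1\<^sup>+\<^sup>\<eta>)\<close> function
  values reach \<open>(1 + \<eta>)\<close> times the squared error of \<open>m\<close> arbitrary functionals, and the exponent
  changes at most by the factor \<open>(1 + \<eta>)\<^sup>2\<close>.  A constant \<open>1 + \<eta>\<close> close to one is essential: a
  fixed larger constant would increase the exponent for \<open>\<epsilon>\<close> near one and large \<open>d\<close>.
\<close>

section \<open>Square integrable functions\<close>

text \<open>Two approximation problems share the field \<open>f x\<close>. For fixed
  \<open>x\<close> in the domain the value is an element of \<open>L2 \<mu>\<close>, and projecting
  it onto the span of the information functionals gives the best predictor; its coefficients are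
  functions of \<open>x\<close>, and these span \<open>V\<close> in \<open>L2 \<nu>\<close>. This is
  why \<open>random_field\<close> is interpreted with both orders of the measures. Volume sampling
  serves as the start of the Kaczmarz stage: contraction alone needs a number of steps depending on
  the ratio of initial error to \<open>tail\<close>, for which there is no a priori bound. From
  \<open>r * tail\<close> about \<open>(m / \<gamma>) * ln (m / \<gamma>)\<close> steps suffice, and
  absorbing the logarithm costs the power \<open>\<eta>\<close>. With
  \<open>\<gamma> = \<eta> / 2\<close>, half of the allowed excess is the floor of the Kaczmarz
  recursion and half is the remainder of the initial error. Square integrability of the whole field
  is not part of the setting; it has to be derived from the Gaussian law of single evaluations
  together with the finite norm of every \<open>f\<close> in \<open>G\<close>.\<close>

definition L2 :: "'a measure \<Rightarrow> ('a \<Rightarrow> real) set" where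
  "L2 M = {f. f \<in> borel_measurable M \<and> integrable M (\<lambda>x. (f x)\<^sup>2)}"

lemma L2_measurable [measurable_dest]: "f \<in> L2 M \<Longrightarrow> f \<in> borel_measurable M"
  by (simp add: L2_def)

lemma L2_integrable_mult:
  assumes "f \<in> L2 M" "g \<in> L2 M"
  shows "integrable M (\<lambda>x. f x * g x)"
proof (rule Bochner_Integration.integrable_bound)
  show "integrable M (\<lambda>x. (f x)\<^sup>2 + (g x)\<^sup>2)" using assms by (simp add: L2_def)
  have "\<bar>a * b\<bar> \<le> a\<^sup>2 + b\<^sup>2" for a b :: real
    using sum_squares_bound[of a b] sum_squares_bound[of a "- b"] by (auto simp: abs_if)
  then show "AE x in M. norm (f x * g x) \<le> norm ((f x)\<^sup>2 + (g x)\<^sup>2)"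
    by (auto simp: abs_mult)
qed (use assms in \<open>auto simp: L2_def\<close>)

lemma L2_integrable_square: "f \<in> L2 M \<Longrightarrow> integrable M (\<lambda>x. (f x)\<^sup>2)"
  by (simp add: L2_def)

lemma L2_add:
  assumes "f \<in> L2 M" "g \<in> L2 M"
  shows "(\<lambda>x. f x + g x) \<in> L2 M"
  using assms L2_integrable_mult[OF assms] unfolding L2_def
  by (auto simp: power2_sum mult.assoc)

lemma L2_cmult: "f \<in> L2 M \<Longrightarrow> (\<lambda>x. c * f x) \<in> L2 M"
  unfolding L2_def by (auto simp: power_mult_distrib)

lemma L2_cmult_right: "f \<in> L2 M \<Longrightarrow> (\<lambda>x. f x * c) \<in> L2 M"
  unfolding L2_def by (auto simp: power_mult_distrib)

lemma L2_divide: "f \<in> L2 M \<Longrightarrow> (\<lambda>x. f x / c) \<in> L2 M"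
  using L2_cmult_right[of f M "1 / c"] by simp

lemma L2_diff:
  assumes "f \<in> L2 M" "g \<in> L2 M"
  shows "(\<lambda>x. f x - g x) \<in> L2 M"
  using L2_add[OF assms(1) L2_cmult[OF assms(2), of "-1"]] by simp

lemma L2_zero: "(\<lambda>x. 0) \<in> L2 M"
  by (simp add: L2_def)

lemma L2_sum: "(\<And>i. i \<in> I \<Longrightarrow> f i \<in> L2 M) \<Longrightarrow> (\<lambda>x. \<Sum>i\<in>I. f i x) \<in> L2 M"
  by (induction I rule: infinite_finite_induct) (auto intro: L2_zero L2_add)

lemmas L2_intros = L2_add L2_diff L2_cmult L2_cmult_right L2_divide L2_zero L2_sum

lemma L2_integrable:
  assumes "finite_measure M" "f \<in> L2 M"
  shows "integrable M f"
proof -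
  have "(\<lambda>x. 1) \<in> L2 M"
    using assms(1) by (simp add: L2_def finite_measure.integrable_const)
  from L2_integrable_mult[OF assms(2) this] show ?thesis by simp
qed

definition orthonormal :: "'a measure \<Rightarrow> nat \<Rightarrow> (nat \<Rightarrow> 'a \<Rightarrow> real) \<Rightarrow> bool" where
  "orthonormal M r u \<longleftrightarrow> (\<forall>j<r. u j \<in> L2 M) \<and>
     (\<forall>j<r. \<forall>k<r. (\<integral>x. u j x * u k x \<partial>M) = (if j = k then 1 else 0))"

lemma orthonormalD:
  assumes "orthonormal M r u"
  shows "j < r \<Longrightarrow> u j \<in> L2 M"
    and "j < r \<Longrightarrow> k < r \<Longrightarrow> (\<integral>x. u j x * u k x \<partial>M) = (if j = k then 1 else 0)"
  using assms by (auto simp: orthonormal_def)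

lemma orthonormal_integral_combination:
  assumes "orthonormal M r u" "k < r"
  shows "(\<integral>x. (\<Sum>j<r. b j * u j x) * u k x \<partial>M) = b k"
proof -
  have "(\<integral>x. (\<Sum>j<r. b j * u j x) * u k x \<partial>M) = (\<integral>x. (\<Sum>j<r. b j * (u j x * u k x)) \<partial>M)"
    by (simp add: sum_distrib_right mult.assoc)
  also have "\<dots> = (\<Sum>j<r. b j * (\<integral>x. u j x * u k x \<partial>M))"
    using assms by (subst Bochner_Integration.integral_sum)
      (auto intro!: L2_integrable_mult orthonormalD)
  also have "\<dots> = (\<Sum>j<r. if j = k then b j else 0)"
    using assms by (intro sum.cong) (auto simp: orthonormalD)
  finally show ?thesis using assms(2) by simp
qed

lemma orthonormal_residual_orthogonal:
  assumes "orthonormal M r u" "w \<in> L2 M" "k < r"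
  shows "(\<integral>x. (w x - (\<Sum>j<r. (\<integral>y. w y * u j y \<partial>M) * u j x)) * u k x \<partial>M) = 0"
proof -
  have "(\<lambda>x. \<Sum>j<r. (\<integral>y. w y * u j y \<partial>M) * u j x) \<in> L2 M"
    using assms by (intro L2_intros) (auto simp: orthonormalD)
  then show ?thesis
    using assms orthonormal_integral_combination[OF assms(1,3), of "\<lambda>j. \<integral>y. w y * u j y \<partial>M"]
    by (simp add: left_diff_distrib L2_integrable_mult orthonormalD)
qed

text \<open>The second identity turns an inner product with the in-span part into a sum over
  coefficients; with \<open>b = c\<close> it evaluates the cross term in
  \<open>kaczmarz_step\<close>.\<close>

lemma orthonormal_pythagoras:
  assumes u: "orthonormal M r u" and g: "g \<in> L2 M"
    and orth: "\<And>k. k < r \<Longrightarrow> (\<integral>x. g x * u k x \<partial>M) = 0"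
  shows "(\<integral>x. (g x + (\<Sum>j<r. b j * u j x))\<^sup>2 \<partial>M) = (\<integral>x. (g x)\<^sup>2 \<partial>M) + (\<Sum>j<r. (b j)\<^sup>2)"
    and "(\<integral>x. (g x + (\<Sum>j<r. b j * u j x)) * (\<Sum>j<r. c j * u j x) \<partial>M) = (\<Sum>j<r. b j * c j)"
proof -
  define v where "v b x = (\<Sum>j<r. b j * u j x)" for b x
  have v: "v b \<in> L2 M" for b
    unfolding v_def using u by (intro L2_intros) (auto simp: orthonormalD)
  have ip: "(\<integral>x. f x * v c x \<partial>M) = (\<Sum>j<r. c j * (\<integral>x. f x * u j x \<partial>M))"
    if f: "f \<in> L2 M" for f c
  proof -
    have "(\<integral>x. f x * v c x \<partial>M) = (\<integral>x. (\<Sum>j<r. c j * (f x * u j x)) \<partial>M)"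
      unfolding v_def by (simp add: sum_distrib_left mult_ac)
    also have "\<dots> = (\<Sum>j<r. c j * (\<integral>x. f x * u j x \<partial>M))"
      using u f by (subst Bochner_Integration.integral_sum)
        (auto intro!: L2_integrable_mult orthonormalD)
    finally show ?thesis .
  qed
  have gv: "(\<integral>x. g x * v c x \<partial>M) = 0" for c
    using ip[OF g] orth by simp
  have vv: "(\<integral>x. v b x * v c x \<partial>M) = (\<Sum>j<r. b j * c j)" for b c
    using ip[OF v[of b], of c] orthonormal_integral_combination[OF u, of _ b]
    by (simp add: v_def mult.commute)
  note int = L2_integrable_mult[OF g v] L2_integrable_mult[OF v v] L2_integrable_square[OF g]
  have "(\<integral>x. (g x + v b x)\<^sup>2 \<partial>M) = (\<integral>x. (g x)\<^sup>2 + 2 * (g x * v b x) + v b x * v b x \<partial>M)"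
    by (intro Bochner_Integration.integral_cong) (auto simp: power2_eq_square algebra_simps)
  also have "\<dots> = (\<integral>x. (g x)\<^sup>2 \<partial>M) + (\<Sum>j<r. (b j)\<^sup>2)"
    using int by (simp add: gv vv power2_eq_square)
  finally show "(\<integral>x. (g x + (\<Sum>j<r. b j * u j x))\<^sup>2 \<partial>M) = (\<integral>x. (g x)\<^sup>2 \<partial>M) + (\<Sum>j<r. (b j)\<^sup>2)"
    by (simp add: v_def)
  have "(\<integral>x. (g x + v b x) * v c x \<partial>M) = (\<Sum>j<r. b j * c j)"
    using int by (simp add: gv vv distrib_right)
  then show "(\<integral>x. (g x + (\<Sum>j<r. b j * u j x)) * (\<Sum>j<r. c j * u j x) \<partial>M) = (\<Sum>j<r. b j * c j)"
    by (simp add: v_def)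
qed

text \<open>Linear dependence only shortens the system, hence \<open>r \<le> n\<close>. The two
  representations differ on purpose: each \<open>u j\<close> is everywhere a combination of the
  \<open>w i\<close>, so it inherits linearity and boundedness when the \<open>w i\<close> are
  functionals, whereas a \<open>w i\<close> whose residual has norm zero is recovered only almost
  everywhere.\<close>

lemma gram_schmidt_L2:
  assumes "\<And>i. i < n \<Longrightarrow> w i \<in> L2 M"
  shows "\<exists>r u b c. r \<le> n \<and> orthonormal M r u \<and>
     (\<forall>i<n. AE x in M. w i x = (\<Sum>j<r. c i j * u j x)) \<and>
     (\<forall>j<r. \<forall>x. u j x = (\<Sum>i<n. b j i * w i x))"
  using assms
proof (induction n)
  case 0
  show ?case by (intro exI[of _ 0]) (auto simp: orthonormal_def)
next
  case (Suc n)
  from Suc.IH[OF Suc.prems[OF less_SucI]]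
  obtain r u b c where r: "r \<le> n" and u: "orthonormal M r u"
    and c: "\<And>i. i < n \<Longrightarrow> AE x in M. w i x = (\<Sum>j<r. c i j * u j x)"
    and b: "\<And>j x. j < r \<Longrightarrow> u j x = (\<Sum>i<n. b j i * w i x)"
    by blast
  have wn: "w n \<in> L2 M" using Suc by simp
  define a where "a j = (\<integral>y. w n y * u j y \<partial>M)" for j
  define v where "v x = w n x - (\<Sum>j<r. a j * u j x)" for x
  have v: "v \<in> L2 M"
    unfolding v_def using u wn by (intro L2_intros) (auto simp: orthonormalD)
  have vu: "(\<integral>x. v x * u k x \<partial>M) = 0" if "k < r" for k
    using orthonormal_residual_orthogonal[OF u wn that] by (simp add: v_def a_def)
  define t where "t = (\<integral>x. (v x)\<^sup>2 \<partial>M)"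
  have t0: "t \<ge> 0" by (simp add: t_def)
  show ?case
  proof (cases "t = 0")
    case True
    then have "AE x in M. v x = 0"
      using integral_nonneg_eq_0_iff_AE[OF L2_integrable_square[OF v]] by (simp add: t_def)
    then have *: "AE x in M. w n x = (\<Sum>j<r. a j * u j x)" by (simp add: v_def)
    show ?thesis
    proof (intro exI conjI allI impI)
      show "r \<le> Suc n" using r by simp
      show "orthonormal M r u" by fact
      show "AE x in M. w i x = (\<Sum>j<r. (c(n := a)) i j * u j x)" if "i < Suc n" for i
        using * c[of i] that by (cases "i = n") auto
      show "u j x = (\<Sum>i<Suc n. ((b j)(n := 0)) i * w i x)" if "j < r" for j x
        using b[OF that, of x] by simp
    qed
  next
    case False
    define s where "s = sqrt t"
    have s: "s > 0" "s\<^sup>2 = t" using False t0 by (auto simp: s_def)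
    define u' where "u' = u(r := \<lambda>x. v x / s)"
    have u'1: "u' j = u j" if "j < r" for j using that by (simp add: u'_def)
    have u'r: "u' r x = v x / s" for x by (simp add: u'_def)
    have uv: "(\<integral>x. u k x * v x \<partial>M) = 0" if "k < r" for k
      using vu[OF that] by (simp add: mult.commute)
    have on: "orthonormal M (Suc r) u'"
      unfolding orthonormal_def
    proof (intro conjI allI impI)
      show "u' j \<in> L2 M" if "j < Suc r" for j
        using that u v by (auto simp: u'_def orthonormalD intro!: L2_divide)
      have "(\<integral>x. v x * v x / (s * s) \<partial>M) = 1"
        using s False by (simp add: t_def power2_eq_square[symmetric])
      then have vv: "(\<integral>x. v x / s * (v x / s) \<partial>M) = 1"
        unfolding times_divide_times_eq .
      show "(\<integral>x. u' j x * u' k x \<partial>M) = (if j = k then 1 else 0)" if "j < Suc r" "k < Suc r" for j k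
      proof (cases "j = r")
        case j: True
        show ?thesis
        proof (cases "k = r")
          case True
          show ?thesis unfolding True j u'r vv by simp
        next
          case False
          then have "k < r" using that by simp
          then show ?thesis using j False vu[of k] by (simp add: u'r u'1 mult.commute)
        qed
      next
        case False
        then have j: "j < r" using that by simp
        show ?thesis
        proof (cases "k = r")
          case True
          then show ?thesis using j False uv[of j] by (simp add: u'r u'1)
        next
          case False
          then have "k < r" using that by simp
          then show ?thesis using j by (simp add: u'1 orthonormalD(2)[OF u])
        qed
      qed
    qed
    have rec: "w n x = (\<Sum>j<Suc r. (a(r := s)) j * u' j x)" for x
    proof -
      have "(\<Sum>j<Suc r. (a(r := s)) j * u' j x) = (\<Sum>j<r. a j * u j x) + v x"
        using s by (simp add: u'r u'1)
      then show ?thesis by (simp add: v_def)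
    qed
    show ?thesis
    proof (intro exI conjI allI impI)
      show "Suc r \<le> Suc n" using r by simp
      show "orthonormal M (Suc r) u'" by fact
      define c' where "c' i = (if i = n then a(r := s) else (c i)(r := 0))" for i
      show "AE x in M. w i x = (\<Sum>j<Suc r. c' i j * u' j x)" if "i < Suc n" for i
      proof (cases "i = n")
        case True
        then show ?thesis using rec unfolding c'_def by simp
      next
        case False
        then have "AE x in M. w i x = (\<Sum>j<r. c i j * u j x)" using that c by auto
        then show ?thesis using False by (simp add: c'_def u'1)
      qed
      \<comment> \<open>\<open>u' r\<close> is the normalised residual of \<open>w n\<close>;
        expanding the subtracted \<open>u j\<close> through \<open>b\<close> gives its coefficients
        in the \<open>w i\<close>.\<close>
      define b' where "b' j = (if j = r then (\<lambda>i. if i = n then 1 / s else - (\<Sum>j<r. a j * b j i) / s)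
        else (b j)(n := 0))" for j
      show "u' j x = (\<Sum>i<Suc n. b' j i * w i x)" if "j < Suc r" for j x
      proof (cases "j = r")
        case False
        then show ?thesis using that b[of j x] by (simp add: b'_def u'1)
      next
        case True
        have "(\<Sum>j<r. a j * u j x) = (\<Sum>j<r. \<Sum>i<n. a j * b j i * w i x)"
          using b by (simp add: sum_distrib_left mult.assoc)
        also have "\<dots> = (\<Sum>i<n. (\<Sum>j<r. a j * b j i) * w i x)"
          by (subst sum.swap) (simp add: sum_distrib_right)
        finally have "v x / s = w n x / s - (\<Sum>i<n. (\<Sum>j<r. a j * b j i) * w i x) / s"
          by (simp add: v_def diff_divide_distrib)
        also have "\<dots> = w n x / s + (\<Sum>i<n. - (\<Sum>j<r. a j * b j i) / s * w i x)"
          by (simp add: sum_divide_distrib[where A = "{..<n}"] sum_negf)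
        finally show ?thesis using True by (simp add: b'_def u'r)
      qed
    qed
  qed
qed

text \<open>The quotient \<open>F / K\<close> is compared with its average for the density
  \<open>K\<close> divided by its integral. If every point with \<open>K x > 0\<close> failed,
  \<open>F - c * K\<close> would be nonnegative with integral zero, hence zero almost everywhere,
  and strictness would force \<open>K = 0\<close> almost everywhere. The sign condition on
  \<open>F\<close> where \<open>K\<close> vanishes covers the points that this density does not
  see.\<close>

lemma exists_le_average:
  fixes F K :: "'a \<Rightarrow> real"
  assumes D: "AE x in M. x \<in> D"
    and F: "integrable M F" and K: "integrable M K"
    and K0: "\<And>x. x \<in> D \<Longrightarrow> 0 \<le> K x" and F0: "\<And>x. x \<in> D \<Longrightarrow> K x = 0 \<Longrightarrow> 0 \<le> F x"
    and pos: "(\<integral>x. K x \<partial>M) > 0"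
  shows "\<exists>x\<in>D. K x > 0 \<and> F x \<le> (\<integral>x. F x \<partial>M) / (\<integral>x. K x \<partial>M) * K x"
proof (rule ccontr)
  assume neg: "\<not> ?thesis"
  define c where "c = (\<integral>x. F x \<partial>M) / (\<integral>x. K x \<partial>M)"
  have lt: "c * K x < F x" if "x \<in> D" "K x > 0" for x
    using neg that by (force simp: c_def)
  have ge: "0 \<le> F x - c * K x" if "x \<in> D" for x
    using lt[OF that] K0[OF that] F0[OF that] by (cases "K x = 0") auto
  have int: "integrable M (\<lambda>x. F x - c * K x)" using F K by auto
  have "(\<integral>x. F x - c * K x \<partial>M) = 0"
    using F K pos by (simp add: c_def)
  moreover have "AE x in M. 0 \<le> F x - c * K x"
    using D by eventually_elim (rule ge)
  ultimately have "AE x in M. F x - c * K x = 0"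
    using integral_nonneg_eq_0_iff_AE[OF int] by blast
  with D have "AE x in M. K x = 0"
  proof eventually_elim
    case (elim x)
    with lt[of x] K0[of x] show ?case by force
  qed
  then have "(\<integral>x. K x \<partial>M) = 0"
    by (intro integral_eq_zero_AE)
  with pos show False by simp
qed

section \<open>Sampling a random field\<close>

definition projection_matrix :: "nat \<Rightarrow> (nat \<Rightarrow> nat \<Rightarrow> real) \<Rightarrow> bool" where
  "projection_matrix r Q \<longleftrightarrow> (\<forall>i<r. \<forall>j<r. Q i j = Q j i) \<and>
     (\<forall>i<r. \<forall>k<r. (\<Sum>j<r. Q i j * Q j k) = Q i k)"

text \<open>By symmetry the sum over a row is a diagonal entry of the square of \<open>Q\<close>,
  which is \<open>Q\<close> again. It evaluates the integral of the kernel diagonal in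
  \<open>greedy_samples\<close>, and in \<open>greedy_complete\<close> it shows that a projection of
  trace zero vanishes.\<close>

lemma projection_matrix_trace:
  assumes "projection_matrix r Q"
  shows "(\<Sum>i<r. \<Sum>j<r. (Q i j)\<^sup>2) = (\<Sum>i<r. Q i i)"
proof (rule sum.cong)
  fix i assume i: "i \<in> {..<r}"
  have "Q i j = Q j i" if "j < r" for j
    using assms i that unfolding projection_matrix_def by blast
  then have "(\<Sum>j<r. (Q i j)\<^sup>2) = (\<Sum>j<r. Q i j * Q j i)"
    by (intro sum.cong) (simp_all add: power2_eq_square)
  also have "\<dots> = Q i i"
    using assms i unfolding projection_matrix_def by blast
  finally show "(\<Sum>j<r. (Q i j)\<^sup>2) = Q i i" .
qed simp

text \<open>
  \<open>Q\<close> is the projection, in coordinates of an orthonormal system with values \<open>U\<close> at a point \<open>x\<close>,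
  onto the remaining subspace; \<open>a\<close> is the kernel section of that subspace at \<open>x\<close>, \<open>K\<close> is its
  value at \<open>x\<close>, and \<open>Q'\<close> projects onto the functions of the subspace that vanish at \<open>x\<close>.
\<close>
locale projection_deflation =
  fixes r :: nat and Q :: "nat \<Rightarrow> nat \<Rightarrow> real" and U :: "nat \<Rightarrow> real"
  assumes Q: "projection_matrix r Q"
begin

definition a where "a j = (\<Sum>k<r. Q j k * U k)"
definition K where "K = (\<Sum>j<r. (a j)\<^sup>2)"
definition Q' where "Q' j k = Q j k - a j * a k / K"

lemma Q_sym: "i < r \<Longrightarrow> j < r \<Longrightarrow> Q i j = Q j i"
  and Q_idem: "i < r \<Longrightarrow> k < r \<Longrightarrow> (\<Sum>j<r. Q i j * Q j k) = Q i k"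
  using Q unfolding projection_matrix_def by blast+

lemma Q_a:
  assumes "i < r"
  shows "(\<Sum>j<r. Q i j * a j) = a i"
proof -
  have "(\<Sum>j<r. Q i j * a j) = (\<Sum>k<r. (\<Sum>j<r. Q i j * Q j k) * U k)"
    unfolding a_def by (simp add: sum_distrib_left sum_distrib_right mult.assoc) (rule sum.swap)
  also have "\<dots> = a i"
    unfolding a_def using assms by (intro sum.cong) (auto simp: Q_idem)
  finally show ?thesis .
qed

lemma a_Q:
  assumes "k < r"
  shows "(\<Sum>j<r. a j * Q j k) = a k"
proof -
  have "(\<Sum>j<r. a j * Q j k) = (\<Sum>j<r. Q k j * a j)"
    using assms by (intro sum.cong) (auto simp: Q_sym[of _ k])
  then show ?thesis using Q_a[OF assms] by simp
qed

text \<open>\<open>a\<close> lies in the range of \<open>Q\<close>, and \<open>p - Q p\<close> is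
  orthogonal to that range.\<close>

lemma a_residual: "(\<Sum>j<r. (p j - (\<Sum>k<r. Q j k * p k)) * a j) = 0"
proof -
  have "(\<Sum>j<r. (\<Sum>k<r. Q j k * p k) * a j) = (\<Sum>k<r. p k * (\<Sum>j<r. a j * Q j k))"
    by (simp add: sum_distrib_left sum_distrib_right mult_ac) (rule sum.swap)
  also have "\<dots> = (\<Sum>k<r. p k * a k)"
    by (intro sum.cong) (auto simp: a_Q)
  finally show ?thesis
    by (simp add: left_diff_distrib sum_subtractf)
qed

context
  assumes K: "K \<noteq> 0"
begin

text \<open>Since \<open>a\<close> lies in the range of \<open>Q\<close> and \<open>K\<close> is its
  squared length, \<open>Q'\<close> subtracts from \<open>Q\<close> the projection onto the line
  through \<open>a\<close>. The function with coordinates \<open>c\<close> in the range of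
  \<open>Q\<close> takes at the point the value given by the inner product of \<open>c\<close> and
  \<open>a\<close>; this is why removing \<open>a\<close> leaves the functions vanishing
  there.\<close>

lemma deflate_projection: "projection_matrix r Q'"
  unfolding projection_matrix_def
proof (intro conjI allI impI)
  show "Q' i j = Q' j i" if "i < r" "j < r" for i j
    using Q_sym[OF that] by (simp add: Q'_def mult.commute)
  show "(\<Sum>j<r. Q' i j * Q' j k) = Q' i k" if "i < r" "k < r" for i k
  proof -
    have "(\<Sum>j<r. Q' i j * Q' j k) = (\<Sum>j<r. Q i j * Q j k - (Q i j * a j) * (a k / K)
        - (a i / K) * (a j * Q j k) + (a i * a k / K\<^sup>2) * (a j)\<^sup>2)"
      unfolding Q'_def using K by (intro sum.cong) (auto simp: field_simps power2_eq_square)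
    also have "\<dots> = Q i k - a i * (a k / K) - (a i / K) * a k + (a i * a k / K\<^sup>2) * K"
      unfolding sum.distrib sum_subtractf sum_distrib_left[symmetric] sum_distrib_right[symmetric]
        K_def[symmetric] using that by (simp add: Q_idem Q_a a_Q)
    also have "\<dots> = Q' i k"
      using K by (simp add: Q'_def power2_eq_square)
    finally show ?thesis .
  qed
qed

lemma deflate_trace: "(\<Sum>j<r. Q' j j) = (\<Sum>j<r. Q j j) - 1"
proof -
  have "(\<Sum>j<r. a j * a j / K) = 1"
    using K by (simp add: sum_divide_distrib[symmetric] K_def power2_eq_square)
  then show ?thesis by (simp add: Q'_def sum_subtractf)
qed

text \<open>\<open>h\<close> is the observed error at the point and \<open>p'\<close> the
  coefficient error after a full step along \<open>a\<close>. \<open>Q'\<close> annihilates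
  \<open>a\<close>, so \<open>Q' p' = Q' p\<close>, and the part of \<open>h\<close> due to
  \<open>Q p\<close> is the sum of the \<open>p k * a k\<close>, which cancels against what
  \<open>Q'\<close> lost compared with \<open>Q\<close>. Thus the uncontrolled component of
  \<open>p\<close> inside the range of \<open>Q\<close> does not enter the new residual.\<close>

lemma deflate_residual:
  fixes p :: "nat \<Rightarrow> real" and y :: real
  assumes i: "i < r"
  defines "h \<equiv> y + (\<Sum>j<r. p j * U j)"
  defines "q \<equiv> \<lambda>j. p j - (\<Sum>k<r. Q j k * p k)"
  defines "p' \<equiv> \<lambda>j. p j - h * a j / K"
  shows "p' i - (\<Sum>k<r. Q' i k * p' k) = q i - (y + (\<Sum>j<r. q j * U j)) * a i / K"
proof -
  have "(\<Sum>j<r. (\<Sum>k<r. Q j k * p k) * U j) = (\<Sum>k<r. p k * (\<Sum>j<r. Q j k * U j))"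
    by (simp add: sum_distrib_left sum_distrib_right mult_ac) (rule sum.swap)
  also have "\<dots> = (\<Sum>k<r. p k * a k)"
    unfolding a_def by (intro sum.cong arg_cong2[where f = "(*)"] refl) (auto simp: Q_sym)
  finally have G: "y + (\<Sum>j<r. q j * U j) = h - (\<Sum>k<r. p k * a k)"
    by (simp add: q_def h_def left_diff_distrib sum_subtractf)
  have "(\<Sum>k<r. Q' i k * p' k) = (\<Sum>k<r. Q i k * p k - (h / K) * (Q i k * a k)
      - (a i / K) * (p k * a k) + (a i * h / K\<^sup>2) * (a k)\<^sup>2)"
    unfolding Q'_def p'_def using K by (intro sum.cong) (auto simp: field_simps power2_eq_square)
  also have "\<dots> = (\<Sum>k<r. Q i k * p k) - (h / K) * a i - (a i / K) * (\<Sum>k<r. p k * a k)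
      + (a i * h / K\<^sup>2) * K"
    unfolding sum.distrib sum_subtractf sum_distrib_left[symmetric] K_def[symmetric]
    using i by (simp add: Q_a)
  finally have S: "(\<Sum>k<r. Q' i k * p' k) = (\<Sum>k<r. Q i k * p k) - (h / K) * a i
      - (a i / K) * (\<Sum>k<r. p k * a k) + (a i * h / K\<^sup>2) * K" .
  show ?thesis
    using K unfolding G S unfolding q_def p'_def by (simp add: field_simps power2_eq_square)
qed

text \<open>Pythagoras: the two terms in \<open>deflate_residual\<close> are orthogonal by
  \<open>a_residual\<close>, and the multiple of \<open>a\<close> has squared length
  \<open>G\<^sup>2 / K\<close>, where \<open>G\<close> is the error at the point left by the
  residual coefficients \<open>q\<close>.\<close>

lemma deflate_residual_norm:
  fixes p :: "nat \<Rightarrow> real" and y :: real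
  defines "h \<equiv> y + (\<Sum>j<r. p j * U j)"
  defines "q \<equiv> \<lambda>j. p j - (\<Sum>k<r. Q j k * p k)"
  defines "p' \<equiv> \<lambda>j. p j - h * a j / K"
  shows "(\<Sum>i<r. (p' i - (\<Sum>k<r. Q' i k * p' k))\<^sup>2) =
    (\<Sum>i<r. (q i)\<^sup>2) + (y + (\<Sum>j<r. q j * U j))\<^sup>2 / K"
proof -
  define G where "G = y + (\<Sum>j<r. q j * U j)"
  have "p' i - (\<Sum>k<r. Q' i k * p' k) = q i - G * a i / K" if "i < r" for i
    using deflate_residual[OF that, where y = y and p = p] unfolding h_def q_def p'_def G_def .
  then have "(\<Sum>i<r. (p' i - (\<Sum>k<r. Q' i k * p' k))\<^sup>2) = (\<Sum>i<r. (q i - G * a i / K)\<^sup>2)"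
    by (intro sum.cong) auto
  also have "\<dots> = (\<Sum>i<r. (q i)\<^sup>2 - (2 * G / K) * (q i * a i) + (G\<^sup>2 / K\<^sup>2) * (a i)\<^sup>2)"
    using K by (intro sum.cong) (auto simp: field_simps power2_eq_square)
  also have "\<dots> = (\<Sum>i<r. (q i)\<^sup>2) - (2 * G / K) * (\<Sum>i<r. q i * a i) + (G\<^sup>2 / K\<^sup>2) * K"
    unfolding sum.distrib sum_subtractf sum_distrib_left[symmetric] K_def[symmetric] ..
  also have "(\<Sum>i<r. q i * a i) = 0"
    unfolding q_def by (rule a_residual)
  finally show ?thesis
    using K by (simp add: G_def power2_eq_square)
qed

end

end

text \<open>In the application \<open>P\<close> lives on functions and \<open>N\<close> on points,
  and once the other way round. Membership in \<open>L2\<close> is required at every point of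
  \<open>D\<close> and for every \<open>\<omega>\<close> in the space, because \<open>D\<close>
  supplies the actual sample points and the projection is formed for each
  \<open>\<omega>\<close>.\<close>

locale random_field = P: prob_space P + N: prob_space N
  for P :: "'a measure" and N :: "'b measure" +
  fixes X :: "'a \<Rightarrow> 'b \<Rightarrow> real" and D :: "'b set"
    and r :: nat and u :: "nat \<Rightarrow> 'b \<Rightarrow> real"
  assumes X_measurable: "(\<lambda>(\<omega>, x). X \<omega> x) \<in> borel_measurable (P \<Otimes>\<^sub>M N)"
    and X_integrable: "integrable (P \<Otimes>\<^sub>M N) (\<lambda>(\<omega>, x). (X \<omega> x)\<^sup>2)"
    and AE_D: "AE x in N. x \<in> D"
    and X_L2_left: "\<And>x. x \<in> D \<Longrightarrow> (\<lambda>\<omega>. X \<omega> x) \<in> L2 P"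
    and X_L2_right: "\<And>\<omega>. \<omega> \<in> space P \<Longrightarrow> X \<omega> \<in> L2 N"
    and u: "orthonormal N r u"
begin

sublocale PN: pair_prob_space P N ..

section \<open>Coefficients, projection residual and energy identities\<close>

definition coef where "coef j \<omega> = (\<integral>x. X \<omega> x * u j x \<partial>N)"
definition resid where "resid \<omega> x = X \<omega> x - (\<Sum>j<r. coef j \<omega> * u j x)"
definition tail where "tail = (\<integral>\<omega>. (\<integral>x. (resid \<omega> x)\<^sup>2 \<partial>N) \<partial>P)"
text \<open>The error field of an approximation in the span whose coefficients are off by
  \<open>q\<close>; see \<open>perturbed_err\<close>. In \<open>greedy_samples\<close> the family
  \<open>q\<close> is only the part of the coefficient error outside the remaining subspace.\<close>

definition perturbed where "perturbed q \<omega> x = resid \<omega> x + (\<Sum>j<r. q j \<omega> * u j x)"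

lemma u_L2: "j < r \<Longrightarrow> u j \<in> L2 N"
  using orthonormalD[OF u] by blast

lemma X_L2: "(\<lambda>(\<omega>, x). X \<omega> x) \<in> L2 (P \<Otimes>\<^sub>M N)"
  using X_measurable X_integrable by (auto simp: L2_def case_prod_unfold)

lemma resid_L2_right: "\<omega> \<in> space P \<Longrightarrow> resid \<omega> \<in> L2 N"
  unfolding resid_def[abs_def] by (intro L2_intros X_L2_right u_L2) auto

lemma resid_orthogonal:
  "\<omega> \<in> space P \<Longrightarrow> k < r \<Longrightarrow> (\<integral>x. resid \<omega> x * u k x \<partial>N) = 0"
  unfolding resid_def coef_def by (rule orthonormal_residual_orthogonal[OF u X_L2_right])

lemma coef_square_le:
  assumes "\<omega> \<in> space P" "j < r"
  shows "(coef j \<omega>)\<^sup>2 \<le> (\<integral>x. (X \<omega> x)\<^sup>2 \<partial>N)"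
proof -
  have "(\<integral>x. (X \<omega> x)\<^sup>2 \<partial>N) = (\<integral>x. (resid \<omega> x + (\<Sum>j<r. coef j \<omega> * u j x))\<^sup>2 \<partial>N)"
    by (simp add: resid_def)
  also have "\<dots> = (\<integral>x. (resid \<omega> x)\<^sup>2 \<partial>N) + (\<Sum>j<r. (coef j \<omega>)\<^sup>2)"
    by (rule orthonormal_pythagoras(1)[OF u resid_L2_right resid_orthogonal]) (use assms in auto)
  finally have "(\<integral>x. (X \<omega> x)\<^sup>2 \<partial>N) = (\<integral>x. (resid \<omega> x)\<^sup>2 \<partial>N) + (\<Sum>j<r. (coef j \<omega>)\<^sup>2)" .
  moreover have "(coef j \<omega>)\<^sup>2 \<le> (\<Sum>j<r. (coef j \<omega>)\<^sup>2)"
    using assms by (intro member_le_sum) auto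
  moreover have "0 \<le> (\<integral>x. (resid \<omega> x)\<^sup>2 \<partial>N)" by simp
  ultimately show ?thesis by linarith
qed

text \<open>Bessel's inequality dominates the squared coefficient by the energy of
  \<open>X \<omega>\<close>, which is integrable over \<open>P\<close> by Fubini.\<close>

lemma coef_L2:
  assumes j: "j < r"
  shows "coef j \<in> L2 P"
proof -
  note [measurable] = X_measurable L2_measurable[OF u_L2[OF j]]
  have m [measurable]: "coef j \<in> borel_measurable P"
    unfolding coef_def[abs_def] by measurable
  have "integrable P (\<lambda>\<omega>. \<integral>x. (X \<omega> x)\<^sup>2 \<partial>N)"
    using PN.integrable_fst[OF X_integrable] by simp
  then have "integrable P (\<lambda>\<omega>. (coef j \<omega>)\<^sup>2)"
    by (rule Bochner_Integration.integrable_bound)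
      (use coef_square_le[OF _ j] in \<open>auto intro!: AE_I2\<close>)
  then show ?thesis by (simp add: L2_def)
qed

lemma product_L2:
  assumes q: "q \<in> L2 P" and v: "v \<in> L2 N"
  shows "(\<lambda>(\<omega>, x). q \<omega> * v x) \<in> L2 (P \<Otimes>\<^sub>M N)"
proof -
  note [measurable] = L2_measurable[OF q] L2_measurable[OF v]
  have "integrable (P \<Otimes>\<^sub>M N) (\<lambda>(\<omega>, x). (q \<omega>)\<^sup>2 * (v x)\<^sup>2)"
    by (rule PN.Fubini_integrable)
      (use L2_integrable_square[OF q] L2_integrable_square[OF v] in auto)
  then show ?thesis
    by (auto simp: L2_def power_mult_distrib case_prod_unfold)
qed

lemma perturbed_L2:
  assumes q: "\<And>j. j < r \<Longrightarrow> q j \<in> L2 P"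
  shows "(\<lambda>z. perturbed q (fst z) (snd z)) \<in> L2 (P \<Otimes>\<^sub>M N)"
    and "(\<lambda>z. \<Sum>j<r. q j (fst z) * u j (snd z)) \<in> L2 (P \<Otimes>\<^sub>M N)"
    and "x \<in> D \<Longrightarrow> (\<lambda>\<omega>. perturbed q \<omega> x) \<in> L2 P"
    and "\<omega> \<in> space P \<Longrightarrow> perturbed q \<omega> \<in> L2 N"
proof -
  have prod: "(\<lambda>z. \<Sum>j<r. q j (fst z) * u j (snd z)) \<in> L2 (P \<Otimes>\<^sub>M N)"
    if "\<And>j. j < r \<Longrightarrow> q j \<in> L2 P" for q
    using product_L2[OF that u_L2] by (intro L2_sum) (auto simp: case_prod_unfold)
  show "(\<lambda>z. \<Sum>j<r. q j (fst z) * u j (snd z)) \<in> L2 (P \<Otimes>\<^sub>M N)"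
    using prod[OF q] by simp
  show "(\<lambda>z. perturbed q (fst z) (snd z)) \<in> L2 (P \<Otimes>\<^sub>M N)"
    unfolding perturbed_def resid_def
    using X_L2 prod[OF coef_L2] prod[OF q] by (intro L2_add L2_diff) (auto simp: case_prod_unfold)
  show "x \<in> D \<Longrightarrow> (\<lambda>\<omega>. perturbed q \<omega> x) \<in> L2 P"
    unfolding perturbed_def resid_def
    by (intro L2_intros X_L2_left coef_L2 q) auto
  show "\<omega> \<in> space P \<Longrightarrow> perturbed q \<omega> \<in> L2 N"
    unfolding perturbed_def[abs_def] by (intro L2_intros resid_L2_right u_L2) auto
qed

text \<open>For each \<open>\<omega>\<close> Pythagoras separates the residual from the span, and
  Fubini exchanges the integrals. The versions integrated first over \<open>P\<close> are functions
  of the sample point, ready for \<open>exists_le_average\<close>; \<open>tail\<close> is the part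
  that no choice of coefficients removes.\<close>

lemma perturbed_integrals:
  assumes q: "\<And>j. j < r \<Longrightarrow> q j \<in> L2 P"
  shows "integrable N (\<lambda>x. \<integral>\<omega>. (perturbed q \<omega> x)\<^sup>2 \<partial>P)"
    and "(\<integral>x. (\<integral>\<omega>. (perturbed q \<omega> x)\<^sup>2 \<partial>P) \<partial>N) = tail + (\<Sum>j<r. \<integral>\<omega>. (q j \<omega>)\<^sup>2 \<partial>P)"
    and "(\<integral>\<omega>. (\<integral>x. (perturbed q \<omega> x)\<^sup>2 \<partial>N) \<partial>P) = tail + (\<Sum>j<r. \<integral>\<omega>. (q j \<omega>)\<^sup>2 \<partial>P)"
    and "integrable N (\<lambda>x. \<integral>\<omega>. perturbed q \<omega> x * (\<Sum>j<r. q j \<omega> * u j x) \<partial>P)"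
    and "(\<integral>x. (\<integral>\<omega>. perturbed q \<omega> x * (\<Sum>j<r. q j \<omega> * u j x) \<partial>P) \<partial>N) =
      (\<Sum>j<r. \<integral>\<omega>. (q j \<omega>)\<^sup>2 \<partial>P)"
proof -
  have i1: "integrable (P \<Otimes>\<^sub>M N) (\<lambda>(\<omega>, x). (perturbed q \<omega> x)\<^sup>2)"
    using L2_integrable_square[OF perturbed_L2(1)[of q, OF q]] by (simp add: case_prod_unfold)
  have i2: "integrable (P \<Otimes>\<^sub>M N) (\<lambda>(\<omega>, x). perturbed q \<omega> x * (\<Sum>j<r. q j \<omega> * u j x))"
    using L2_integrable_mult[OF perturbed_L2(1)[of q, OF q] perturbed_L2(2)[of q, OF q]] by (simp add: case_prod_unfold)
  show "integrable N (\<lambda>x. \<integral>\<omega>. (perturbed q \<omega> x)\<^sup>2 \<partial>P)"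
    and "integrable N (\<lambda>x. \<integral>\<omega>. perturbed q \<omega> x * (\<Sum>j<r. q j \<omega> * u j x) \<partial>P)"
    using PN.integrable_snd[OF i1] PN.integrable_snd[OF i2] by auto
  have i0: "integrable (P \<Otimes>\<^sub>M N) (\<lambda>(\<omega>, x). (resid \<omega> x)\<^sup>2)"
    using L2_integrable_square[OF perturbed_L2(1)[of "\<lambda>_ _. 0", OF L2_zero]]
    by (simp add: case_prod_unfold perturbed_def)
  have t: "integrable P (\<lambda>\<omega>. \<integral>x. (resid \<omega> x)\<^sup>2 \<partial>N)"
    using PN.integrable_fst[OF i0] by simp
  have eq: "(\<integral>\<omega>. (\<integral>x. (perturbed q \<omega> x)\<^sup>2 \<partial>N) \<partial>P) =
      (\<integral>\<omega>. (\<integral>x. (resid \<omega> x)\<^sup>2 \<partial>N) + (\<Sum>j<r. (q j \<omega>)\<^sup>2) \<partial>P)"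
    unfolding perturbed_def
    by (intro Bochner_Integration.integral_cong refl
        orthonormal_pythagoras(1)[OF u resid_L2_right resid_orthogonal]) auto
  show *: "(\<integral>\<omega>. (\<integral>x. (perturbed q \<omega> x)\<^sup>2 \<partial>N) \<partial>P) = tail + (\<Sum>j<r. \<integral>\<omega>. (q j \<omega>)\<^sup>2 \<partial>P)"
    unfolding eq tail_def using t L2_integrable_square[OF q]
    by (subst Bochner_Integration.integral_add) (auto simp: Bochner_Integration.integral_sum)
  show "(\<integral>x. (\<integral>\<omega>. (perturbed q \<omega> x)\<^sup>2 \<partial>P) \<partial>N) = tail + (\<Sum>j<r. \<integral>\<omega>. (q j \<omega>)\<^sup>2 \<partial>P)"
    using PN.Fubini_integral[OF i1] * by simp
  have "(\<integral>\<omega>. (\<integral>x. perturbed q \<omega> x * (\<Sum>j<r. q j \<omega> * u j x) \<partial>N) \<partial>P) =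
      (\<integral>\<omega>. (\<Sum>j<r. q j \<omega> * q j \<omega>) \<partial>P)"
    unfolding perturbed_def
    by (intro Bochner_Integration.integral_cong refl
        orthonormal_pythagoras(2)[OF u resid_L2_right resid_orthogonal]) auto
  also have "\<dots> = (\<Sum>j<r. \<integral>\<omega>. (q j \<omega>)\<^sup>2 \<partial>P)"
    using L2_integrable_square[OF q] by (subst Bochner_Integration.integral_sum) (auto simp: power2_eq_square)
  finally show "(\<integral>x. (\<integral>\<omega>. perturbed q \<omega> x * (\<Sum>j<r. q j \<omega> * u j x) \<partial>P) \<partial>N) =
      (\<Sum>j<r. \<integral>\<omega>. (q j \<omega>)\<^sup>2 \<partial>P)"
    using PN.Fubini_integral[OF i2] by simp
qed

lemma tail_nonneg: "0 \<le> tail"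
  unfolding tail_def by (intro Bochner_Integration.integral_nonneg) auto

section \<open>Linear estimators built from point values\<close>

definition sampled :: "nat \<Rightarrow> (nat \<Rightarrow> 'a \<Rightarrow> real) \<Rightarrow> bool" where
  "sampled n s \<longleftrightarrow> (\<exists>xs w. (\<forall>i<n. xs i \<in> D) \<and>
     (\<forall>j<r. \<forall>\<omega>. s j \<omega> = (\<Sum>i<n. w i j * X \<omega> (xs i))))"

lemma sampled_zero: "sampled 0 (\<lambda>_ _. 0)"
  by (simp add: sampled_def)

lemma sampled_L2:
  assumes "sampled n s" "j < r"
  shows "s j \<in> L2 P"
proof -
  obtain xs w where xs: "\<And>i. i < n \<Longrightarrow> xs i \<in> D"
    and "\<And>j \<omega>. j < r \<Longrightarrow> s j \<omega> = (\<Sum>i<n. w i j * X \<omega> (xs i))"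
    using assms(1) unfolding sampled_def by blast
  then have "s j = (\<lambda>\<omega>. \<Sum>i<n. w i j * X \<omega> (xs i))" using assms(2) by auto
  then show ?thesis using xs by (auto intro!: L2_intros X_L2_left)
qed

definition err where "err s j \<omega> = coef j \<omega> - s j \<omega>"

lemma err_L2: "sampled n s \<Longrightarrow> j < r \<Longrightarrow> err s j \<in> L2 P"
  unfolding err_def[abs_def] by (intro L2_diff coef_L2 sampled_L2)

lemma perturbed_err: "perturbed (err s) \<omega> x = X \<omega> x - (\<Sum>j<r. s j \<omega> * u j x)"
  by (simp add: perturbed_def resid_def err_def left_diff_distrib sum_subtractf)

text \<open>The true coefficients are unknown to an algorithm, but the residual at \<open>x\<close>
  is \<open>X \<omega> x\<close> minus the value at \<open>x\<close> of the current approximation,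
  hence linear in the old samples and one new one. Any update proportional to it therefore costs a
  single function value.\<close>

lemma sampled_step:
  assumes s: "sampled n s" and x: "x \<in> D"
  shows "sampled (Suc n) (\<lambda>j \<omega>. s j \<omega> + perturbed (err s) \<omega> x * b j)"
proof -
  obtain xs w where xs: "\<And>i. i < n \<Longrightarrow> xs i \<in> D"
    and w: "\<And>j \<omega>. j < r \<Longrightarrow> s j \<omega> = (\<Sum>i<n. w i j * X \<omega> (xs i))"
    using s unfolding sampled_def by blast
  define xs' where "xs' = xs(n := x)"
  \<comment> \<open>The new sample gets weight \<open>b j\<close>; the old weights are corrected by
    the value at \<open>x\<close> of the approximation already built from them.\<close>
  define w' where "w' i j = (if i = n then b j else w i j - b j * (\<Sum>l<r. w i l * u l x))" for i j
  show ?thesis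
    unfolding sampled_def
  proof (intro exI conjI allI impI)
    show "xs' i \<in> D" if "i < Suc n" for i
      using that xs x by (auto simp: xs'_def less_Suc_eq)
    show "s j \<omega> + perturbed (err s) \<omega> x * b j = (\<Sum>i<Suc n. w' i j * X \<omega> (xs' i))" if "j < r" for j \<omega>
    proof -
      have "(\<Sum>l<r. s l \<omega> * u l x) = (\<Sum>l<r. \<Sum>i<n. w i l * X \<omega> (xs i) * u l x)"
        by (intro sum.cong) (auto simp: w sum_distrib_right)
      also have "\<dots> = (\<Sum>i<n. (\<Sum>l<r. w i l * u l x) * X \<omega> (xs i))"
        by (subst sum.swap) (simp add: sum_distrib_right sum_distrib_left mult_ac)
      finally have "(\<Sum>l<r. s l \<omega> * u l x) = \<dots>" .
      then have "s j \<omega> + perturbed (err s) \<omega> x * b j =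
         (\<Sum>i<n. w i j * X \<omega> (xs i)) - (\<Sum>i<n. b j * ((\<Sum>l<r. w i l * u l x) * X \<omega> (xs i))) + b j * X \<omega> x"
        using that by (simp add: w perturbed_err algebra_simps sum_distrib_left[symmetric])
      also have "\<dots> = (\<Sum>i<n. w' i j * X \<omega> (xs' i)) + b j * X \<omega> x"
        by (simp add: w'_def xs'_def sum_subtractf[symmetric] algebra_simps)
      finally show ?thesis by (simp add: w'_def xs'_def)
    qed
  qed
qed

text \<open>A step in direction zero adds a point without changing the coefficients, and
  \<open>D\<close> is nonempty since \<open>N\<close> is a probability measure. The padding brings
  estimators for different ranks \<open>r\<close> to the same number of samples.\<close>

lemma sampled_mono:
  assumes s: "sampled n s" and "n \<le> n'"
  shows "sampled n' s"
  using \<open>n \<le> n'\<close>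
proof (induction n' rule: dec_induct)
  case (step k)
  have "D \<noteq> {}"
    using AE_D by auto
  then obtain x where "x \<in> D" by blast
  from sampled_step[OF step.IH this, of "\<lambda>_. 0"] show ?case by simp
qed (rule s)

lemma orthonormal_combination_square:
  "(\<integral>x. (\<Sum>k<r. b k * u k x)\<^sup>2 \<partial>N) = (\<Sum>k<r. (b k)\<^sup>2)"
  using orthonormal_pythagoras(1)[OF u L2_zero, of b] by simp

definition sqerr where "sqerr s = (\<Sum>j<r. \<integral>\<omega>. (err s j \<omega>)\<^sup>2 \<partial>P)"

text \<open>
  The point is chosen by averaging over the density \<open>K / r\<close>; the projection onto the span of the
  \<open>u j\<close> moves by \<open>\<gamma>\<close> times the residual at \<open>x\<close>, in the direction of the kernel section at \<open>x\<close>.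
\<close>
lemma kaczmarz_step:
  fixes \<gamma> :: real
  assumes s: "sampled n s" and r: "0 < r"
  shows "\<exists>s'. sampled (Suc n) s' \<and>
    sqerr s' \<le> (1 - \<gamma> * (2 - \<gamma>) / r) * sqerr s + \<gamma>\<^sup>2 * tail / r"
proof -
  define K where "K x = (\<Sum>j<r. (u j x)\<^sup>2)" for x
  define p where "p = err s"
  define h where "h \<omega> x = perturbed p \<omega> x" for \<omega> x
  define q where "q \<omega> x = (\<Sum>j<r. p j \<omega> * u j x)" for \<omega> x
  have p: "p j \<in> L2 P" if "j < r" for j
    unfolding p_def using err_L2[OF s that] .
  have hP: "(\<lambda>\<omega>. h \<omega> x) \<in> L2 P" if "x \<in> D" for x
    unfolding h_def using perturbed_L2(3)[of p, OF p that] .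
  have qP: "(\<lambda>\<omega>. q \<omega> x) \<in> L2 P" for x
    unfolding q_def by (intro L2_intros p) auto
  note I = perturbed_integrals[of p, OF p, folded h_def q_def]
  \<comment> \<open>\<open>F x / K x\<close> is the change of \<open>sqerr\<close> caused by a step
    at \<open>x\<close>: the squared length of the move minus twice its inner product with the old
    error.\<close>
  define F where "F x = \<gamma>\<^sup>2 * (\<integral>\<omega>. (h \<omega> x)\<^sup>2 \<partial>P) - 2 * \<gamma> * (\<integral>\<omega>. h \<omega> x * q \<omega> x \<partial>P)" for x
  have B: "(\<Sum>j<r. \<integral>\<omega>. (p j \<omega>)\<^sup>2 \<partial>P) = sqerr s"
    by (simp add: sqerr_def p_def)
  have F: "integrable N F" unfolding F_def using I by auto
  have intF: "(\<integral>x. F x \<partial>N) = \<gamma>\<^sup>2 * (tail + sqerr s) - 2 * \<gamma> * sqerr s"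
    unfolding F_def using I by (simp add: B)
  have K: "integrable N K" unfolding K_def using u_L2 by (auto intro!: L2_integrable_square)
  have intK: "(\<integral>x. K x \<partial>N) = r"
  proof -
    have "(\<integral>x. K x \<partial>N) = (\<Sum>j<r. \<integral>x. u j x * u j x \<partial>N)"
      unfolding K_def power2_eq_square using u_L2
      by (intro Bochner_Integration.integral_sum L2_integrable_mult) auto
    then show ?thesis by (simp add: orthonormalD(2)[OF u])
  qed
  \<comment> \<open>Where the kernel diagonal vanishes all \<open>u j x\<close> vanish, so the cross
    term is zero and \<open>F x\<close> is a multiple of a mean square.\<close>
  have F0: "0 \<le> F x" if "K x = 0" for x
  proof -
    have "u j x = 0" if "j < r" for j
      using that \<open>K x = 0\<close> unfolding K_def by (subst (asm) sum_nonneg_eq_0_iff) auto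
    then show ?thesis unfolding F_def q_def by simp
  qed
  obtain x where x: "x \<in> D" "K x > 0" and Fx: "F x \<le> (\<integral>x. F x \<partial>N) / (\<integral>x. K x \<partial>N) * K x"
    using exists_le_average[OF AE_D F K _ F0] r intK by (auto simp: K_def sum_nonneg)
  define s' where "s' j \<omega> = s j \<omega> + perturbed (err s) \<omega> x * (\<gamma> * u j x / K x)" for j \<omega>
  have s': "sampled (Suc n) s'"
    unfolding s'_def by (rule sampled_step[OF s x(1)])
  have err': "err s' j \<omega> = p j \<omega> - (\<gamma> * u j x / K x) * h \<omega> x" for j \<omega>
    by (simp add: err_def s'_def p_def h_def)
  have "sqerr s' = (\<integral>\<omega>. (\<Sum>j<r. (err s' j \<omega>)\<^sup>2) \<partial>P)"
    unfolding sqerr_def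
    by (subst Bochner_Integration.integral_sum) (auto intro!: L2_integrable_square err_L2[OF s'])
  also have "\<dots> = (\<integral>\<omega>. (\<Sum>j<r. (p j \<omega>)\<^sup>2) + (\<gamma>\<^sup>2 / K x) * (h \<omega> x)\<^sup>2
      - (2 * \<gamma> / K x) * (h \<omega> x * q \<omega> x) \<partial>P)"
  proof (intro Bochner_Integration.integral_cong refl)
    fix \<omega>
    have "(\<Sum>j<r. (err s' j \<omega>)\<^sup>2) = (\<Sum>j<r. (p j \<omega>)\<^sup>2 + (\<gamma>\<^sup>2 / (K x)\<^sup>2 * (h \<omega> x)\<^sup>2) * (u j x)\<^sup>2
        - (2 * \<gamma> / K x * h \<omega> x) * (p j \<omega> * u j x))"
      unfolding err' using x by (intro sum.cong) (auto simp: field_simps power2_eq_square)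
    also have "\<dots> = (\<Sum>j<r. (p j \<omega>)\<^sup>2) + (\<gamma>\<^sup>2 / (K x)\<^sup>2 * (h \<omega> x)\<^sup>2) * K x
        - (2 * \<gamma> / K x * h \<omega> x) * q \<omega> x"
      unfolding sum.distrib sum_subtractf sum_distrib_left[symmetric] K_def q_def ..
    finally show "(\<Sum>j<r. (err s' j \<omega>)\<^sup>2) = (\<Sum>j<r. (p j \<omega>)\<^sup>2) + (\<gamma>\<^sup>2 / K x) * (h \<omega> x)\<^sup>2
      - (2 * \<gamma> / K x) * (h \<omega> x * q \<omega> x)"
      using x by (simp add: power2_eq_square)
  qed
  also have "\<dots> = sqerr s + F x / K x"
  proof -
    note int = L2_integrable_square[OF p] L2_integrable_square[OF hP[OF x(1)]]
      L2_integrable_mult[OF hP[OF x(1)] qP]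
    have "integrable P (\<lambda>\<omega>. \<Sum>j<r. (p j \<omega>)\<^sup>2)" using int(1) by auto
    moreover have "(\<integral>\<omega>. (\<Sum>j<r. (p j \<omega>)\<^sup>2) \<partial>P) = (\<Sum>j<r. \<integral>\<omega>. (p j \<omega>)\<^sup>2 \<partial>P)"
      using int(1) by (intro Bochner_Integration.integral_sum) auto
    ultimately show ?thesis
      unfolding B[symmetric] F_def using int(2,3)
      by (simp add: diff_divide_distrib)
  qed
  also have "\<dots> \<le> sqerr s + (\<integral>x. F x \<partial>N) / r"
    using Fx x by (simp add: intK field_simps)
  also have "\<dots> = (1 - \<gamma> * (2 - \<gamma>) / r) * sqerr s + \<gamma>\<^sup>2 * tail / r"
    using r unfolding intF by (simp add: field_simps power2_eq_square)
  finally show ?thesis using s' by blast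
qed

text \<open>
  A derandomised form of volume sampling: the part of the error outside the range of \<open>Q\<close> grows by
  the factor \<open>1 + 1 / (r - n)\<close> in step \<open>n\<close>, and these factors telescope.
\<close>
lemma greedy_samples:
  assumes "n \<le> r"
  shows "\<exists>s Q. sampled n s \<and> projection_matrix r Q \<and> (\<Sum>j<r. Q j j) = real r - real n \<and>
    tail + (\<Sum>j<r. \<integral>\<omega>. (err s j \<omega> - (\<Sum>k<r. Q j k * err s k \<omega>))\<^sup>2 \<partial>P) \<le>
      (real r + 1) / (real r + 1 - real n) * tail"
  using assms
proof (induction n)
  case 0
  \<comment> \<open>At the start the remaining subspace is the whole span, so no error lies outside
    it.\<close>
  define I :: "nat \<Rightarrow> nat \<Rightarrow> real" where "I i j = (if i = j then 1 else 0)" for i j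
  have I: "(\<Sum>j<r. I i j * y j) = y i" if "i < r" for i y
  proof -
    have "(\<Sum>j<r. I i j * y j) = (\<Sum>j<r. if i = j then y j else 0)"
      by (intro sum.cong) (auto simp: I_def)
    then show ?thesis using that by simp
  qed
  have "projection_matrix r I"
    unfolding projection_matrix_def using I by (auto simp: I_def)
  moreover have "(\<Sum>j<r. \<integral>\<omega>. (err s j \<omega> - (\<Sum>k<r. I j k * err s k \<omega>))\<^sup>2 \<partial>P) = 0" for s
    by (intro sum.neutral) (auto simp: I)
  moreover have "(\<Sum>j<r. I j j) = r"
    by (simp add: I_def)
  ultimately show ?case
    by (intro exI[of _ "\<lambda>_ _. 0"] exI[of _ I]) (auto simp: sampled_zero)
next
  case (Suc n)
  then obtain s Q where s: "sampled n s" and Q: "projection_matrix r Q"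
    and tr: "(\<Sum>j<r. Q j j) = real r - real n"
    and \<Phi>: "tail + (\<Sum>j<r. \<integral>\<omega>. (err s j \<omega> - (\<Sum>k<r. Q j k * err s k \<omega>))\<^sup>2 \<partial>P) \<le>
      (real r + 1) / (real r + 1 - real n) * tail"
    by (auto simp: Suc_le_eq)
  have n: "n < r" using Suc by simp
  define p where "p = err s"
  define q where "q j \<omega> = p j \<omega> - (\<Sum>k<r. Q j k * p k \<omega>)" for j \<omega>
  have p: "p j \<in> L2 P" if "j < r" for j
    unfolding p_def using err_L2[OF s that] .
  have q: "q j \<in> L2 P" if "j < r" for j
    unfolding q_def[abs_def] using that by (intro L2_intros p) auto
  \<comment> \<open>The potential equals the mean energy of \<open>perturbed q\<close>. One step
    adds at most \<open>\<phi> / (r - n)\<close>, because the integral of \<open>F\<close> is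
    \<open>\<phi>\<close> and that of \<open>K\<close> is the remaining dimension
    \<open>r - n\<close>.\<close>
  define \<phi> where "\<phi> = tail + (\<Sum>j<r. \<integral>\<omega>. (q j \<omega>)\<^sup>2 \<partial>P)"
  define a where "a x j = (\<Sum>k<r. Q j k * u k x)" for x j
  define K where "K x = (\<Sum>j<r. (a x j)\<^sup>2)" for x
  have defl: "projection_deflation r Q" using Q by unfold_locales
  have a_eq: "projection_deflation.a r Q (\<lambda>j. u j x) = a x" for x
    by (auto simp: projection_deflation.a_def[OF defl] a_def)
  have K_eq: "projection_deflation.K r Q (\<lambda>j. u j x) = K x" for x
    by (auto simp: projection_deflation.K_def[OF defl] a_eq K_def)
  define F where "F x = (\<integral>\<omega>. (perturbed q \<omega> x)\<^sup>2 \<partial>P)" for x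
  note I = perturbed_integrals[of q, OF q]
  have F: "integrable N F" unfolding F_def by (rule I(1))
  have intF: "(\<integral>x. F x \<partial>N) = \<phi>" unfolding F_def \<phi>_def by (rule I(2))
  have aL2: "(\<lambda>x. a x j) \<in> L2 N" for j
    unfolding a_def by (intro L2_intros u_L2) auto
  have K: "integrable N K"
    unfolding K_def using aL2 by (auto intro!: L2_integrable_square)
  have "(\<integral>x. K x \<partial>N) = (\<Sum>j<r. \<integral>x. (a x j)\<^sup>2 \<partial>N)"
    unfolding K_def using aL2
    by (subst Bochner_Integration.integral_sum) (auto simp: L2_integrable_square)
  also have "\<dots> = real r - real n"
    unfolding a_def orthonormal_combination_square using projection_matrix_trace[OF Q] tr by simp
  finally have intK: "(\<integral>x. K x \<partial>N) = real r - real n" .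
  obtain x where x: "x \<in> D" "K x > 0" and Fx: "F x \<le> (\<integral>x. F x \<partial>N) / (\<integral>x. K x \<partial>N) * K x"
    using exists_le_average[OF AE_D F K] n intK by (auto simp: K_def F_def sum_nonneg)
  \<comment> \<open>A full step along the kernel section: the sum of the
    \<open>a x j * u j x\<close> is \<open>K x\<close>, so the new approximation interpolates at
    \<open>x\<close>.\<close>
  define s' where "s' j \<omega> = s j \<omega> + perturbed (err s) \<omega> x * (a x j / K x)" for j \<omega>
  define Q' where "Q' j k = Q j k - a x j * a x k / K x" for j k
  have Q'_eq: "projection_deflation.Q' r Q (\<lambda>j. u j x) = Q'"
    by (intro ext) (simp add: projection_deflation.Q'_def[OF defl] a_eq K_eq Q'_def)
  have K0: "projection_deflation.K r Q (\<lambda>j. u j x) \<noteq> 0" using x by (simp add: K_eq)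
  have s': "sampled (Suc n) s'"
    unfolding s'_def by (rule sampled_step[OF s x(1)])
  have err': "err s' j \<omega> = p j \<omega> - (resid \<omega> x + (\<Sum>j<r. p j \<omega> * u j x)) * a x j / K x" for j \<omega>
    by (simp add: err_def s'_def p_def perturbed_def)
  have res': "(\<Sum>i<r. (err s' i \<omega> - (\<Sum>k<r. Q' i k * err s' k \<omega>))\<^sup>2) =
      (\<Sum>i<r. (q i \<omega>)\<^sup>2) + (perturbed q \<omega> x)\<^sup>2 / K x" for \<omega>
    using projection_deflation.deflate_residual_norm[OF defl K0, where y = "resid \<omega> x" and p = "\<lambda>j. p j \<omega>"]
    unfolding err' a_eq K_eq Q'_eq q_def perturbed_def .
  have e': "(\<lambda>\<omega>. err s' i \<omega> - (\<Sum>k<r. Q' i k * err s' k \<omega>)) \<in> L2 P" if "i < r" for i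
    using that by (intro L2_intros err_L2[OF s']) auto
  have "(\<Sum>j<r. \<integral>\<omega>. (err s' j \<omega> - (\<Sum>k<r. Q' j k * err s' k \<omega>))\<^sup>2 \<partial>P) =
      (\<integral>\<omega>. (\<Sum>i<r. (err s' i \<omega> - (\<Sum>k<r. Q' i k * err s' k \<omega>))\<^sup>2) \<partial>P)"
    by (rule Bochner_Integration.integral_sum[symmetric]) (auto intro!: L2_integrable_square e')
  also have "\<dots> = (\<Sum>j<r. \<integral>\<omega>. (q j \<omega>)\<^sup>2 \<partial>P) + F x / K x"
  proof -
    have "integrable P (\<lambda>\<omega>. \<Sum>j<r. (q j \<omega>)\<^sup>2)" using L2_integrable_square[OF q] by auto
    moreover have "(\<integral>\<omega>. (\<Sum>j<r. (q j \<omega>)\<^sup>2) \<partial>P) = (\<Sum>j<r. \<integral>\<omega>. (q j \<omega>)\<^sup>2 \<partial>P)"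
      using L2_integrable_square[OF q] by (intro Bochner_Integration.integral_sum) auto
    ultimately show ?thesis
      unfolding res' F_def using L2_integrable_square[OF perturbed_L2(3)[of q, OF q x(1)]]
      by simp
  qed
  also have "\<dots> \<le> (\<Sum>j<r. \<integral>\<omega>. (q j \<omega>)\<^sup>2 \<partial>P) + \<phi> / (real r - real n)"
    using Fx x n by (simp add: intK intF field_simps)
  finally have "tail + (\<Sum>j<r. \<integral>\<omega>. (err s' j \<omega> - (\<Sum>k<r. Q' j k * err s' k \<omega>))\<^sup>2 \<partial>P) \<le>
      \<phi> * ((real r + 1 - real n) / (real r - real n))"
    using n by (simp add: \<phi>_def field_simps)
  also have "\<dots> \<le> (real r + 1) / (real r + 1 - real n) * tail *
      ((real r + 1 - real n) / (real r - real n))"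
    using \<Phi> n unfolding \<phi>_def q_def p_def by (intro mult_right_mono) auto
  also have "\<dots> = (real r + 1) / (real r + 1 - real (Suc n)) * tail"
  proof -
    have "real r + 1 - real n \<noteq> 0" "real r + 1 - real (Suc n) = real r - real n" using n by auto
    then show ?thesis by simp
  qed
  finally show ?case
    using s' projection_deflation.deflate_projection[OF defl K0]
      projection_deflation.deflate_trace[OF defl K0] tr
    unfolding Q'_eq by (intro exI[of _ s'] exI[of _ Q']) auto
qed

text \<open>After \<open>r\<close> steps the remaining projection has trace zero, hence is zero, and
  the whole coefficient error lies outside its range, where the potential controls it.\<close>

lemma greedy_complete: "\<exists>s. sampled r s \<and> sqerr s \<le> real r * tail"
proof -
  obtain s Q where s: "sampled r s" and Q: "projection_matrix r Q" and tr: "(\<Sum>j<r. Q j j) = 0"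
    and le: "tail + (\<Sum>j<r. \<integral>\<omega>. (err s j \<omega> - (\<Sum>k<r. Q j k * err s k \<omega>))\<^sup>2 \<partial>P) \<le>
      (real r + 1) * tail"
    using greedy_samples[of r] by auto
  have "(\<Sum>i<r. \<Sum>j<r. (Q i j)\<^sup>2) = 0"
    using projection_matrix_trace[OF Q] tr by simp
  then have "(\<Sum>j<r. (Q i j)\<^sup>2) = 0" if "i < r" for i
    using that by (subst (asm) sum_nonneg_eq_0_iff) (auto intro: sum_nonneg)
  then have "Q i j = 0" if "i < r" "j < r" for i j
    using that by (subst (asm) sum_nonneg_eq_0_iff) auto
  then have "tail + sqerr s \<le> (real r + 1) * tail"
    using le by (simp add: sqerr_def)
  then have "sqerr s \<le> real r * tail" by (simp add: distrib_right)
  with s show ?thesis by blast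
qed

text \<open>The first \<open>r\<close> points bring the error to \<open>r * tail\<close>; then
  \<open>n\<close> Kaczmarz steps follow the recursion \<open>e \<mapsto> (1 - \<gamma> / r) * e +
  \<gamma>\<^sup>2 * tail / r\<close>, whose fixed point is \<open>\<gamma> * tail\<close>.\<close>

lemma sampling_error:
  fixes \<gamma> :: real
  assumes r: "0 < r" and \<gamma>: "0 < \<gamma>" "\<gamma> \<le> 1"
  shows "\<exists>s. sampled (r + n) s \<and>
    sqerr s \<le> ((1 - \<gamma> / r) ^ n * r + \<gamma>) * tail"
proof (induction n)
  case 0
  have "real r * tail \<le> (real r + \<gamma>) * tail"
    using \<gamma> tail_nonneg by (intro mult_right_mono) auto
  moreover obtain s where "sampled r s" "sqerr s \<le> real r * tail"
    using greedy_complete by blast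
  ultimately show ?case by (intro exI[of _ s]) simp
next
  case (Suc n)
  then obtain s where s: "sampled (r + n) s"
    and le: "sqerr s \<le> ((1 - \<gamma> / r) ^ n * r + \<gamma>) * tail" by blast
  obtain s' where s': "sampled (Suc (r + n)) s'"
    and "sqerr s' \<le> (1 - \<gamma> * (2 - \<gamma>) / r) * sqerr s + \<gamma>\<^sup>2 * tail / r"
    using kaczmarz_step[OF s r] by blast
  note this(2)
  \<comment> \<open>As \<open>\<gamma> \<le> 1\<close>, the factor \<open>2 - \<gamma>\<close> is at
    least one; dropping it makes \<open>\<gamma> * tail\<close> the fixed point.\<close>
  also have "(1 - \<gamma> * (2 - \<gamma>) / r) * sqerr s + \<gamma>\<^sup>2 * tail / r \<le>
      (1 - \<gamma> / r) * sqerr s + \<gamma>\<^sup>2 * tail / r"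
    using \<gamma> r by (intro add_right_mono mult_right_mono)
      (auto simp: sqerr_def field_simps intro!: sum_nonneg)
  also have "\<dots> \<le> (1 - \<gamma> / r) * (((1 - \<gamma> / r) ^ n * r + \<gamma>) * tail) + \<gamma>\<^sup>2 * tail / r"
    using \<gamma> r le by (intro add_right_mono mult_left_mono) (auto simp: field_simps)
  also have "\<dots> = ((1 - \<gamma> / r) ^ Suc n * r + \<gamma>) * tail"
    using r by (simp add: field_simps power2_eq_square)
  finally show ?case using s' by (intro exI[of _ s']) simp
qed

end

section \<open>Gaussian random variables\<close>

lemma distr_density_integral:
  fixes h :: "'b \<Rightarrow> 'c::{banach, second_countable_topology}"
  assumes "w \<in> borel_measurable M" "\<And>\<omega>. 0 \<le> w \<omega>" "T \<in> measurable M N" "h \<in> borel_measurable N"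
  shows "integral\<^sup>L (distr (density M (\<lambda>\<omega>. ennreal (w \<omega>))) N T) h = (\<integral>\<omega>. w \<omega> *\<^sub>R h (T \<omega>) \<partial>M)"
  using assms by (subst integral_distr) (auto simp: integral_density)

lemma integral_pos_neg_parts:
  fixes W h :: "'a \<Rightarrow> real"
  assumes W: "W \<in> borel_measurable M" and h [measurable]: "h \<in> borel_measurable M"
    and int: "integrable M (\<lambda>x. W x * h x)"
  shows "(\<integral>x. W x * h x \<partial>M) = (\<integral>x. max 0 (W x) * h x \<partial>M) - (\<integral>x. max 0 (- W x) * h x \<partial>M)"
proof -
  note [measurable] = W
  have "integrable M (\<lambda>x. max 0 (W x) * h x)" "integrable M (\<lambda>x. max 0 (- W x) * h x)"
    by (rule Bochner_Integration.integrable_bound[OF int]; auto simp: abs_mult mult_right_mono)+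
  then have "(\<integral>x. max 0 (W x) * h x \<partial>M) - (\<integral>x. max 0 (- W x) * h x \<partial>M) =
      (\<integral>x. max 0 (W x) * h x - max 0 (- W x) * h x \<partial>M)"
    by simp
  also have "\<dots> = (\<integral>x. W x * h x \<partial>M)"
    by (intro Bochner_Integration.integral_cong) (auto simp: max_def)
  finally show ?thesis by simp
qed

lemma integrable_mult_bounded:
  fixes W h :: "'a \<Rightarrow> real"
  assumes "integrable M W" "h \<in> borel_measurable M" "\<And>x. \<bar>h x\<bar> \<le> 1"
  shows "integrable M (\<lambda>x. W x * h x)"
  by (rule Bochner_Integration.integrable_bound[OF assms(1)])
    (use assms in \<open>auto simp: abs_mult mult_left_le\<close>)

section \<open>Vanishing Fourier transforms and orthogonality to functions of several
  variables\<close>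

definition trig_orthogonal :: "'a measure \<Rightarrow> ('a \<Rightarrow> real) \<Rightarrow> ('a \<Rightarrow> real) \<Rightarrow> bool" where
  "trig_orthogonal M W Y \<longleftrightarrow> (\<integral>\<omega>. W \<omega> * cos (Y \<omega>) \<partial>M) = 0 \<and> (\<integral>\<omega>. W \<omega> * sin (Y \<omega>) \<partial>M) = 0"

text \<open>The positive and negative parts of \<open>W\<close>, of equal mass \<open>m\<close> by
  the case \<open>t = 0\<close>, are normalised and pushed forward by \<open>Y\<close> to two laws
  on the line. Their characteristic functions agree by hypothesis, so the Levy uniqueness theorem
  identifies them. For \<open>m = 0\<close> normalisation is impossible, but then \<open>W\<close>
  vanishes almost everywhere.\<close>

lemma trig_orthogonal_indicator:
  fixes W Y :: "'a \<Rightarrow> real"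
  assumes W: "integrable M W" and Y [measurable]: "Y \<in> borel_measurable M"
    and trig: "\<And>t. trig_orthogonal M W (\<lambda>\<omega>. t * Y \<omega>)"
    and B [measurable]: "B \<in> sets borel"
  shows "(\<integral>\<omega>. W \<omega> * indicator B (Y \<omega>) \<partial>M) = 0"
proof -
  note [measurable] = borel_measurable_integrable[OF W]
  define p where "p \<omega> = max 0 (W \<omega>)" for \<omega>
  define n where "n \<omega> = max 0 (- W \<omega>)" for \<omega>
  have [measurable]: "p \<in> borel_measurable M" "n \<in> borel_measurable M"
    unfolding p_def[abs_def] n_def[abs_def] by auto
  have pn0: "0 \<le> p \<omega>" "0 \<le> n \<omega>" for \<omega> by (auto simp: p_def n_def)
  have p: "integrable M p" and n: "integrable M n"
    unfolding p_def n_def using W by auto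
  define m where "m = (\<integral>\<omega>. p \<omega> \<partial>M)"
  have split: "(\<integral>\<omega>. W \<omega> * h \<omega> \<partial>M) = (\<integral>\<omega>. p \<omega> * h \<omega> \<partial>M) - (\<integral>\<omega>. n \<omega> * h \<omega> \<partial>M)"
    if "h \<in> borel_measurable M" "\<And>\<omega>. \<bar>h \<omega>\<bar> \<le> 1" for h
    unfolding p_def n_def
    using that W by (intro integral_pos_neg_parts integrable_mult_bounded) auto
  have mn: "m = (\<integral>\<omega>. n \<omega> \<partial>M)"
    using trig[of 0] split[of "\<lambda>_. 1"] by (simp add: trig_orthogonal_def m_def)
  have m0: "0 \<le> m" unfolding m_def by (intro Bochner_Integration.integral_nonneg pn0)
  show ?thesis
  proof (cases "m = 0")
    case True
    then have "AE \<omega> in M. p \<omega> = 0" "AE \<omega> in M. n \<omega> = 0"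
      using integral_nonneg_eq_0_iff_AE[OF p] integral_nonneg_eq_0_iff_AE[OF n] pn0 mn m_def by auto
    then have "AE \<omega> in M. W \<omega> * indicator B (Y \<omega>) = 0"
      by eventually_elim (auto simp: p_def n_def max_def split: if_splits)
    then show ?thesis by (rule integral_eq_zero_AE)
  next
    case False
    with m0 have m: "m > 0" by simp
    define L where "L w = distr (density M (\<lambda>\<omega>. ennreal (w \<omega> / m))) borel Y" for w
    have rd: "real_distribution (L w)"
      if "integrable M w" "\<And>\<omega>. 0 \<le> w \<omega>" "(\<integral>\<omega>. w \<omega> \<partial>M) = m" for w
    proof -
      have "prob_space (density M (\<lambda>\<omega>. ennreal (w \<omega> / m)))"
      proof (rule prob_spaceI)
        have "(\<integral>\<^sup>+\<omega>. ennreal (w \<omega> / m) \<partial>M) = ennreal (\<integral>\<omega>. w \<omega> / m \<partial>M)"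
          using that m by (intro nn_integral_eq_integral) auto
        then show "emeasure (density M (\<lambda>\<omega>. ennreal (w \<omega> / m))) (space (density M (\<lambda>\<omega>. ennreal (w \<omega> / m)))) = 1"
          using that m borel_measurable_integrable[OF that(1)]
          by (simp add: emeasure_density cong: nn_integral_cong)
      qed
      then show ?thesis
        unfolding L_def by (rule prob_space.real_distribution_distr) simp
    qed
    have L_int: "integral\<^sup>L (L w) h = (\<integral>\<omega>. (w \<omega> / m) *\<^sub>R h (Y \<omega>) \<partial>M)"
      if "integrable M w" "\<And>\<omega>. 0 \<le> w \<omega>" "h \<in> borel_measurable borel"
      for w and h :: "real \<Rightarrow> 'c::{banach, second_countable_topology}"
      unfolding L_def using that m by (intro distr_density_integral) auto
    have char: "char (L w) t = Complex ((\<integral>\<omega>. w \<omega> * cos (t * Y \<omega>) \<partial>M) / m) ((\<integral>\<omega>. w \<omega> * sin (t * Y \<omega>) \<partial>M) / m)"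
      if w: "integrable M w" "\<And>\<omega>. 0 \<le> w \<omega>" for w t
    proof -
      have [measurable]: "w \<in> borel_measurable M" using w by auto
      have eq: "char (L w) t = (\<integral>\<omega>. (w \<omega> / m) *\<^sub>R iexp (t * Y \<omega>) \<partial>M)"
        unfolding char_def using w by (subst L_int) auto
      have int: "integrable M (\<lambda>\<omega>. (w \<omega> / m) *\<^sub>R iexp (t * Y \<omega>))"
        using w m by (intro Bochner_Integration.integrable_bound[OF integrable_divide[OF w(1), of m]])
          (auto simp: norm_mult)
      show ?thesis
        unfolding eq complex_eq_iff integral_Re[OF int, symmetric] integral_Im[OF int, symmetric]
        by (simp add: Re_exp Im_exp)
    qed
    have "char (L p) = char (L n)"
    proof
      fix t
      show "char (L p) t = char (L n) t"
        using trig[of t] split[of "\<lambda>\<omega>. cos (t * Y \<omega>)"] split[of "\<lambda>\<omega>. sin (t * Y \<omega>)"]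
        by (simp add: char p n pn0 trig_orthogonal_def)
    qed
    then have "L p = L n"
      using rd[OF p pn0(1) m_def[symmetric]] rd[OF n pn0(2) mn[symmetric]] by (intro Levy_uniqueness)
    then have "(\<integral>\<omega>. p \<omega> / m * indicator B (Y \<omega>) \<partial>M) = (\<integral>\<omega>. n \<omega> / m * indicator B (Y \<omega>) \<partial>M)"
      using L_int[OF p pn0(1), of "indicator B :: real \<Rightarrow> real"]
        L_int[OF n pn0(2), of "indicator B :: real \<Rightarrow> real"] by simp
    then have "(\<integral>\<omega>. p \<omega> * indicator B (Y \<omega>) \<partial>M) = (\<integral>\<omega>. n \<omega> * indicator B (Y \<omega>) \<partial>M)"
      using m by simp
    then show ?thesis
      by (subst split) (auto simp: indicator_def)
  qed
qed

text \<open>Product-to-sum formulas transfer a trigonometric factor of \<open>Y\<close> from the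
  phase into the weight, leaving a phase in \<open>Z\<close> alone. This isolates one coordinate in
  \<open>trig_orthogonal_boxes\<close>.\<close>

lemma trig_orthogonal_split:
  fixes W Y Z :: "'a \<Rightarrow> real"
  assumes W: "integrable M W" and [measurable]: "Y \<in> borel_measurable M" "Z \<in> borel_measurable M"
    and "trig_orthogonal M W (\<lambda>\<omega>. Y \<omega> + Z \<omega>)" "trig_orthogonal M W (\<lambda>\<omega>. Y \<omega> - Z \<omega>)"
  shows "trig_orthogonal M (\<lambda>\<omega>. W \<omega> * cos (Y \<omega>)) Z"
    and "trig_orthogonal M (\<lambda>\<omega>. W \<omega> * sin (Y \<omega>)) Z"
proof -
  have i: "integrable M (\<lambda>\<omega>. W \<omega> * cos (h \<omega>))" "integrable M (\<lambda>\<omega>. W \<omega> * sin (h \<omega>))"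
    if [measurable]: "h \<in> borel_measurable M" for h
    using W by (auto intro!: integrable_mult_bounded)
  note i' = i[of "\<lambda>\<omega>. Y \<omega> + Z \<omega>"] i[of "\<lambda>\<omega>. Y \<omega> - Z \<omega>"]
  have "(\<integral>\<omega>. W \<omega> * cos (Y \<omega>) * cos (Z \<omega>) \<partial>M) =
      (\<integral>\<omega>. (W \<omega> * cos (Y \<omega> - Z \<omega>) + W \<omega> * cos (Y \<omega> + Z \<omega>)) / 2 \<partial>M)"
    "(\<integral>\<omega>. W \<omega> * sin (Y \<omega>) * sin (Z \<omega>) \<partial>M) =
      (\<integral>\<omega>. (W \<omega> * cos (Y \<omega> - Z \<omega>) - W \<omega> * cos (Y \<omega> + Z \<omega>)) / 2 \<partial>M)"
    "(\<integral>\<omega>. W \<omega> * sin (Y \<omega>) * cos (Z \<omega>) \<partial>M) =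
      (\<integral>\<omega>. (W \<omega> * sin (Y \<omega> + Z \<omega>) + W \<omega> * sin (Y \<omega> - Z \<omega>)) / 2 \<partial>M)"
    "(\<integral>\<omega>. W \<omega> * cos (Y \<omega>) * sin (Z \<omega>) \<partial>M) =
      (\<integral>\<omega>. (W \<omega> * sin (Y \<omega> + Z \<omega>) - W \<omega> * sin (Y \<omega> - Z \<omega>)) / 2 \<partial>M)"
    by (intro Bochner_Integration.integral_cong refl;
        simp add: cos_add cos_diff sin_add sin_diff algebra_simps)+
  then show "trig_orthogonal M (\<lambda>\<omega>. W \<omega> * cos (Y \<omega>)) Z" "trig_orthogonal M (\<lambda>\<omega>. W \<omega> * sin (Y \<omega>)) Z"
    using assms(4,5) i' by (simp_all add: trig_orthogonal_def)
qed

text \<open>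
  Only the one-dimensional uniqueness theorem for characteristic functions is available, so the
  coordinates are treated one at a time, absorbing the indicators into \<open>W\<close>.
\<close>
lemma trig_orthogonal_boxes:
  fixes Y :: "nat \<Rightarrow> 'a \<Rightarrow> real"
  assumes "integrable M W" "\<And>i. i < n \<Longrightarrow> Y i \<in> borel_measurable M"
    and "\<And>u. trig_orthogonal M W (\<lambda>\<omega>. \<Sum>i<n. u i * Y i \<omega>)"
    and "\<And>i. i < n \<Longrightarrow> B i \<in> sets borel"
  shows "(\<integral>\<omega>. W \<omega> * (\<Prod>i<n. indicator (B i) (Y i \<omega>)) \<partial>M) = 0"
  using assms
proof (induction n arbitrary: W)
  case 0
  then show ?case by (simp add: trig_orthogonal_def)
next
  case (Suc n)
  note Y = Suc.prems(2) and B = Suc.prems(4)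
  have [measurable]: "Y n \<in> borel_measurable M" "B n \<in> sets borel" using Y B by auto
  have Ym: "(\<lambda>\<omega>. \<Sum>i<n. u i * Y i \<omega>) \<in> borel_measurable M" for u
    using Y by (intro borel_measurable_sum) auto
  define W' where "W' \<omega> = W \<omega> * indicator (B n) (Y n \<omega>)" for \<omega>
  have W': "integrable M W'"
    unfolding W'_def[abs_def] using Suc.prems(1)
    by (intro integrable_mult_bounded) (auto simp: indicator_def)
  have "trig_orthogonal M W' (\<lambda>\<omega>. \<Sum>i<n. u i * Y i \<omega>)" for u
  proof -
    define S where "S \<omega> = (\<Sum>i<n. u i * Y i \<omega>)" for \<omega>
    have [measurable]: "S \<in> borel_measurable M" unfolding S_def[abs_def] by (rule Ym)
    \<comment> \<open>The last coordinate enters the phase with coefficient \<open>t\<close>; the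
      splitting uses both signs of \<open>t\<close>.\<close>
    have a: "trig_orthogonal M W (\<lambda>\<omega>. S \<omega> + t * Y n \<omega>)" for t
      using Suc.prems(3)[of "u(n := t)"] by (simp add: S_def)
    have b: "trig_orthogonal M W (\<lambda>\<omega>. S \<omega> - t * Y n \<omega>)" for t
      using a[of "- t"] by simp
    have [measurable]: "(\<lambda>\<omega>. t * Y n \<omega>) \<in> borel_measurable M" for t by simp
    note c = trig_orthogonal_split[OF Suc.prems(1) \<open>S \<in> borel_measurable M\<close> this a b]
    have i: "integrable M (\<lambda>\<omega>. W \<omega> * cos (S \<omega>))" "integrable M (\<lambda>\<omega>. W \<omega> * sin (S \<omega>))"
      using Suc.prems(1) by (auto intro!: integrable_mult_bounded)
    have "(\<integral>\<omega>. W \<omega> * cos (S \<omega>) * indicator (B n) (Y n \<omega>) \<partial>M) = 0"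
      "(\<integral>\<omega>. W \<omega> * sin (S \<omega>) * indicator (B n) (Y n \<omega>) \<partial>M) = 0"
      using i c by (intro trig_orthogonal_indicator; simp)+
    then show ?thesis
      by (simp add: trig_orthogonal_def W'_def S_def mult_ac)
  qed
  from Suc.IH[OF W' _ this] Y B
  have "(\<integral>\<omega>. W' \<omega> * (\<Prod>i<n. indicator (B i) (Y i \<omega>)) \<partial>M) = 0" by auto
  then show ?case by (simp add: W'_def mult_ac)
qed

text \<open>The images under \<open>T n\<close> of the positive and negative parts of
  \<open>W\<close> are finite measures that agree on boxes, a generator stable under intersection,
  and so coincide; every measurable \<open>h\<close> then has the same integral against both. Only
  the product with \<open>W\<close> is assumed integrable, so \<open>h\<close> may be
  unbounded.\<close>

lemma boxes_orthogonal:
  fixes Y :: "nat \<Rightarrow> 'a \<Rightarrow> real" and h :: "(nat \<Rightarrow> real) \<Rightarrow> real"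
  defines "T \<equiv> \<lambda>n \<omega>. restrict (\<lambda>i. Y i \<omega>) {..<n}"
  assumes W: "integrable M W" and Y: "\<And>i. i < n \<Longrightarrow> Y i \<in> borel_measurable M"
    and boxes: "\<And>B. (\<And>i. i < n \<Longrightarrow> B i \<in> sets borel) \<Longrightarrow>
      (\<integral>\<omega>. W \<omega> * (\<Prod>i<n. indicator (B i) (Y i \<omega>)) \<partial>M) = 0"
    and h: "h \<in> borel_measurable (PiM {..<n} (\<lambda>_. lborel))"
    and int: "integrable M (\<lambda>\<omega>. W \<omega> * h (T n \<omega>))"
  shows "(\<integral>\<omega>. W \<omega> * h (T n \<omega>) \<partial>M) = 0"
proof -
  note [measurable] = borel_measurable_integrable[OF W]
  let ?N = "PiM {..<n} (\<lambda>_. lborel :: real measure)"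
  have T [measurable]: "T n \<in> measurable M ?N"
    unfolding T_def using Y by (intro measurable_restrict) auto
  define L where "L w = distr (density M (\<lambda>\<omega>. ennreal (w \<omega>))) ?N (T n)" for w
  define p where "p \<omega> = max 0 (W \<omega>)" for \<omega>
  define m where "m \<omega> = max 0 (- W \<omega>)" for \<omega>
  have p: "integrable M p" and m: "integrable M m"
    unfolding p_def m_def using W by auto
  have pm0: "0 \<le> p \<omega>" "0 \<le> m \<omega>" for \<omega> by (auto simp: p_def m_def)
  note [measurable] = borel_measurable_integrable[OF p] borel_measurable_integrable[OF m]
  have ind_measurable: "(\<lambda>\<omega>. \<Prod>i<n. indicator (B i) (Y i \<omega>) :: real) \<in> borel_measurable M"
    if "\<And>i. i < n \<Longrightarrow> B i \<in> sets borel" for B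
    using Y that by (intro borel_measurable_prod) (auto intro!: borel_measurable_indicator')
  have ind_bound: "\<bar>\<Prod>i<n. indicator (B i) (Y i \<omega>) :: real\<bar> \<le> 1" for B \<omega>
    unfolding abs_prod by (intro prod_le_1) (auto simp: indicator_def)
  have box: "emeasure (L w) (Pi\<^sub>E {..<n} B) = ennreal (\<integral>\<omega>. w \<omega> * (\<Prod>i<n. indicator (B i) (Y i \<omega>)) \<partial>M)"
    if w: "integrable M w" "\<And>\<omega>. 0 \<le> w \<omega>" and B: "\<And>i. i < n \<Longrightarrow> B i \<in> sets borel" for w B
  proof -
    have [measurable]: "w \<in> borel_measurable M" using w by auto
    have Bs: "Pi\<^sub>E {..<n} B \<in> sets ?N" using B by (intro sets_PiM_I_finite) auto
    have ind: "indicator (T n -` Pi\<^sub>E {..<n} B \<inter> space M) \<omega> = (\<Prod>i<n. indicator (B i) (Y i \<omega>) :: real)"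
      if "\<omega> \<in> space M" for \<omega>
    proof -
      have "T n \<omega> \<in> Pi\<^sub>E {..<n} B \<longleftrightarrow> (\<forall>i<n. Y i \<omega> \<in> B i)"
        unfolding T_def by (auto simp: PiE_iff extensional_def)
      moreover have "(\<Prod>i<n. indicator (B i) (Y i \<omega>) :: real) = (if \<forall>i<n. Y i \<omega> \<in> B i then 1 else 0)"
        by (auto simp: indicator_def intro!: prod_zero)
      ultimately show ?thesis using that by (auto simp: indicator_def)
    qed
    have Bm: "T n -` Pi\<^sub>E {..<n} B \<inter> space M \<in> sets M" using measurable_sets[OF T Bs] .
    have "emeasure (L w) (Pi\<^sub>E {..<n} B) = (\<integral>\<^sup>+\<omega>. ennreal (w \<omega>) * indicator (T n -` Pi\<^sub>E {..<n} B \<inter> space M) \<omega> \<partial>M)"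
      unfolding L_def using Bs Bm by (simp add: emeasure_distr emeasure_density)
    also have "\<dots> = (\<integral>\<^sup>+\<omega>. ennreal (w \<omega> * (\<Prod>i<n. indicator (B i) (Y i \<omega>))) \<partial>M)"
    proof (rule nn_integral_cong)
      fix \<omega> assume "\<omega> \<in> space M"
      show "ennreal (w \<omega>) * indicator (T n -` Pi\<^sub>E {..<n} B \<inter> space M) \<omega> =
          ennreal (w \<omega> * (\<Prod>i<n. indicator (B i) (Y i \<omega>)))"
        unfolding ind[OF \<open>\<omega> \<in> space M\<close>, symmetric] by (auto simp: indicator_def)
    qed
    also have "\<dots> = ennreal (\<integral>\<omega>. w \<omega> * (\<Prod>i<n. indicator (B i) (Y i \<omega>)) \<partial>M)"
    proof (rule nn_integral_eq_integral)
      show "integrable M (\<lambda>\<omega>. w \<omega> * (\<Prod>i<n. indicator (B i) (Y i \<omega>)))"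
        by (intro integrable_mult_bounded w ind_measurable ind_bound B)
    qed (use w in \<open>auto intro!: prod_nonneg mult_nonneg_nonneg\<close>)
    finally show ?thesis .
  qed
  have "L p = L m"
  proof (rule measure_eqI_PiM_finite)
    show "finite {..<n}" "sets (L p) = sets ?N" "sets (L m) = sets ?N" by (auto simp: L_def)
    show "emeasure (L p) (Pi\<^sub>E {..<n} B) = emeasure (L m) (Pi\<^sub>E {..<n} B)"
      if "\<And>i. i \<in> {..<n} \<Longrightarrow> B i \<in> sets lborel" for B
    proof -
      have B: "\<And>i. i < n \<Longrightarrow> B i \<in> sets borel" using that by auto
      have "integrable M (\<lambda>\<omega>. W \<omega> * (\<Prod>i<n. indicator (B i) (Y i \<omega>)))"
        by (intro integrable_mult_bounded W ind_measurable ind_bound B)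
      then have "(\<integral>\<omega>. p \<omega> * (\<Prod>i<n. indicator (B i) (Y i \<omega>)) \<partial>M) =
          (\<integral>\<omega>. m \<omega> * (\<Prod>i<n. indicator (B i) (Y i \<omega>)) \<partial>M)"
        using integral_pos_neg_parts[of W M "\<lambda>\<omega>. \<Prod>i<n. indicator (B i) (Y i \<omega>)"]
          boxes[OF B] ind_measurable[OF B]
        by (simp add: p_def m_def)
      then show ?thesis by (simp add: box p m pm0 B)
    qed
    show "range (\<lambda>_. Pi\<^sub>E {..<n} (\<lambda>_. UNIV)) \<subseteq> prod_algebra {..<n} (\<lambda>_. lborel :: real measure)"
      by (auto intro!: prod_algebraI_finite)
    show "(\<Union>i. Pi\<^sub>E {..<n} (\<lambda>_. UNIV)) = space ?N" by (auto simp: space_PiM)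
    show "emeasure (L p) (Pi\<^sub>E {..<n} (\<lambda>_. UNIV)) \<noteq> \<infinity>" by (subst box[OF p pm0(1)]) auto
  qed
  moreover have "integral\<^sup>L (L p) h = (\<integral>\<omega>. p \<omega> * h (T n \<omega>) \<partial>M)" "integral\<^sup>L (L m) h = (\<integral>\<omega>. m \<omega> * h (T n \<omega>) \<partial>M)"
    unfolding L_def using h pm0 by (subst distr_density_integral; simp)+
  ultimately show ?thesis
    using integral_pos_neg_parts[OF _ _ int] measurable_compose[OF T h] by (simp add: p_def m_def)
qed

section \<open>Gaussian moments and prediction from Gaussian information\<close>

lemma centered_gauss_moments:
  assumes Z [measurable]: "Z \<in> borel_measurable M" and \<sigma>: "0 \<le> \<sigma>"
    and distr: "distr M borel Z = centered_gauss \<sigma>"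
  shows "integrable M (\<lambda>\<omega>. (Z \<omega>)\<^sup>2)" "(\<integral>\<omega>. (Z \<omega>)\<^sup>2 \<partial>M) = \<sigma>\<^sup>2"
    and "integrable M (\<lambda>\<omega>. (Z \<omega>) ^ 4)" "(\<integral>\<omega>. (Z \<omega>) ^ 4 \<partial>M) = 3 * \<sigma> ^ 4"
proof -
  have *: "integrable M (\<lambda>\<omega>. (Z \<omega>) ^ (2 * k)) \<and>
      (\<integral>\<omega>. (Z \<omega>) ^ (2 * k) \<partial>M) = fact (2 * k) / (2 ^ k * fact k) * \<sigma> ^ (2 * k)" if "k > 0" for k
  proof (cases "\<sigma> = 0")
    case True
    have "AE x in distr M borel Z. x = 0"
      unfolding distr centered_gauss_def using True by (simp add: AE_return)
    then have ae: "AE \<omega> in M. (Z \<omega>) ^ (2 * k) = 0"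
      using that by (subst (asm) AE_distr_iff) auto
    have "integrable M (\<lambda>\<omega>. (Z \<omega>) ^ (2 * k))"
      using integrable_cong_AE[THEN iffD2, OF _ _ ae] by simp
    moreover have "(\<integral>\<omega>. (Z \<omega>) ^ (2 * k) \<partial>M) = 0"
      using ae by (rule integral_eq_zero_AE)
    ultimately show ?thesis using True that by simp
  next
    case False
    then have s: "\<sigma> > 0" using \<sigma> by simp
    have d: "distr M borel Z = density lborel (normal_density 0 \<sigma>)"
      using False by (simp add: distr centered_gauss_def)
    have m: "has_bochner_integral lborel (\<lambda>x. normal_density 0 \<sigma> x * x ^ (2 * k))
        (fact (2 * k) / ((2 / \<sigma>\<^sup>2) ^ k * fact k))"
      using normal_moment_even[OF s, of 0 k] by simp
    have "integrable (distr M borel Z) (\<lambda>x. x ^ (2 * k))"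
      unfolding d using m by (subst integrable_density) (auto simp: has_bochner_integral_iff)
    moreover have "(\<integral>x. x ^ (2 * k) \<partial>distr M borel Z) = fact (2 * k) / ((2 / \<sigma>\<^sup>2) ^ k * fact k)"
      unfolding d using m by (subst integral_density) (auto simp: has_bochner_integral_iff)
    moreover have "fact (2 * k) / ((2 / \<sigma>\<^sup>2) ^ k * fact k) = fact (2 * k) / (2 ^ k * fact k) * \<sigma> ^ (2 * k)"
      using s by (simp add: power_divide power_mult)
    ultimately show ?thesis
      by (simp add: integrable_distr_eq integral_distr)
  qed
  show "integrable M (\<lambda>\<omega>. (Z \<omega>)\<^sup>2)" "(\<integral>\<omega>. (Z \<omega>)\<^sup>2 \<partial>M) = \<sigma>\<^sup>2"
    using *[of 1] by simp_all
  show "integrable M (\<lambda>\<omega>. (Z \<omega>) ^ 4)" "(\<integral>\<omega>. (Z \<omega>) ^ 4 \<partial>M) = 3 * \<sigma> ^ 4"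
    using *[of 2] by (simp_all add: fact_numeral)
qed

text \<open>
  Since \<open>s R + S\<close> and \<open>- s R + S\<close> have the same law, \<open>sin (s R)\<close> is orthogonal to all
  trigonometric functions of the \<open>Y i\<close>; dividing by \<open>s\<close> and letting \<open>s\<close> tend to \<open>0\<close> gives the
  claim for \<open>R\<close>.
\<close>
lemma gaussian_uncorrelated_orthogonal:
  fixes R :: "'a \<Rightarrow> real" and Y :: "nat \<Rightarrow> 'a \<Rightarrow> real" and h :: "(nat \<Rightarrow> real) \<Rightarrow> real"
  assumes M: "prob_space M" and R: "R \<in> borel_measurable M"
    and Y: "\<And>i. i < n \<Longrightarrow> Y i \<in> borel_measurable M"
    and gauss: "\<And>s u. \<exists>\<sigma>\<ge>0. distr M borel (\<lambda>\<omega>. s * R \<omega> + (\<Sum>i<n. u i * Y i \<omega>)) = centered_gauss \<sigma>"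
    and unc: "\<And>i. i < n \<Longrightarrow> (\<integral>\<omega>. R \<omega> * Y i \<omega> \<partial>M) = 0"
    and h: "h \<in> borel_measurable (PiM {..<n} (\<lambda>_. lborel))"
    and int: "integrable M (\<lambda>\<omega>. R \<omega> * h (restrict (\<lambda>i. Y i \<omega>) {..<n}))"
  shows "(\<integral>\<omega>. R \<omega> * h (restrict (\<lambda>i. Y i \<omega>) {..<n}) \<partial>M) = 0"
proof -
  interpret prob_space M by fact
  note [measurable] = R
  define S where "S u \<omega> = (\<Sum>i<n. u i * Y i \<omega>)" for u \<omega>
  have S [measurable]: "S u \<in> borel_measurable M" for u
    unfolding S_def[abs_def] using Y by (intro borel_measurable_sum) auto
  have L2: "(\<lambda>\<omega>. s * R \<omega> + S u \<omega>) \<in> L2 M" for s u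
    using gauss[of s u, folded S_def] centered_gauss_moments(1)[of "\<lambda>\<omega>. s * R \<omega> + S u \<omega>" M]
    by (auto simp: L2_def)
  have R2: "R \<in> L2 M"
    using L2[of 1 "\<lambda>_. 0"] by (simp add: S_def)
  have S2: "S u \<in> L2 M" for u
    using L2[of 0 u] by simp
  have Y2: "Y i \<in> L2 M" if "i < n" for i
  proof -
    have "S (\<lambda>j. if j = i then 1 else 0) \<omega> = (\<Sum>j<n. if j = i then Y j \<omega> else 0)" for \<omega>
      unfolding S_def by (intro sum.cong) auto
    then have "S (\<lambda>j. if j = i then 1 else 0) = Y i" using that by auto
    then show ?thesis using S2 by metis
  qed
  have RS: "(\<integral>\<omega>. R \<omega> * S u \<omega> \<partial>M) = 0" for u
  proof -
    have "(\<integral>\<omega>. R \<omega> * S u \<omega> \<partial>M) = (\<integral>\<omega>. (\<Sum>i<n. u i * (R \<omega> * Y i \<omega>)) \<partial>M)"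
      unfolding S_def by (simp add: sum_distrib_left mult_ac)
    also have "\<dots> = (\<Sum>i<n. \<integral>\<omega>. u i * (R \<omega> * Y i \<omega>) \<partial>M)"
      using L2_integrable_mult[OF R2 Y2] by (intro Bochner_Integration.integral_sum) auto
    finally show ?thesis using unc by simp
  qed
  have sq: "(\<integral>\<omega>. (s * R \<omega> + S u \<omega>)\<^sup>2 \<partial>M) = s\<^sup>2 * (\<integral>\<omega>. (R \<omega>)\<^sup>2 \<partial>M) + (\<integral>\<omega>. (S u \<omega>)\<^sup>2 \<partial>M)" for s u
  proof -
    have "(\<integral>\<omega>. (s * R \<omega> + S u \<omega>)\<^sup>2 \<partial>M) =
        (\<integral>\<omega>. s\<^sup>2 * (R \<omega>)\<^sup>2 + 2 * s * (R \<omega> * S u \<omega>) + (S u \<omega>)\<^sup>2 \<partial>M)"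
      by (intro Bochner_Integration.integral_cong) (auto simp: power2_eq_square algebra_simps)
    also have "\<dots> = s\<^sup>2 * (\<integral>\<omega>. (R \<omega>)\<^sup>2 \<partial>M) + 2 * s * (\<integral>\<omega>. R \<omega> * S u \<omega> \<partial>M) + (\<integral>\<omega>. (S u \<omega>)\<^sup>2 \<partial>M)"
      using L2_integrable_square[OF R2] L2_integrable_square[OF S2] L2_integrable_mult[OF R2 S2] by simp
    finally show ?thesis by (simp add: RS)
  qed
  \<comment> \<open>\<open>R\<close> and \<open>S u\<close> are uncorrelated, so by
    \<open>sq\<close> both variables have the same second moment, and this determines a centered
    Gaussian law.\<close>
  have sym: "distr M borel (\<lambda>\<omega>. s * R \<omega> + S u \<omega>) = distr M borel (\<lambda>\<omega>. - s * R \<omega> + S u \<omega>)" for s u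
  proof -
    obtain \<sigma> \<tau> where \<sigma>: "0 \<le> \<sigma>" "distr M borel (\<lambda>\<omega>. s * R \<omega> + S u \<omega>) = centered_gauss \<sigma>"
      and \<tau>: "0 \<le> \<tau>" "distr M borel (\<lambda>\<omega>. - s * R \<omega> + S u \<omega>) = centered_gauss \<tau>"
      using gauss[of s u, folded S_def] gauss[of "- s" u, folded S_def] by blast
    have "\<sigma>\<^sup>2 = (\<integral>\<omega>. (s * R \<omega> + S u \<omega>)\<^sup>2 \<partial>M)" "\<tau>\<^sup>2 = (\<integral>\<omega>. (- s * R \<omega> + S u \<omega>)\<^sup>2 \<partial>M)"
      using centered_gauss_moments(2)[OF _ \<sigma>] centered_gauss_moments(2)[OF _ \<tau>] by simp_all
    then have "\<sigma>\<^sup>2 = \<tau>\<^sup>2" unfolding sq by simp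
    then have "\<sigma> = \<tau>" using \<sigma>(1) \<tau>(1) by simp
    then show ?thesis using \<sigma> \<tau> by simp
  qed
  have eq: "(\<integral>\<omega>. g (s * R \<omega> + S u \<omega>) \<partial>M) = (\<integral>\<omega>. g (- s * R \<omega> + S u \<omega>) \<partial>M)"
    if [measurable]: "g \<in> borel_measurable borel" for g :: "real \<Rightarrow> real" and s u
  proof -
    have "(\<integral>\<omega>. g (s * R \<omega> + S u \<omega>) \<partial>M) = integral\<^sup>L (distr M borel (\<lambda>\<omega>. s * R \<omega> + S u \<omega>)) g"
      by (subst integral_distr) auto
    also have "\<dots> = (\<integral>\<omega>. g (- s * R \<omega> + S u \<omega>) \<partial>M)"
      unfolding sym[of s u] by (subst integral_distr) auto
    finally show ?thesis .
  qed
  have bdd: "integrable M (\<lambda>\<omega>. cos (g \<omega>))" "integrable M (\<lambda>\<omega>. sin (g \<omega>))"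
    if [measurable]: "g \<in> borel_measurable M" for g :: "'a \<Rightarrow> real"
    by (auto intro!: integrable_const_bound[where B = 1])
  have trig: "trig_orthogonal M (\<lambda>\<omega>. sin (s * R \<omega>)) (\<lambda>\<omega>. \<Sum>i<n. u i * Y i \<omega>)" for s u
  proof -
    have "(\<integral>\<omega>. sin (s * R \<omega>) * cos (S u \<omega>) \<partial>M) =
        (\<integral>\<omega>. (sin (s * R \<omega> + S u \<omega>) - sin (- s * R \<omega> + S u \<omega>)) / 2 \<partial>M)"
      "(\<integral>\<omega>. sin (s * R \<omega>) * sin (S u \<omega>) \<partial>M) =
        (\<integral>\<omega>. (cos (- s * R \<omega> + S u \<omega>) - cos (s * R \<omega> + S u \<omega>)) / 2 \<partial>M)"
      by (intro Bochner_Integration.integral_cong refl; simp add: cos_add sin_add cos_diff sin_diff)+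
    then show ?thesis
      unfolding trig_orthogonal_def S_def[symmetric] using eq[of sin s u] eq[of cos s u] bdd by simp
  qed
  have ind_measurable: "(\<lambda>\<omega>. \<Prod>i<n. indicator (B i) (Y i \<omega>) :: real) \<in> borel_measurable M"
    if "\<And>i. i < n \<Longrightarrow> B i \<in> sets borel" for B
    using Y that by (intro borel_measurable_prod) (auto intro!: borel_measurable_indicator')
  have ind_bound: "\<bar>\<Prod>i<n. indicator (B i) (Y i \<omega>) :: real\<bar> \<le> 1" for B \<omega>
    unfolding abs_prod by (intro prod_le_1) (auto simp: indicator_def)
  have boxes: "(\<integral>\<omega>. R \<omega> * (\<Prod>i<n. indicator (B i) (Y i \<omega>)) \<partial>M) = 0"
    if B: "\<And>i. i < n \<Longrightarrow> B i \<in> sets borel" for B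
  proof -
    define I where "I \<omega> = (\<Prod>i<n. indicator (B i) (Y i \<omega>) :: real)" for \<omega>
    have [measurable]: "I \<in> borel_measurable M" unfolding I_def[abs_def] by (rule ind_measurable[OF B])
    have I1: "\<bar>I \<omega>\<bar> \<le> 1" for \<omega> unfolding I_def by (rule ind_bound)
    \<comment> \<open>This is \<open>s = 1 / (k + 1)\<close>; dividing \<open>sin (s R)\<close> by
      \<open>s\<close> approximates \<open>R\<close> and stays below its absolute value because
      \<open>\<bar>sin y\<bar> \<le> \<bar>y\<bar>\<close>.\<close>
    define f where "f k \<omega> = real (Suc k) * sin (1 / real (Suc k) * R \<omega>) * I \<omega>" for k \<omega>
    have f0: "(\<integral>\<omega>. f k \<omega> \<partial>M) = 0" for k
    proof -
      have "(\<integral>\<omega>. sin (1 / real (Suc k) * R \<omega>) * I \<omega> \<partial>M) = 0"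
        unfolding I_def by (intro trig_orthogonal_boxes Y B trig bdd) simp_all
      then show ?thesis by (simp add: f_def mult.assoc del: of_nat_Suc)
    qed
    have lim: "(\<lambda>k. f k \<omega>) \<longlonglongrightarrow> R \<omega> * I \<omega>" for \<omega>
    proof (cases "R \<omega> = 0")
      case False
      have "filterlim (\<lambda>k. R \<omega> / real (Suc k)) (at 0) sequentially"
        using False LIMSEQ_Suc[OF lim_const_over_n[of "R \<omega>"]]
        by (intro filterlim_atI) (auto simp del: of_nat_Suc)
      from tendsto_mult[OF tendsto_const filterlim_compose[OF sinc_at_0 this], of "R \<omega> * I \<omega>"]
      show ?thesis
        by (rule filterlim_cong[THEN iffD1, rotated -1])
          (use False in \<open>auto simp: f_def field_simps\<close>)
    qed (simp add: f_def)
    have "(\<lambda>k. \<integral>\<omega>. f k \<omega> \<partial>M) \<longlonglongrightarrow> (\<integral>\<omega>. R \<omega> * I \<omega> \<partial>M)"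
    proof (rule integral_dominated_convergence[where w = "\<lambda>\<omega>. \<bar>R \<omega>\<bar>"])
      show "integrable M (\<lambda>\<omega>. \<bar>R \<omega>\<bar>)"
        using L2_integrable[OF finite_measure_axioms R2] by simp
      show "AE \<omega> in M. norm (f k \<omega>) \<le> \<bar>R \<omega>\<bar>" for k
      proof (rule AE_I2)
        fix \<omega>
        have "\<bar>real (Suc k) * sin (1 / real (Suc k) * R \<omega>)\<bar> \<le> real (Suc k) * \<bar>1 / real (Suc k) * R \<omega>\<bar>"
          unfolding abs_mult using abs_sin_x_le_abs_x[of "1 / real (Suc k) * R \<omega>"]
          by (intro mult_mono) (auto simp: abs_mult)
        also have "\<dots> = \<bar>R \<omega>\<bar>" by (simp add: abs_mult del: of_nat_Suc)
        finally show "norm (f k \<omega>) \<le> \<bar>R \<omega>\<bar>"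
          unfolding f_def real_norm_def abs_mult[of _ "I \<omega>"] using I1[of \<omega>]
          by (meson abs_ge_zero mult_left_le order_trans)
      qed
      show "AE \<omega> in M. (\<lambda>k. f k \<omega>) \<longlonglongrightarrow> R \<omega> * I \<omega>" using lim by simp
    qed (auto simp: f_def)
    then show ?thesis by (simp add: f0 LIMSEQ_const_iff I_def)
  qed
  show ?thesis
    using boxes_orthogonal[OF L2_integrable[OF finite_measure_axioms R2] Y boxes h int] .
qed

text \<open>The cross term of the expanded square vanishes. If the right side is infinite the claim
  is trivial; otherwise \<open>g = R - (R - g)\<close> is square integrable, which supplies the
  integrability that \<open>orth\<close> asks for.\<close>

lemma orthogonal_best_approximation:
  fixes R :: "'a \<Rightarrow> real" and g :: "'a \<Rightarrow> real"
  assumes R: "R \<in> L2 M" and g [measurable]: "g \<in> borel_measurable M"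
    and orth: "integrable M (\<lambda>\<omega>. R \<omega> * g \<omega>) \<Longrightarrow> (\<integral>\<omega>. R \<omega> * g \<omega> \<partial>M) = 0"
  shows "(\<integral>\<^sup>+\<omega>. ennreal ((R \<omega>)\<^sup>2) \<partial>M) \<le> (\<integral>\<^sup>+\<omega>. ennreal ((R \<omega> - g \<omega>)\<^sup>2) \<partial>M)"
proof (cases "(\<integral>\<^sup>+\<omega>. ennreal ((R \<omega> - g \<omega>)\<^sup>2) \<partial>M) = \<infinity>")
  case False
  note [measurable] = L2_measurable[OF R]
  have d: "(\<lambda>\<omega>. R \<omega> - g \<omega>) \<in> L2 M"
    using False by (auto simp: L2_def integrable_iff_bounded less_top)
  have gL: "g \<in> L2 M"
    using L2_diff[OF R d] by simp
  have Rg: "(\<integral>\<omega>. R \<omega> * g \<omega> \<partial>M) = 0"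
    using orth[OF L2_integrable_mult[OF R gL]] .
  have "(\<integral>\<omega>. (R \<omega> - g \<omega>)\<^sup>2 \<partial>M) = (\<integral>\<omega>. (R \<omega>)\<^sup>2 - 2 * (R \<omega> * g \<omega>) + (g \<omega>)\<^sup>2 \<partial>M)"
    by (intro Bochner_Integration.integral_cong) (auto simp: power2_eq_square algebra_simps)
  also have "\<dots> = (\<integral>\<omega>. (R \<omega>)\<^sup>2 \<partial>M) + (\<integral>\<omega>. (g \<omega>)\<^sup>2 \<partial>M)"
    using L2_integrable_square[OF R] L2_integrable_square[OF gL] L2_integrable_mult[OF R gL]
    by (simp add: Rg)
  finally have "(\<integral>\<omega>. (R \<omega>)\<^sup>2 \<partial>M) \<le> (\<integral>\<omega>. (R \<omega> - g \<omega>)\<^sup>2 \<partial>M)"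
    by simp
  then show ?thesis
    using L2_integrable_square[OF R] L2_integrable_square[OF d]
    by (simp add: nn_integral_eq_integral ennreal_leI)
qed simp

text \<open>
  Replaces Fernique's theorem: on an event \<open>B\<close> of probability at least \<open>11 / 12\<close> the inner integral
  is bounded, and the fourth moment condition forces at least half of each second moment to live
  on \<open>B\<close>.
\<close>
lemma finite_field_energy:
  fixes X :: "'a \<Rightarrow> 'b \<Rightarrow> real"
  assumes P: "prob_space P" and N: "prob_space N"
    and X [measurable]: "(\<lambda>(\<omega>, x). X \<omega> x) \<in> borel_measurable (P \<Otimes>\<^sub>M N)"
    and D: "AE x in N. x \<in> D"
    and X2: "\<And>x. x \<in> D \<Longrightarrow> integrable P (\<lambda>\<omega>. (X \<omega> x)\<^sup>2)"
    and X4: "\<And>x. x \<in> D \<Longrightarrow> integrable P (\<lambda>\<omega>. (X \<omega> x) ^ 4)"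
    and moment: "\<And>x. x \<in> D \<Longrightarrow> (\<integral>\<omega>. (X \<omega> x) ^ 4 \<partial>P) \<le> 3 * (\<integral>\<omega>. (X \<omega> x)\<^sup>2 \<partial>P)\<^sup>2"
    and fin: "\<And>\<omega>. \<omega> \<in> space P \<Longrightarrow> (\<integral>\<^sup>+x. ennreal ((X \<omega> x)\<^sup>2) \<partial>N) < \<infinity>"
  shows "(\<integral>\<^sup>+\<omega>. (\<integral>\<^sup>+x. ennreal ((X \<omega> x)\<^sup>2) \<partial>N) \<partial>P) < \<infinity>"
proof -
  interpret P: prob_space P by fact
  interpret N: prob_space N by fact
  interpret PN: pair_prob_space P N ..
  define q where "q \<omega> = (\<integral>\<^sup>+x. ennreal ((X \<omega> x)\<^sup>2) \<partial>N)" for \<omega>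
  have [measurable]: "q \<in> borel_measurable P" unfolding q_def[abs_def] by measurable
  \<comment> \<open>These exceedance events decrease to the empty set because \<open>q\<close> is
    finite everywhere, so one of them has probability below \<open>1 / 12\<close>.\<close>
  define A where "A k = {\<omega> \<in> space P. ennreal (real k) < q \<omega>}" for k
  have A [measurable]: "A k \<in> sets P" for k unfolding A_def by measurable
  have "(\<lambda>k. P.prob (A k)) \<longlonglongrightarrow> P.prob (\<Inter>k. A k)"
  proof (rule P.finite_Lim_measure_decseq)
    show "range A \<subseteq> P.events" using A by auto
    show "decseq A"
    proof (rule decseq_SucI)
      fix k
      have "ennreal (real k) \<le> ennreal (real (Suc k))" by (intro ennreal_leI) simp
      then show "A (Suc k) \<subseteq> A k" unfolding A_def using order.strict_trans1 by blast
    qed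
  qed
  moreover have "(\<Inter>k. A k) = {}"
  proof -
    have "\<exists>k. q \<omega> \<le> ennreal (real k)" if "\<omega> \<in> space P" for \<omega>
    proof -
      have "q \<omega> < top" using fin[OF that] by (simp add: q_def less_top)
      then obtain k :: nat where "q \<omega> < of_nat k" using ennreal_Ex_less_of_nat by auto
      then have "q \<omega> \<le> ennreal (real k)" by (simp add: ennreal_of_nat_eq_real_of_nat)
      then show ?thesis by blast
    qed
    then show ?thesis unfolding A_def by (fastforce simp: not_less[symmetric])
  qed
  ultimately have "(\<lambda>k. P.prob (A k)) \<longlonglongrightarrow> 0" by simp
  then have "eventually (\<lambda>k. P.prob (A k) < 1 / 12) sequentially"
    by (rule order_tendstoD) simp
  then obtain K where K: "P.prob (A K) < 1 / 12"
    using eventually_happens by (metis sequentially_bot)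
  define B where "B = space P - A K"
  have B [measurable]: "B \<in> sets P" unfolding B_def by measurable
  have half: "(\<integral>\<^sup>+\<omega>. ennreal ((X \<omega> x)\<^sup>2) \<partial>P) \<le> 2 * (\<integral>\<^sup>+\<omega>. ennreal ((X \<omega> x)\<^sup>2) * indicator B \<omega> \<partial>P)"
    if x: "x \<in> D" for x
  proof -
    define v where "v = (\<integral>\<omega>. (X \<omega> x)\<^sup>2 \<partial>P)"
    note i2 = X2[OF x] and i4 = X4[OF x]
    have iB: "integrable P (\<lambda>\<omega>. (X \<omega> x)\<^sup>2 * indicator B \<omega>)"
      "integrable P (\<lambda>\<omega>. (X \<omega> x)\<^sup>2 * indicator (A K) \<omega>)"
      using i2 by (auto intro!: integrable_mult_bounded simp: indicator_def)
    have v0: "0 \<le> v" by (simp add: v_def)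
    have "v \<le> 2 * (\<integral>\<omega>. (X \<omega> x)\<^sup>2 * indicator B \<omega> \<partial>P)"
    proof (cases "v = 0")
      case False
      with v0 have v: "v > 0" by simp
      have "v = (\<integral>\<omega>. (X \<omega> x)\<^sup>2 * indicator B \<omega> + (X \<omega> x)\<^sup>2 * indicator (A K) \<omega> \<partial>P)"
        unfolding v_def by (intro Bochner_Integration.integral_cong) (auto simp: B_def indicator_def)
      also have "\<dots> = (\<integral>\<omega>. (X \<omega> x)\<^sup>2 * indicator B \<omega> \<partial>P) + (\<integral>\<omega>. (X \<omega> x)\<^sup>2 * indicator (A K) \<omega> \<partial>P)"
        using iB by simp
      also have "(\<integral>\<omega>. (X \<omega> x)\<^sup>2 * indicator (A K) \<omega> \<partial>P) \<le>
          (\<integral>\<omega>. (X \<omega> x) ^ 4 / (12 * v) + 3 * v * indicator (A K) \<omega> \<partial>P)"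
      proof (rule integral_mono[OF iB(2)])
        show "integrable P (\<lambda>\<omega>. (X \<omega> x) ^ 4 / (12 * v) + 3 * v * indicator (A K) \<omega>)"
          using i4 by (auto simp: P.emeasure_eq_measure)
        fix \<omega>
        \<comment> \<open>Expand \<open>(y\<^sup>2 - 6 * v)\<^sup>2 \<ge> 0\<close>. After
          integration the first term is at most \<open>3 * v\<^sup>2 / (12 * v) = v / 4\<close>, and
          the second, on an event of probability below \<open>1 / 12\<close>, is at most
          \<open>v / 4\<close>; so at most half of \<open>v\<close> lives on
          \<open>A K\<close>.\<close>
        have "y\<^sup>2 \<le> y ^ 4 / (12 * v) + 3 * v" for y :: real
        proof -
          have "12 * v * y\<^sup>2 \<le> y ^ 4 + 36 * v\<^sup>2"
            using zero_le_power2[of "y\<^sup>2 - 6 * v"] by (simp add: power2_diff power_mult[symmetric] power_mult_distrib mult_ac)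
          then show ?thesis using v by (simp add: field_simps power2_eq_square)
        qed
        then show "(X \<omega> x)\<^sup>2 * indicator (A K) \<omega> \<le> (X \<omega> x) ^ 4 / (12 * v) + 3 * v * indicator (A K) \<omega>"
          using v by (auto simp: indicator_def)
      qed
      also have "\<dots> = (\<integral>\<omega>. (X \<omega> x) ^ 4 \<partial>P) / (12 * v) + 3 * v * P.prob (A K)"
        using i4 by (simp add: P.emeasure_eq_measure)
      also have "\<dots> \<le> 3 * v\<^sup>2 / (12 * v) + 3 * v * (1 / 12)"
        using moment[OF x] K v by (intro add_mono divide_right_mono mult_left_mono) (auto simp: v_def)
      also have "\<dots> = v / 2" using v by (simp add: power2_eq_square)
      finally show ?thesis by simp
    qed simp
    then have "ennreal v \<le> ennreal (2 * (\<integral>\<omega>. (X \<omega> x)\<^sup>2 * indicator B \<omega> \<partial>P))"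
      by (rule ennreal_leI)
    also have "\<dots> = 2 * ennreal (\<integral>\<omega>. (X \<omega> x)\<^sup>2 * indicator B \<omega> \<partial>P)"
      by (simp add: ennreal_mult)
    also have "ennreal (\<integral>\<omega>. (X \<omega> x)\<^sup>2 * indicator B \<omega> \<partial>P) = (\<integral>\<^sup>+\<omega>. ennreal ((X \<omega> x)\<^sup>2 * indicator B \<omega>) \<partial>P)"
      using iB by (intro nn_integral_eq_integral[symmetric]) auto
    also have "\<dots> = (\<integral>\<^sup>+\<omega>. ennreal ((X \<omega> x)\<^sup>2) * indicator B \<omega> \<partial>P)"
      by (intro nn_integral_cong) (auto simp: indicator_def)
    finally show ?thesis
      using i2 by (simp add: nn_integral_eq_integral v_def)
  qed
  have "(\<integral>\<^sup>+\<omega>. (\<integral>\<^sup>+x. ennreal ((X \<omega> x)\<^sup>2) \<partial>N) \<partial>P) = (\<integral>\<^sup>+x. (\<integral>\<^sup>+\<omega>. ennreal ((X \<omega> x)\<^sup>2) \<partial>P) \<partial>N)"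
    by (rule PN.Fubini'[symmetric]) measurable
  also have "\<dots> \<le> (\<integral>\<^sup>+x. 2 * (\<integral>\<^sup>+\<omega>. ennreal ((X \<omega> x)\<^sup>2) * indicator B \<omega> \<partial>P) \<partial>N)"
    using D half by (intro nn_integral_mono_AE) auto
  also have "\<dots> = 2 * (\<integral>\<^sup>+x. (\<integral>\<^sup>+\<omega>. ennreal ((X \<omega> x)\<^sup>2) * indicator B \<omega> \<partial>P) \<partial>N)"
    by (rule nn_integral_cmult) measurable
  also have "(\<integral>\<^sup>+x. (\<integral>\<^sup>+\<omega>. ennreal ((X \<omega> x)\<^sup>2) * indicator B \<omega> \<partial>P) \<partial>N) =
      (\<integral>\<^sup>+\<omega>. (\<integral>\<^sup>+x. ennreal ((X \<omega> x)\<^sup>2) * indicator B \<omega> \<partial>N) \<partial>P)"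
    by (rule PN.Fubini') measurable
  also have "\<dots> = (\<integral>\<^sup>+\<omega>. q \<omega> * indicator B \<omega> \<partial>P)"
    unfolding q_def by (intro nn_integral_cong nn_integral_multc) measurable
  also have "\<dots> \<le> (\<integral>\<^sup>+\<omega>. ennreal (real K) \<partial>P)"
    by (intro nn_integral_mono) (auto simp: B_def A_def indicator_def not_less)
  also have "\<dots> = ennreal (real K)" by (simp add: P.emeasure_space_1)
  finally have "(\<integral>\<^sup>+\<omega>. (\<integral>\<^sup>+x. ennreal ((X \<omega> x)\<^sup>2) \<partial>N) \<partial>P) \<le> 2 * ennreal (real K)"
    by (simp add: mult_left_mono)
  also have "\<dots> < \<infinity>" by (simp add: ennreal_mult_less_top less_top)
  finally show ?thesis .
qed

section \<open>Arbitrary functionals versus function values\<close>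

locale avg_setting_dim =
  fixes S :: avg_setting and d :: nat
  assumes valid: "valid_setting S" and d: "d \<ge> 1"
begin

abbreviation "F \<equiv> Fsp S d"
abbreviation "D \<equiv> Dom S d"
abbreviation "\<mu> \<equiv> gmeas S d"
abbreviation "\<nu> \<equiv> nuG S d"

lemmas setting = mp[OF spec[OF valid[unfolded valid_setting_def], of d] d]

lemma D_sets: "D \<in> sets (lebd d)"
  and dens_measurable: "dens S d \<in> borel_measurable (lebd d)"
  and dens_integral: "(\<integral>\<^sup>+ x. ennreal (dens S d x) * indicator D x \<partial>lebd d) = 1"
  and F_zero: "(\<lambda>x. 0) \<in> F"
  and F_separable: "\<exists>Q. countable Q \<and> Q \<subseteq> F \<and> (\<forall>f\<in>F. \<forall>e>0. \<exists>q\<in>Q. Fnorm S d (\<lambda>x. f x - q x) < e)"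
  and embedding: "\<exists>C. \<forall>f\<in>F. Gnorm2 S d f \<le> ennreal (C * (Fnorm S d f)\<^sup>2)"
  and prob_mu: "prob_space \<mu>" and space_mu: "space \<mu> = F" and sets_mu: "sets \<mu> = F_borel S d"
  by (insert setting, (elim conjE, assumption)+)

lemma F_outside: "f \<in> F \<Longrightarrow> x \<notin> D \<Longrightarrow> f x = 0"
proof -
  have "\<forall>f\<in>F. \<forall>x. x \<notin> D \<longrightarrow> f x = 0" using setting by (elim conjE)
  then show "f \<in> F \<Longrightarrow> x \<notin> D \<Longrightarrow> f x = 0" by blast
qed

lemma F_add: "f \<in> F \<Longrightarrow> g \<in> F \<Longrightarrow> (\<lambda>x. f x + g x) \<in> F"
proof -
  have "\<forall>f\<in>F. \<forall>g\<in>F. (\<lambda>x. f x + g x) \<in> F" using setting by (elim conjE)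
  then show "f \<in> F \<Longrightarrow> g \<in> F \<Longrightarrow> (\<lambda>x. f x + g x) \<in> F" by blast
qed

lemma F_cmult: "f \<in> F \<Longrightarrow> (\<lambda>x. c * f x) \<in> F"
proof -
  have "\<forall>c. \<forall>f\<in>F. (\<lambda>x. c * f x) \<in> F" using setting by (elim conjE)
  then show "f \<in> F \<Longrightarrow> (\<lambda>x. c * f x) \<in> F" by blast
qed

lemma norm_nonneg: "f \<in> F \<Longrightarrow> Fnorm S d f \<ge> 0"
proof -
  have "\<forall>f\<in>F. Fnorm S d f \<ge> 0 \<and> (Fnorm S d f = 0 \<longleftrightarrow> f = (\<lambda>x. 0))" using setting by (elim conjE)
  then show "f \<in> F \<Longrightarrow> Fnorm S d f \<ge> 0" by blast
qed

lemma norm_add: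
  "f \<in> F \<Longrightarrow> g \<in> F \<Longrightarrow> Fnorm S d (\<lambda>x. f x + g x) \<le> Fnorm S d f + Fnorm S d g"
proof -
  have "\<forall>f\<in>F. \<forall>g\<in>F. Fnorm S d (\<lambda>x. f x + g x) \<le> Fnorm S d f + Fnorm S d g"
    using setting by (elim conjE)
  then show "f \<in> F \<Longrightarrow> g \<in> F \<Longrightarrow> Fnorm S d (\<lambda>x. f x + g x) \<le> Fnorm S d f + Fnorm S d g" by blast
qed

lemma F_measurable: "f \<in> F \<Longrightarrow> f \<in> borel_measurable (lebd d)"
proof -
  have "\<forall>f\<in>F. f \<in> borel_measurable (lebd d)" using setting by (elim conjE)
  then show "f \<in> F \<Longrightarrow> f \<in> borel_measurable (lebd d)" by blast
qed

lemma eval_bounded: "x \<in> D \<Longrightarrow> \<exists>C. \<forall>f\<in>F. \<bar>f x\<bar> \<le> C * Fnorm S d f"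
proof -
  have "\<forall>x\<in>D. \<exists>C. \<forall>f\<in>F. \<bar>f x\<bar> \<le> C * Fnorm S d f" using setting by (elim conjE)
  then show "x \<in> D \<Longrightarrow> \<exists>C. \<forall>f\<in>F. \<bar>f x\<bar> \<le> C * Fnorm S d f" by blast
qed

lemma gaussian: "L \<in> Lam_all S d \<Longrightarrow> \<exists>s\<ge>0. distr \<mu> borel L = centered_gauss s"
proof -
  have "\<forall>L\<in>Lam_all S d. \<exists>s\<ge>0. distr \<mu> borel L = centered_gauss s" using setting by (elim conjE)
  then show "L \<in> Lam_all S d \<Longrightarrow> \<exists>s\<ge>0. distr \<mu> borel L = centered_gauss s" by blast
qed

lemma sets_nu: "sets \<nu> = sets (lebd d)" and space_nu: "space \<nu> = space (lebd d)"
  by (simp_all add: nuG_def)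

lemma measurable_nu: "f \<in> borel_measurable \<nu> \<longleftrightarrow> f \<in> borel_measurable (lebd d)"
  by (simp add: measurable_def sets_nu space_nu)

lemma prob_nu: "prob_space \<nu>"
proof (rule prob_spaceI)
  have "(\<lambda>x. ennreal (dens S d x) * indicator D x) \<in> borel_measurable (lebd d)"
    using dens_measurable D_sets by measurable
  then show "emeasure \<nu> (space \<nu>) = 1"
    unfolding nuG_def using dens_integral by (simp add: emeasure_density cong: nn_integral_cong)
qed

lemma AE_nu_D: "AE x in \<nu>. x \<in> D"
proof -
  have "(\<lambda>x. ennreal (dens S d x) * indicator D x) \<in> borel_measurable (lebd d)"
    using dens_measurable D_sets by measurable
  then show ?thesis
    unfolding nuG_def by (subst AE_density) (auto simp: indicator_def)
qed

lemma F_diff: "f \<in> F \<Longrightarrow> g \<in> F \<Longrightarrow> (\<lambda>x. f x - g x) \<in> F"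
  using F_add[of f "\<lambda>x. (-1) * g x"] F_cmult[of g "-1"] by simp

lemma norm_diff_triangle:
  assumes "f \<in> F" "g \<in> F" "h \<in> F"
  shows "Fnorm S d (\<lambda>x. f x - h x) \<le> Fnorm S d (\<lambda>x. f x - g x) + Fnorm S d (\<lambda>x. g x - h x)"
  using norm_add[OF F_diff[OF assms(1,2)] F_diff[OF assms(2,3)]] by simp

lemma F_open_sets: "F_open S d U \<Longrightarrow> U \<in> sets \<mu>"
  unfolding sets_mu F_borel_def by (rule sigma_sets.Basic) simp

lemma Lam_allD:
  assumes "L \<in> Lam_all S d"
  shows "f \<in> F \<Longrightarrow> g \<in> F \<Longrightarrow> L (\<lambda>x. f x + g x) = L f + L g"
    and "f \<in> F \<Longrightarrow> L (\<lambda>x. c * f x) = c * L f"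
    and "\<exists>C. \<forall>f\<in>F. \<bar>L f\<bar> \<le> C * Fnorm S d f"
  using assms unfolding Lam_all_def by blast+

lemma Lam_all_bound:
  assumes "L \<in> Lam_all S d"
  obtains C where "C > 0" "\<And>f. f \<in> F \<Longrightarrow> \<bar>L f\<bar> \<le> C * Fnorm S d f"
proof -
  obtain C where C: "\<forall>f\<in>F. \<bar>L f\<bar> \<le> C * Fnorm S d f" using Lam_allD(3)[OF assms] by blast
  have "\<bar>L f\<bar> \<le> (\<bar>C\<bar> + 1) * Fnorm S d f" if "f \<in> F" for f
  proof -
    have "\<bar>L f\<bar> \<le> C * Fnorm S d f" using C that by blast
    also have "\<dots> \<le> (\<bar>C\<bar> + 1) * Fnorm S d f"
      using norm_nonneg[OF that] by (intro mult_right_mono) auto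
    finally show ?thesis .
  qed
  then show ?thesis using that[of "\<bar>C\<bar> + 1"] by auto
qed

lemma Lam_all_diff:
  assumes "L \<in> Lam_all S d" "f \<in> F" "g \<in> F"
  shows "L (\<lambda>x. f x - g x) = L f - L g"
  using Lam_allD(1)[OF assms(1,2) F_cmult[OF assms(3), of "-1"]] Lam_allD(2)[OF assms(1,3), of "-1"]
  by simp

lemma Lam_all_zero: "(\<lambda>f. 0) \<in> Lam_all S d"
  unfolding Lam_all_def by (auto intro!: exI[of _ 0])

lemma Lam_all_cmult:
  assumes "L \<in> Lam_all S d"
  shows "(\<lambda>f. c * L f) \<in> Lam_all S d"
proof -
  obtain C where C: "\<And>f. f \<in> F \<Longrightarrow> \<bar>L f\<bar> \<le> C * Fnorm S d f" using Lam_all_bound[OF assms] by blast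
  have "\<forall>f\<in>F. \<bar>c * L f\<bar> \<le> (\<bar>c\<bar> * C) * Fnorm S d f"
    using C by (auto simp: abs_mult mult.assoc intro!: mult_left_mono)
  then have "\<exists>C. \<forall>f\<in>F. \<bar>c * L f\<bar> \<le> C * Fnorm S d f" by blast
  then show ?thesis
    unfolding Lam_all_def mem_Collect_eq
    by (intro conjI) (auto simp: Lam_allD(1,2)[OF assms] algebra_simps)
qed

lemma Lam_all_add:
  assumes "L \<in> Lam_all S d" "L' \<in> Lam_all S d"
  shows "(\<lambda>f. L f + L' f) \<in> Lam_all S d"
proof -
  obtain C where C: "\<And>f. f \<in> F \<Longrightarrow> \<bar>L f\<bar> \<le> C * Fnorm S d f" using Lam_all_bound[OF assms(1)] by blast
  obtain C' where C': "\<And>f. f \<in> F \<Longrightarrow> \<bar>L' f\<bar> \<le> C' * Fnorm S d f" using Lam_all_bound[OF assms(2)] by blast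
  have "\<bar>L f + L' f\<bar> \<le> (C + C') * Fnorm S d f" if "f \<in> F" for f
    using C[OF that] C'[OF that] by (simp add: distrib_right)
  then have "\<exists>C. \<forall>f\<in>F. \<bar>L f + L' f\<bar> \<le> C * Fnorm S d f" by blast
  then show ?thesis
    unfolding Lam_all_def mem_Collect_eq
    by (intro conjI) (auto simp: Lam_allD(1,2)[OF assms(1)] Lam_allD(1,2)[OF assms(2)] algebra_simps)
qed

lemma Lam_all_sum:
  "(\<And>i. i \<in> I \<Longrightarrow> L i \<in> Lam_all S d) \<Longrightarrow> (\<lambda>f. \<Sum>i\<in>I. L i f) \<in> Lam_all S d"
  by (induction I rule: infinite_finite_induct) (auto intro: Lam_all_zero Lam_all_add)

lemma Lam_all_eval: "x \<in> D \<Longrightarrow> (\<lambda>f. f x) \<in> Lam_all S d"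
  unfolding Lam_all_def using eval_bounded by auto

lemma Lam_std_subset: "Lam_std S d \<subseteq> Lam_all S d"
  unfolding Lam_std_def using Lam_all_eval by auto

lemma Lam_all_measurable:
  assumes "L \<in> Lam_all S d"
  shows "L \<in> borel_measurable \<mu>"
proof (rule borel_measurableI)
  fix U :: "real set" assume U: "open U"
  obtain C where C: "C > 0" "\<And>f. f \<in> F \<Longrightarrow> \<bar>L f\<bar> \<le> C * Fnorm S d f" using Lam_all_bound[OF assms] by blast
  have "F_open S d (L -` U \<inter> F)"
    unfolding F_open_def
  proof (intro conjI ballI)
    fix f assume f: "f \<in> L -` U \<inter> F"
    then obtain e where e: "e > 0" "\<And>y. dist y (L f) < e \<Longrightarrow> y \<in> U"
      using U unfolding open_dist by blast
    have "g \<in> L -` U \<inter> F" if g: "g \<in> F" "Fnorm S d (\<lambda>x. g x - f x) < e / C" for g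
    proof -
      have "\<bar>L g - L f\<bar> \<le> C * Fnorm S d (\<lambda>x. g x - f x)"
        using C(2)[OF F_diff] Lam_all_diff[OF assms] f g by auto
      also have "\<dots> < e" using g C(1) by (simp add: field_simps)
      finally show ?thesis using e g by (simp add: dist_real_def)
    qed
    then show "\<exists>e>0. \<forall>g\<in>F. Fnorm S d (\<lambda>x. g x - f x) < e \<longrightarrow> g \<in> L -` U \<inter> F"
      using e C by (intro exI[of _ "e / C"]) auto
  qed auto
  then show "L -` U \<inter> space \<mu> \<in> sets \<mu>" using F_open_sets space_mu by simp
qed

lemma ball_sets:
  assumes "q \<in> F"
  shows "{f \<in> F. Fnorm S d (\<lambda>x. f x - q x) < e} \<in> sets \<mu>"
proof (rule F_open_sets)
  show "F_open S d {f \<in> F. Fnorm S d (\<lambda>x. f x - q x) < e}"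
    unfolding F_open_def
  proof (intro conjI ballI)
    fix f assume f: "f \<in> {f \<in> F. Fnorm S d (\<lambda>x. f x - q x) < e}"
    then show "\<exists>\<epsilon>>0. \<forall>g\<in>F. Fnorm S d (\<lambda>x. g x - f x) < \<epsilon> \<longrightarrow> g \<in> {f \<in> F. Fnorm S d (\<lambda>x. f x - q x) < e}"
      using norm_diff_triangle[OF _ _ assms, of _ f]
      by (intro exI[of _ "e - Fnorm S d (\<lambda>x. f x - q x)"]) force
  qed auto
qed

text \<open>By separability \<open>f\<close> can be replaced by the first member of a dense sequence
  within \<open>1 / (n + 1)\<close>, so each approximation is a countable family of measurable
  functions of \<open>x\<close>, selected measurably by \<open>f\<close>. Convergence holds at
  points of \<open>D\<close> since evaluations are bounded, and outside \<open>D\<close> all members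
  of \<open>F\<close> vanish.\<close>

lemma eval_measurable: "(\<lambda>(f, x). f x) \<in> borel_measurable (\<mu> \<Otimes>\<^sub>M \<nu>)"
proof -
  obtain Q where Q: "countable Q" "Q \<subseteq> F" "\<And>f e. f \<in> F \<Longrightarrow> e > 0 \<Longrightarrow> \<exists>q\<in>Q. Fnorm S d (\<lambda>x. f x - q x) < e"
    using F_separable by blast
  have "Q \<noteq> {}" using Q(3)[OF F_zero, of 1] by auto
  define q where "q = from_nat_into Q"
  have range_q: "range q = Q" unfolding q_def using Q(1) \<open>Q \<noteq> {}\<close> by (rule range_from_nat_into[rotated])
  then have qF: "q i \<in> F" for i using Q(2) by auto
  define idx where "idx n f = (LEAST i. Fnorm S d (\<lambda>x. f x - q i x) < 1 / real (Suc n))" for n f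
  have idx: "Fnorm S d (\<lambda>x. f x - q (idx n f) x) < 1 / real (Suc n)" if "f \<in> F" for n f
  proof -
    have "\<exists>i. Fnorm S d (\<lambda>x. f x - q i x) < 1 / real (Suc n)"
      using Q(3)[OF that, of "1 / real (Suc n)"] range_q by auto
    then show ?thesis unfolding idx_def by (rule LeastI_ex)
  qed
  have idx_measurable: "idx n \<in> measurable \<mu> (count_space UNIV)" for n
    unfolding idx_def[abs_def]
  proof (rule measurable_Least)
    fix i
    have "{f \<in> space \<mu>. Fnorm S d (\<lambda>x. f x - q i x) < 1 / real (Suc n)} \<in> sets \<mu>"
      using ball_sets[OF qF] by (simp add: space_mu)
    then show "(\<lambda>f. Fnorm S d (\<lambda>x. f x - q i x) < 1 / real (Suc n)) \<in> measurable \<mu> (count_space UNIV)"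
      by (simp add: pred_def)
  qed
  show ?thesis
  proof (rule borel_measurable_LIMSEQ_real)
    fix n
    have "(\<lambda>z. q i (snd z)) \<in> borel_measurable (\<mu> \<Otimes>\<^sub>M \<nu>)" for i
      using F_measurable[OF qF] by (intro measurable_compose[OF measurable_snd]) (simp add: measurable_nu)
    then show "(\<lambda>z. q (idx n (fst z)) (snd z)) \<in> borel_measurable (\<mu> \<Otimes>\<^sub>M \<nu>)"
      by (rule measurable_compose_countable) (rule measurable_compose[OF measurable_fst idx_measurable])
  next
    fix z assume "z \<in> space (\<mu> \<Otimes>\<^sub>M \<nu>)"
    then obtain f x where z: "z = (f, x)" and f: "f \<in> F" by (auto simp: space_pair_measure space_mu)
    have "(\<lambda>n. q (idx n f) x) \<longlonglongrightarrow> f x"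
    proof (cases "x \<in> D")
      case True
      obtain C where C: "C > 0" "\<And>g. g \<in> F \<Longrightarrow> \<bar>g x\<bar> \<le> C * Fnorm S d g"
        using Lam_all_bound[OF Lam_all_eval[OF True]] by blast
      have bound: "\<bar>q (idx n f) x - f x\<bar> \<le> C * (1 / real (Suc n))" for n
      proof -
        have "\<bar>f x - q (idx n f) x\<bar> \<le> C * Fnorm S d (\<lambda>x. f x - q (idx n f) x)"
          by (rule C(2)[OF F_diff[OF f qF]])
        also have "\<dots> \<le> C * (1 / real (Suc n))"
          using idx[OF f, of n] C(1) by (intro mult_left_mono) auto
        finally show ?thesis by (simp add: abs_minus_commute)
      qed
      have "(\<lambda>n. q (idx n f) x - f x) \<longlonglongrightarrow> 0"
      proof (rule Lim_null_comparison)
        show "\<forall>\<^sub>F n in sequentially. norm (q (idx n f) x - f x) \<le> C * (1 / real (Suc n))"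
          unfolding real_norm_def using bound by (rule always_eventually[OF allI])
        show "(\<lambda>n. C * (1 / real (Suc n))) \<longlonglongrightarrow> 0"
          using tendsto_mult[OF tendsto_const LIMSEQ_Suc[OF lim_1_over_n], of C]
          by (simp only: mult_zero_right)
      qed
      then show ?thesis by (simp add: LIM_zero_iff)
    next
      case False
      then show ?thesis using F_outside[OF f] F_outside[OF qF] by simp
    qed
    then show "(\<lambda>n. q (idx n (fst z)) (snd z)) \<longlonglongrightarrow> (case z of (f, x) \<Rightarrow> f x)" by (simp add: z)
  qed
qed

lemma Gnorm2_finite: "f \<in> F \<Longrightarrow> Gnorm2 S d f < \<infinity>"
  using embedding by (metis ennreal_less_top infinity_ennreal_def le_less_trans)

lemma F_L2: "f \<in> F \<Longrightarrow> f \<in> L2 \<nu>"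
  using Gnorm2_finite[of f] F_measurable[of f]
  by (auto simp: L2_def measurable_nu[symmetric] integrable_iff_bounded Gnorm2_def)

lemma Lam_all_moments:
  assumes "L \<in> Lam_all S d"
  shows "L \<in> L2 \<mu>" "integrable \<mu> (\<lambda>f. (L f) ^ 4)" "(\<integral>f. (L f) ^ 4 \<partial>\<mu>) = 3 * (\<integral>f. (L f)\<^sup>2 \<partial>\<mu>)\<^sup>2"
proof -
  obtain \<sigma> where \<sigma>: "0 \<le> \<sigma>" "distr \<mu> borel L = centered_gauss \<sigma>" using gaussian[OF assms] by blast
  note m = centered_gauss_moments[OF Lam_all_measurable[OF assms] \<sigma>]
  show "L \<in> L2 \<mu>" using m(1) Lam_all_measurable[OF assms] by (simp add: L2_def)
  show "integrable \<mu> (\<lambda>f. (L f) ^ 4)" by (rule m(3))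
  show "(\<integral>f. (L f) ^ 4 \<partial>\<mu>) = 3 * (\<integral>f. (L f)\<^sup>2 \<partial>\<mu>)\<^sup>2" unfolding m by simp
qed

text \<open>Each evaluation is Gaussian, hence meets the fourth moment condition, and each
  \<open>f\<close> has finite norm in \<open>G\<close> by the embedding. The bound makes the
  evaluation field square integrable on the product.\<close>

lemma Gamma_finite: "Gamma S d < \<infinity>"
proof -
  have "(\<integral>\<^sup>+f. (\<integral>\<^sup>+x. ennreal ((f x)\<^sup>2) \<partial>\<nu>) \<partial>\<mu>) < \<infinity>"
  proof (rule finite_field_energy[OF prob_mu prob_nu eval_measurable AE_nu_D])
    show "(\<integral>\<^sup>+x. ennreal ((f x)\<^sup>2) \<partial>\<nu>) < \<infinity>" if "f \<in> space \<mu>" for f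
      using Gnorm2_finite[of f] that by (simp add: Gnorm2_def space_mu)
  qed (use Lam_all_moments[OF Lam_all_eval] in \<open>auto simp: L2_def\<close>)
  then show ?thesis by (simp add: Gamma_def err2_def Gnorm2_def)
qed

lemma eval_integrable: "integrable (\<mu> \<Otimes>\<^sub>M \<nu>) (\<lambda>(f, x). (f x)\<^sup>2)"
proof -
  interpret N: prob_space \<nu> by (rule prob_nu)
  note [measurable] = eval_measurable
  have "(\<integral>\<^sup>+z. ennreal ((fst z (snd z))\<^sup>2) \<partial>(\<mu> \<Otimes>\<^sub>M \<nu>)) = Gamma S d"
    unfolding Gamma_def err2_def Gnorm2_def by (subst N.nn_integral_fst[symmetric]) (auto simp: case_prod_unfold)
  then show ?thesis
    using Gamma_finite by (simp add: integrable_iff_bounded case_prod_unfold)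
qed

lemma random_field:
  assumes "orthonormal \<nu> r u"
  shows "random_field \<mu> \<nu> (\<lambda>f x. f x) D r u"
  unfolding random_field_def random_field_axioms_def
  using assms prob_mu prob_nu eval_measurable eval_integrable AE_nu_D Lam_all_moments(1)[OF Lam_all_eval] F_L2
  by (auto simp: space_mu)


text \<open>Here points index the elements \<open>f x\<close> of \<open>L2 \<mu>\<close>, and the
  orthonormal system will come from information functionals, so the coefficients become functions of
  \<open>x\<close>. Points outside \<open>D\<close> are covered because \<open>f x\<close> is
  constantly zero there.\<close>

lemma random_field_swapped:
  assumes "orthonormal \<mu> r u"
  shows "random_field \<nu> \<mu> (\<lambda>x f. f x) F r u"
proof -
  interpret P: prob_space \<mu> by (rule prob_mu)
  interpret N: prob_space \<nu> by (rule prob_nu)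
  interpret PN: pair_prob_space \<mu> \<nu> ..
  have m: "(\<lambda>(x, f). f x) \<in> borel_measurable (\<nu> \<Otimes>\<^sub>M \<mu>)"
    using measurable_pair_swap[OF eval_measurable] by simp
  have i: "integrable (\<nu> \<Otimes>\<^sub>M \<mu>) (\<lambda>(x, f). (f x)\<^sup>2)"
    using PN.integrable_product_swap[OF eval_integrable] by (simp add: case_prod_unfold)
  have L: "(\<lambda>f. f x) \<in> L2 \<mu>" for x
  proof (cases "x \<in> D")
    case False
    then have eq: "f x = 0" if "f \<in> space \<mu>" for f using F_outside that by (simp add: space_mu)
    have "(\<lambda>f. f x) \<in> borel_measurable \<mu>"
      by (subst measurable_cong[where g = "\<lambda>_. 0"]) (auto simp: eq)
    moreover have "integrable \<mu> (\<lambda>f. (f x)\<^sup>2)"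
      by (subst Bochner_Integration.integrable_cong[where g = "\<lambda>_. 0", OF refl]) (auto simp: eq)
    ultimately show ?thesis by (simp add: L2_def)
  qed (rule Lam_all_moments(1)[OF Lam_all_eval])
  have "AE f in \<mu>. f \<in> F" using AE_space[of \<mu>] by (simp add: space_mu)
  then show ?thesis
    unfolding random_field_def random_field_axioms_def
    using assms prob_mu prob_nu m i L F_L2 by auto
qed

section \<open>Comparison of the two classes of information in a fixed dimension\<close>

lemma information_orthogonal:
  fixes L :: "nat \<Rightarrow> fn \<Rightarrow> real"
  assumes L: "\<And>i. i < m \<Longrightarrow> L i \<in> Lam_all S d" and R: "R \<in> Lam_all S d"
    and orth: "\<And>i. i < m \<Longrightarrow> (\<integral>f. R f * L i f \<partial>\<mu>) = 0"
    and h: "h \<in> borel_measurable (PiM {..<m} (\<lambda>_. lborel))"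
    and int: "integrable \<mu> (\<lambda>f. R f * h (restrict (\<lambda>i. L i f) {..<m}))"
  shows "(\<integral>f. R f * h (restrict (\<lambda>i. L i f) {..<m}) \<partial>\<mu>) = 0"
proof (rule gaussian_uncorrelated_orthogonal[where R = R and Y = L and n = m, OF prob_mu _ _ _ _ h int])
  \<comment> \<open>Joint Gaussianity: combinations of \<open>R\<close> and the \<open>L i\<close>
    are again continuous linear functionals.\<close>
  show "\<exists>\<sigma>\<ge>0. distr \<mu> borel (\<lambda>f. s * R f + (\<Sum>i<m. u i * L i f)) = centered_gauss \<sigma>" for s u
    by (intro gaussian Lam_all_add Lam_all_sum Lam_all_cmult L R) simp
qed (use L R Lam_all_measurable orth in auto)

text \<open>For \<open>x\<close> in \<open>D\<close>, subtracting from \<open>f x\<close> its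
  projection onto the information in \<open>L2 \<mu>\<close> leaves \<open>R x\<close>, which is
  uncorrelated with the information and therefore, by Gaussianity, orthogonal to functions of it; so
  no \<open>\<phi>\<close> beats the linear predictor at \<open>x\<close>. Its coefficient functions
  \<open>a j\<close> span at most \<open>m\<close> dimensions of \<open>G\<close>, and projecting
  each \<open>f\<close> onto that span is at least as good as any predictor with values in
  it.\<close>

lemma projection_le_algorithm:
  assumes alg: "(L, \<phi>) \<in> algs S Info_all d m"
  shows "\<exists>r u. r \<le> m \<and> orthonormal \<nu> r u \<and>
    ennreal (random_field.tail \<mu> \<nu> (\<lambda>f x. f x) r u) \<le> err2 S d (alg_apply m L \<phi>)"
proof -
  interpret P: prob_space \<mu> by (rule prob_mu)
  interpret N: prob_space \<nu> by (rule prob_nu)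
  interpret PN: pair_prob_space \<mu> \<nu> ..
  have L: "L i \<in> Lam_all S d" if "i < m" for i
    using alg that by (auto simp: algs_def Lam_def)
  have \<phi>: "(\<lambda>(y, x). \<phi> y x) \<in> borel_measurable (PiM {..<m} (\<lambda>_. lborel) \<Otimes>\<^sub>M lebd d)"
    using alg by (auto simp: algs_def)
  define T where "T f = restrict (\<lambda>i. L i f) {..<m}" for f
  have T: "T \<in> measurable \<mu> (PiM {..<m} (\<lambda>_. lborel))"
    unfolding T_def[abs_def] using L Lam_all_measurable by (intro measurable_restrict) auto
  from gram_schmidt_L2[of m L, OF Lam_all_moments(1)[OF L]]
  obtain p U b c where U: "orthonormal \<mu> p U"
    and c: "\<And>i. i < m \<Longrightarrow> AE f in \<mu>. L i f = (\<Sum>j<p. c i j * U j f)"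
    and b: "\<And>j f. j < p \<Longrightarrow> U j f = (\<Sum>i<m. b j i * L i f)"
    and "p \<le> m"
    by blast
  interpret V: random_field \<nu> \<mu> "\<lambda>x f. f x" F p U
    by (rule random_field_swapped[OF U])
  \<comment> \<open>This relies on \<open>U j\<close> being a combination of the \<open>L i\<close>
    everywhere, not merely almost everywhere.\<close>
  have U_Lam: "U j \<in> Lam_all S d" if "j < p" for j
  proof -
    have "U j = (\<lambda>f. \<Sum>i<m. b j i * L i f)" using b[OF that] by blast
    then show ?thesis by (simp only:) (intro Lam_all_sum Lam_all_cmult L, simp)
  qed
  define a where "a = V.coef"
  have a: "a j \<in> L2 \<nu>" if "j < p" for j unfolding a_def by (rule V.coef_L2[OF that])
  define R where "R x f = f x - (\<Sum>j<p. a j x * U j f)" for x f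
  have R_resid: "R x f = V.resid x f" for x f by (simp add: R_def V.resid_def a_def)
  have space_T: "T f \<in> space (PiM {..<m} (\<lambda>_. lborel))" for f
    by (auto simp: T_def space_PiM)
  have pointwise: "(\<integral>\<^sup>+f. ennreal ((R x f)\<^sup>2) \<partial>\<mu>) \<le> (\<integral>\<^sup>+f. ennreal ((f x - \<phi> (T f) x)\<^sup>2) \<partial>\<mu>)"
    if x: "x \<in> D" "x \<in> space \<nu>" for x
  proof -
    \<comment> \<open>The deviation of the algorithm from the linear predictor as a function of the
      information vector, so that the error at \<open>x\<close> becomes
      \<open>R x f - h (T f)\<close>.\<close>
    define h where "h y = \<phi> y x - (\<Sum>j<p. a j x * (\<Sum>i<m. b j i * y i))" for y
    have "(\<lambda>y. \<phi> y x) \<in> borel_measurable (PiM {..<m} (\<lambda>_. lborel))"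
      using measurable_compose[OF measurable_Pair2'[of x "lebd d"] \<phi>] x by (simp add: space_nu)
    then have h: "h \<in> borel_measurable (PiM {..<m} (\<lambda>_. lborel))"
      unfolding h_def[abs_def]
      by (intro borel_measurable_diff borel_measurable_sum borel_measurable_times borel_measurable_const)
        (auto intro: measurable_component_singleton)
    have Rx: "R x \<in> Lam_all S d"
    proof -
      have "(\<lambda>f. f x + (\<Sum>j<p. - a j x * U j f)) \<in> Lam_all S d"
        by (intro Lam_all_add Lam_all_eval Lam_all_sum Lam_all_cmult U_Lam x) simp
      then show ?thesis by (simp add: R_def[abs_def] sum_negf)
    qed
    have R_U: "(\<integral>f. R x f * U k f \<partial>\<mu>) = 0" if "k < p" for k
      using V.resid_orthogonal[OF x(2) that] by (simp add: R_resid)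
    have orth: "(\<integral>f. R x f * L i f \<partial>\<mu>) = 0" if i: "i < m" for i
    proof -
      have "(\<integral>f. R x f * L i f \<partial>\<mu>) = (\<integral>f. (\<Sum>j<p. c i j * (R x f * U j f)) \<partial>\<mu>)"
      proof (rule integral_cong_AE)
        show "AE f in \<mu>. R x f * L i f = (\<Sum>j<p. c i j * (R x f * U j f))"
          using c[OF i] by eventually_elim (simp add: sum_distrib_left mult_ac)
        show "(\<lambda>f. R x f * L i f) \<in> borel_measurable \<mu>"
          by (intro borel_measurable_times Lam_all_measurable Rx L[OF i])
        show "(\<lambda>f. \<Sum>j<p. c i j * (R x f * U j f)) \<in> borel_measurable \<mu>"
          by (intro borel_measurable_sum borel_measurable_times borel_measurable_const Lam_all_measurable Rx U_Lam) simp
      qed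
      also have "\<dots> = (\<Sum>j<p. \<integral>f. c i j * (R x f * U j f) \<partial>\<mu>)"
        by (intro Bochner_Integration.integral_sum integrable_mult_right L2_integrable_mult Lam_all_moments(1) Rx U_Lam) simp
      finally show ?thesis using R_U by simp
    qed
    have g: "f x - \<phi> (T f) x = R x f - h (T f)" for f
      by (simp add: R_def h_def T_def b)
    show ?thesis
      unfolding g
    proof (rule orthogonal_best_approximation)
      show "R x \<in> L2 \<mu>" by (rule Lam_all_moments(1)[OF Rx])
      show "(\<lambda>f. h (T f)) \<in> borel_measurable \<mu>" by (rule measurable_compose[OF T h])
      show "(\<integral>f. R x f * h (T f) \<partial>\<mu>) = 0" if "integrable \<mu> (\<lambda>f. R x f * h (T f))"
        using that unfolding T_def by (intro information_orthogonal L Rx orth h)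
    qed
  qed
  have diff_measurable: "(\<lambda>(f, x). f x - \<phi> (T f) x) \<in> borel_measurable (\<mu> \<Otimes>\<^sub>M \<nu>)"
  proof -
    have sets: "sets (PiM {..<m} (\<lambda>_. lborel) \<Otimes>\<^sub>M lebd d) = sets (PiM {..<m} (\<lambda>_. lborel) \<Otimes>\<^sub>M \<nu>)"
      by (intro sets_pair_measure_cong) (auto simp: sets_nu)
    have "(\<lambda>z. (T (fst z), snd z)) \<in> measurable (\<mu> \<Otimes>\<^sub>M \<nu>) (PiM {..<m} (\<lambda>_. lborel) \<Otimes>\<^sub>M lebd d)"
      unfolding measurable_cong_sets[OF refl sets]
      using T by (intro measurable_Pair measurable_compose[OF measurable_fst]) auto
    from measurable_compose[OF this \<phi>] eval_measurable show ?thesis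
      by (simp add: case_prod_unfold)
  qed
  have R_measurable: "(\<lambda>(f, x). R x f) \<in> borel_measurable (\<mu> \<Otimes>\<^sub>M \<nu>)"
  proof -
    have "(\<lambda>z. a j (snd z) * U j (fst z)) \<in> borel_measurable (\<mu> \<Otimes>\<^sub>M \<nu>)" if "j < p" for j
      using L2_measurable[OF a[OF that]] Lam_all_measurable[OF U_Lam[OF that]]
      by (intro borel_measurable_times measurable_compose[OF measurable_snd] measurable_compose[OF measurable_fst]) auto
    then show ?thesis
      unfolding R_def using eval_measurable
      by (auto simp: case_prod_unfold intro!: borel_measurable_diff borel_measurable_sum)
  qed
  from gram_schmidt_L2[of p a, OF a]
  obtain r u e where "r \<le> p" and u: "orthonormal \<nu> r u"
    and e: "\<And>j. j < p \<Longrightarrow> AE x in \<nu>. a j x = (\<Sum>k<r. e j k * u k x)"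
    by blast
  interpret W: random_field \<mu> \<nu> "\<lambda>f x. f x" D r u
    by (rule random_field[OF u])
  have "ennreal W.tail \<le> (\<integral>\<^sup>+f. (\<integral>\<^sup>+x. ennreal ((W.resid f x)\<^sup>2) \<partial>\<nu>) \<partial>\<mu>)"
  proof -
    have "integrable (\<mu> \<Otimes>\<^sub>M \<nu>) (\<lambda>(f, x). (W.resid f x)\<^sup>2)"
      using L2_integrable_square[OF W.perturbed_L2(1)[of "\<lambda>_ _. 0", OF L2_zero]]
      by (simp add: case_prod_unfold W.perturbed_def)
    from PN.integrable_fst[OF this]
    have "ennreal W.tail = (\<integral>\<^sup>+f. ennreal (\<integral>x. (W.resid f x)\<^sup>2 \<partial>\<nu>) \<partial>\<mu>)"
      unfolding W.tail_def by (intro nn_integral_eq_integral[symmetric]) auto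
    also have "\<dots> = (\<integral>\<^sup>+f. (\<integral>\<^sup>+x. ennreal ((W.resid f x)\<^sup>2) \<partial>\<nu>) \<partial>\<mu>)"
      using W.resid_L2_right
      by (intro nn_integral_cong nn_integral_eq_integral[symmetric]) (auto simp: L2_def)
    finally show ?thesis by simp
  qed
  also have "\<dots> \<le> (\<integral>\<^sup>+f. (\<integral>\<^sup>+x. ennreal ((R x f)\<^sup>2) \<partial>\<nu>) \<partial>\<mu>)"
  proof (rule nn_integral_mono)
    fix f assume f: "f \<in> space \<mu>"
    \<comment> \<open>Coefficients of the projection of \<open>f\<close> minus those of the linear
      predictor, the latter read off from the expansion of the \<open>a j\<close> in the
      \<open>u k\<close>.\<close>
    define q where "q k = W.coef k f - (\<Sum>j<p. U j f * e j k)" for k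
    have "AE x in \<nu>. \<forall>j\<in>{..<p}. a j x = (\<Sum>k<r. e j k * u k x)"
      using e by (intro AE_finite_allI) auto
    then have ae: "AE x in \<nu>. R x f = W.resid f x + (\<Sum>k<r. q k * u k x)"
    proof eventually_elim
      case (elim x)
      have "(\<Sum>j<p. a j x * U j f) = (\<Sum>j<p. \<Sum>k<r. U j f * e j k * u k x)"
        using elim by (intro sum.cong) (auto simp: sum_distrib_left mult_ac)
      also have "\<dots> = (\<Sum>k<r. (\<Sum>j<p. U j f * e j k) * u k x)"
        by (subst sum.swap) (simp add: sum_distrib_right)
      finally show ?case
        by (simp add: R_def W.resid_def q_def left_diff_distrib sum_subtractf)
    qed
    have L2: "(\<lambda>x. W.resid f x + (\<Sum>k<r. q k * u k x)) \<in> L2 \<nu>"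
      by (intro L2_intros W.resid_L2_right[OF f] W.u_L2) simp
    have "(\<integral>\<^sup>+x. ennreal ((W.resid f x)\<^sup>2) \<partial>\<nu>) = ennreal (\<integral>x. (W.resid f x)\<^sup>2 \<partial>\<nu>)"
      using W.resid_L2_right[OF f] by (intro nn_integral_eq_integral) (auto simp: L2_def)
    also have "\<dots> \<le> ennreal (\<integral>x. (W.resid f x + (\<Sum>k<r. q k * u k x))\<^sup>2 \<partial>\<nu>)"
      using orthonormal_pythagoras(1)[OF u W.resid_L2_right[OF f] W.resid_orthogonal[OF f], of q]
      by (intro ennreal_leI) (simp add: sum_nonneg)
    also have "\<dots> = (\<integral>\<^sup>+x. ennreal ((W.resid f x + (\<Sum>k<r. q k * u k x))\<^sup>2) \<partial>\<nu>)"
      using L2 by (intro nn_integral_eq_integral[symmetric]) (auto simp: L2_def)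
    also have "\<dots> = (\<integral>\<^sup>+x. ennreal ((R x f)\<^sup>2) \<partial>\<nu>)"
      using ae by (intro nn_integral_cong_AE) auto
    finally show "(\<integral>\<^sup>+x. ennreal ((W.resid f x)\<^sup>2) \<partial>\<nu>) \<le> (\<integral>\<^sup>+x. ennreal ((R x f)\<^sup>2) \<partial>\<nu>)" .
  qed
  also have "\<dots> = (\<integral>\<^sup>+x. (\<integral>\<^sup>+f. ennreal ((R x f)\<^sup>2) \<partial>\<mu>) \<partial>\<nu>)"
    using R_measurable by (intro PN.Fubini'[symmetric]) (simp add: case_prod_unfold)
  also have "\<dots> \<le> (\<integral>\<^sup>+x. (\<integral>\<^sup>+f. ennreal ((f x - \<phi> (T f) x)\<^sup>2) \<partial>\<mu>) \<partial>\<nu>)"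
    using AE_nu_D AE_space[of \<nu>] by (intro nn_integral_mono_AE) (auto elim!: eventually_elim2 intro: pointwise)
  also have "\<dots> = (\<integral>\<^sup>+f. (\<integral>\<^sup>+x. ennreal ((f x - \<phi> (T f) x)\<^sup>2) \<partial>\<nu>) \<partial>\<mu>)"
    using diff_measurable by (intro PN.Fubini') (simp add: case_prod_unfold)
  also have "\<dots> = err2 S d (alg_apply m L \<phi>)"
    by (simp add: err2_def Gnorm2_def alg_apply_def T_def)
  finally show ?thesis
    using u \<open>r \<le> p\<close> \<open>p \<le> m\<close> by (intro exI[of _ r] exI[of _ u]) auto
qed

text \<open>The estimator becomes an algorithm whose \<open>\<phi>\<close> forms the coefficients
  from the samples and whose error field is \<open>perturbed (err s)\<close>. \<open>N > 0\<close>
  selects the branch of \<open>min_err2\<close> that is an infimum over algorithms.\<close>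

lemma min_err2_std_le_sampled:
  assumes u: "orthonormal \<nu> r u" and N: "N > 0"
    and s: "random_field.sampled (\<lambda>f x. f x) D r N s"
  shows "min_err2 S Info_std N d \<le> ennreal (random_field.tail \<mu> \<nu> (\<lambda>f x. f x) r u +
    random_field.sqerr \<mu> \<nu> (\<lambda>f x. f x) r u s)"
proof -
  interpret W: random_field \<mu> \<nu> "\<lambda>f x. f x" D r u
    by (rule random_field[OF u])
  obtain xs w where xs: "\<And>i. i < N \<Longrightarrow> xs i \<in> D"
    and w: "\<And>j f. j < r \<Longrightarrow> s j f = (\<Sum>i<N. w i j * f (xs i))"
    using s unfolding W.sampled_def by blast
  define L where "L i f = f (xs i)" for i and f :: fn
  define \<phi> where "\<phi> y x = (\<Sum>j<r. (\<Sum>i<N. w i j * y i) * u j x)" for y :: "nat \<Rightarrow> real" and x :: pt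
  have "\<phi> y \<in> L2 \<nu>" for y
    unfolding \<phi>_def[abs_def] by (intro L2_intros W.u_L2) simp
  then have \<phi>_fin: "Gnorm2 S d (\<phi> y) < \<infinity>" for y
    by (auto simp: Gnorm2_def L2_def integrable_iff_bounded)
  have "(\<lambda>z. \<phi> (fst z) (snd z)) \<in> borel_measurable (PiM {..<N} (\<lambda>_. lborel) \<Otimes>\<^sub>M lebd d)"
    unfolding \<phi>_def
  proof (intro borel_measurable_sum borel_measurable_times borel_measurable_const)
    show "(\<lambda>z. fst z i) \<in> borel_measurable (PiM {..<N} (\<lambda>_. lborel) \<Otimes>\<^sub>M lebd d)" if "i \<in> {..<N}" for i
      using measurable_compose[OF measurable_fst measurable_component_singleton[OF that, of "\<lambda>_. lborel"]] by simp
    show "(\<lambda>z. u j (snd z)) \<in> borel_measurable (PiM {..<N} (\<lambda>_. lborel) \<Otimes>\<^sub>M lebd d)" if "j \<in> {..<r}" for j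
      using L2_measurable[OF W.u_L2[of j]] that
      by (intro measurable_compose[OF measurable_snd]) (auto simp: measurable_nu)
  qed
  then have alg: "(L, \<phi>) \<in> algs S Info_std d N"
    using xs \<phi>_fin by (auto simp: algs_def Lam_def Lam_std_def L_def[abs_def] case_prod_unfold)
  have apply_eq: "alg_apply N L \<phi> f x = (\<Sum>j<r. s j f * u j x)" for f x
    unfolding alg_apply_def \<phi>_def by (intro sum.cong) (auto simp: w L_def)
  have e: "W.err s j \<in> L2 \<mu>" if "j < r" for j using W.err_L2[OF s that] .
  have "min_err2 S Info_std N d \<le> err2 S d (alg_apply N L \<phi>)"
    using N alg by (auto simp: min_err2_def intro!: INF_lower2[of "(L, \<phi>)"])
  also have "\<dots> = (\<integral>\<^sup>+f. (\<integral>\<^sup>+x. ennreal ((W.perturbed (W.err s) f x)\<^sup>2) \<partial>\<nu>) \<partial>\<mu>)"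
    by (simp add: err2_def Gnorm2_def apply_eq W.perturbed_err)
  also have "\<dots> = (\<integral>\<^sup>+f. ennreal (\<integral>x. (W.perturbed (W.err s) f x)\<^sup>2 \<partial>\<nu>) \<partial>\<mu>)"
    using W.perturbed_L2(4)[of "W.err s", OF e]
    by (intro nn_integral_cong nn_integral_eq_integral) (auto simp: L2_def)
  also have "\<dots> = ennreal (\<integral>f. (\<integral>x. (W.perturbed (W.err s) f x)\<^sup>2 \<partial>\<nu>) \<partial>\<mu>)"
  proof (rule nn_integral_eq_integral)
    have "integrable (\<mu> \<Otimes>\<^sub>M \<nu>) (\<lambda>(f, x). (W.perturbed (W.err s) f x)\<^sup>2)"
      using L2_integrable_square[OF W.perturbed_L2(1)[of "W.err s", OF e]] by (simp add: case_prod_unfold)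
    from W.PN.integrable_fst[OF this]
    show "integrable \<mu> (\<lambda>f. \<integral>x. (W.perturbed (W.err s) f x)\<^sup>2 \<partial>\<nu>)" by simp
  qed simp
  also have "\<dots> = ennreal (W.tail + W.sqerr s)"
    using W.perturbed_integrals(3)[of "W.err s", OF e] by (simp add: W.sqerr_def)
  finally show ?thesis .
qed

text \<open>Every algorithm is dominated by a projection of some rank \<open>r \<le> m\<close>, and
  the sampling bound is monotone in \<open>r\<close>, so \<open>r\<close> may be replaced by
  \<open>m\<close> and the missing points padded. The summands of the constant are the projection
  error, the remainder of the initial sampling error and the floor of the Kaczmarz
  recursion.\<close>

lemma min_err2_std_le_all:
  fixes \<gamma> :: real
  assumes m: "m > 0" and \<gamma>: "0 < \<gamma>" "\<gamma> \<le> 1"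
  shows "min_err2 S Info_std (m + n) d \<le> ennreal (1 + (1 - \<gamma> / m) ^ n * m + \<gamma>) * min_err2 S Info_all m d"
proof -
  define c where "c = 1 + (1 - \<gamma> / m) ^ n * m + \<gamma>"
  have c: "c > 0"
  proof -
    have "0 \<le> 1 - \<gamma> / m" using m \<gamma> by (simp add: field_simps)
    then have "0 \<le> (1 - \<gamma> / m) ^ n * m" by simp
    then show ?thesis unfolding c_def using \<gamma> by linarith
  qed
  have key: "min_err2 S Info_std (m + n) d \<le> ennreal c * err2 S d (alg_apply m L \<phi>)"
    if alg: "(L, \<phi>) \<in> algs S Info_all d m" for L \<phi>
  proof -
    obtain r u where r: "r \<le> m" and u: "orthonormal \<nu> r u"
      and tail: "ennreal (random_field.tail \<mu> \<nu> (\<lambda>f x. f x) r u) \<le> err2 S d (alg_apply m L \<phi>)"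
      using projection_le_algorithm[OF alg] by blast
    interpret W: random_field \<mu> \<nu> "\<lambda>f x. f x" D r u
      by (rule random_field[OF u])
    have "\<exists>s. W.sampled (m + n) s \<and> W.tail + W.sqerr s \<le> c * W.tail"
    proof (cases "r = 0")
      \<comment> \<open>Rank zero: the zero estimator has no coefficient error, and
        \<open>c \<ge> 1\<close>.\<close>
      case True
      have "W.sampled (m + n) (\<lambda>_ _. 0)"
        by (rule W.sampled_mono[OF W.sampled_zero]) simp
      moreover have "W.sqerr (\<lambda>_ _. 0) = 0" unfolding W.sqerr_def using True by simp
      moreover have "1 * W.tail \<le> c * W.tail"
      proof (rule mult_right_mono[OF _ W.tail_nonneg])
        have "0 \<le> 1 - \<gamma> / m" using m \<gamma> by (simp add: field_simps)
        then have "0 \<le> (1 - \<gamma> / m) ^ n * m" by simp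
        then show "1 \<le> c" unfolding c_def using \<gamma> by linarith
      qed
      ultimately show ?thesis by (intro exI[of _ "\<lambda>_ _. 0"]) simp
    next
      case False
      then obtain s where s: "W.sampled (r + n) s"
        and le: "W.sqerr s \<le> ((1 - \<gamma> / r) ^ n * r + \<gamma>) * W.tail"
        using W.sampling_error[of \<gamma> n] \<gamma> by auto
      have "\<gamma> / m \<le> \<gamma> / r" using r False \<gamma> by (intro divide_left_mono) auto
      moreover have "\<gamma> / r \<le> 1" using False \<gamma> by (simp add: field_simps)
      ultimately have "(1 - \<gamma> / r) ^ n * r \<le> (1 - \<gamma> / m) ^ n * m"
        using r by (intro mult_mono power_mono) auto
      then have "((1 - \<gamma> / r) ^ n * r + \<gamma>) * W.tail \<le> ((1 - \<gamma> / m) ^ n * m + \<gamma>) * W.tail"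
        by (intro mult_right_mono W.tail_nonneg) simp
      with le have "W.tail + W.sqerr s \<le> c * W.tail" unfolding c_def by (simp add: algebra_simps)
      moreover have "W.sampled (m + n) s" using W.sampled_mono[OF s] r by simp
      ultimately show ?thesis by blast
    qed
    then obtain s where s: "W.sampled (m + n) s" and le: "W.tail + W.sqerr s \<le> c * W.tail" by blast
    have "min_err2 S Info_std (m + n) d \<le> ennreal (W.tail + W.sqerr s)"
      using min_err2_std_le_sampled[OF u _ s] m by simp
    also have "\<dots> \<le> ennreal (c * W.tail)" by (rule ennreal_leI[OF le])
    also have "\<dots> = ennreal c * ennreal W.tail" using c W.tail_nonneg by (intro ennreal_mult) auto
    also have "\<dots> \<le> ennreal c * err2 S d (alg_apply m L \<phi>)" by (intro mult_left_mono tail) simp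
    finally show ?thesis .
  qed
  \<comment> \<open>The infimum need not be attained; after division by \<open>c\<close> each
    algorithm can be treated separately.\<close>
  have "ennreal (1 / c) * min_err2 S Info_std (m + n) d \<le> min_err2 S Info_all m d"
  proof -
    have "ennreal (1 / c) * min_err2 S Info_std (m + n) d \<le> err2 S d (alg_apply m (fst z) (snd z))"
      if "z \<in> algs S Info_all d m" for z
    proof -
      have "ennreal (1 / c) * min_err2 S Info_std (m + n) d \<le>
          ennreal (1 / c) * (ennreal c * err2 S d (alg_apply m (fst z) (snd z)))"
        using key[of "fst z" "snd z"] that by (intro mult_left_mono) auto
      also have "\<dots> = err2 S d (alg_apply m (fst z) (snd z))"
        using c by (simp add: mult.assoc[symmetric] ennreal_mult[symmetric])
      finally show ?thesis .
    qed
    then show ?thesis using m by (auto simp: min_err2_def intro!: INF_greatest)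
  qed
  then have "ennreal c * (ennreal (1 / c) * min_err2 S Info_std (m + n) d) \<le> ennreal c * min_err2 S Info_all m d"
    by (intro mult_left_mono) auto
  then show ?thesis
    using c by (simp add: mult.assoc[symmetric] ennreal_mult[symmetric] c_def)
qed

lemma min_err2_all_le_std: "min_err2 S Info_all n d \<le> min_err2 S Info_std n d"
proof -
  have "algs S Info_std d n \<subseteq> algs S Info_all d n"
    using Lam_std_subset by (auto simp: algs_def Lam_def)
  then show ?thesis by (auto simp: min_err2_def intro!: INF_superset_mono)
qed

end

section \<open>Exponents of tractability\<close>

text \<open>With \<open>\<gamma> = \<eta> / 2\<close>, let \<open>n\<close> be
  \<open>(m / \<gamma>) * ln (m / \<gamma>)\<close> rounded up; then \<open>(1 - \<gamma> / m) ^ n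
  \<le> exp (- \<gamma> * n / m) \<le> \<gamma> / m\<close>. The logarithm is absorbed by
  \<open>ln m \<le> m powr \<eta> / \<eta>\<close>.\<close>

lemma sample_count:
  fixes \<eta> :: real
  assumes \<eta>: "0 < \<eta>" "\<eta> \<le> 1"
  obtains K where "K > 0"
    "\<And>m :: nat. m > 0 \<Longrightarrow> \<exists>n. real (m + n) \<le> K * real m powr (1 + \<eta>) \<and>
      (1 - \<eta> / 2 / m) ^ n * m \<le> \<eta> / 2"
proof -
  define \<gamma> where "\<gamma> = \<eta> / 2"
  have \<gamma>: "0 < \<gamma>" "\<gamma> < 1" using \<eta> by (auto simp: \<gamma>_def)
  \<comment> \<open>The \<open>2\<close> pays for \<open>m\<close> itself and for rounding up; the
    rest bounds \<open>y\<close>.\<close>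
  define K where "K = 2 + 1 / \<gamma> * (1 / \<eta> + ln (1 / \<gamma>))"
  have K: "K > 0" unfolding K_def using \<gamma> \<eta> by (intro add_pos_nonneg mult_nonneg_nonneg) auto
  have main: "\<exists>n. real (m + n) \<le> K * real m powr (1 + \<eta>) \<and> (1 - \<gamma> / m) ^ n * m \<le> \<gamma>" if m: "m > 0" for m :: nat
  proof -
    define y where "y = real m / \<gamma> * ln (real m / \<gamma>)"
    have m\<gamma>: "1 \<le> real m / \<gamma>" using m \<gamma> by (simp add: field_simps)
    have y0: "0 \<le> y" unfolding y_def using m\<gamma> by (intro mult_nonneg_nonneg ln_ge_zero) auto
    define n where "n = nat \<lceil>y\<rceil>"
    have n: "y \<le> real n" "real n \<le> y + 1" using y0 by (auto simp: n_def)
    have "(1 - \<gamma> / m) ^ n \<le> exp (- (\<gamma> / m)) ^ n"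
      using exp_ge_add_one_self[of "- (\<gamma> / m)"] m \<gamma> by (intro power_mono) (auto simp: field_simps)
    also have "\<dots> = exp (- (\<gamma> / m) * n)"
      by (simp add: exp_of_nat_mult[symmetric] mult.commute)
    also have "\<dots> \<le> exp (- ln (real m / \<gamma>))"
    proof -
      have "ln (real m / \<gamma>) = \<gamma> / m * y" using m \<gamma> by (simp add: y_def)
      also have "\<dots> \<le> \<gamma> / m * n" using n \<gamma> by (intro mult_left_mono) auto
      finally show ?thesis by simp
    qed
    also have "\<dots> = \<gamma> / m" using m \<gamma> by (simp add: exp_minus)
    finally have "(1 - \<gamma> / m) ^ n * m \<le> \<gamma>" using m by (simp add: field_simps)
    moreover have "real (m + n) \<le> K * real m powr (1 + \<eta>)"
    proof -
      have p: "real m powr (1 + \<eta>) = real m * real m powr \<eta>" using m by (simp add: powr_add)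
      have p1: "1 \<le> real m powr \<eta>" using m \<eta> by (simp add: ge_one_powr_ge_zero)
      have "ln (real m / \<gamma>) = ln (real m) + ln (1 / \<gamma>)" using m \<gamma> by (simp add: ln_div)
      also have "\<dots> \<le> real m powr \<eta> / \<eta> + ln (1 / \<gamma>) * real m powr \<eta>"
        using ln_powr_bound[of "real m" \<eta>] m \<eta> \<gamma> p1
        by (intro add_mono) (auto simp: ln_div mult_le_cancel_left1)
      also have "\<dots> = (1 / \<eta> + ln (1 / \<gamma>)) * real m powr \<eta>" by (simp add: algebra_simps)
      finally have "y \<le> real m / \<gamma> * ((1 / \<eta> + ln (1 / \<gamma>)) * real m powr \<eta>)"
        unfolding y_def using \<gamma> by (intro mult_left_mono) auto
      also have "\<dots> = (1 / \<gamma> * (1 / \<eta> + ln (1 / \<gamma>))) * real m powr (1 + \<eta>)"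
        unfolding p by (simp add: field_simps)
      finally have "y \<le> (1 / \<gamma> * (1 / \<eta> + ln (1 / \<gamma>))) * real m powr (1 + \<eta>)" .
      moreover have "real m \<le> real m powr (1 + \<eta>)" unfolding p using p1 m by simp
      moreover have "1 \<le> real m powr (1 + \<eta>)" using m \<eta> by (simp add: ge_one_powr_ge_zero)
      ultimately show ?thesis unfolding K_def using n by (simp add: distrib_right)
    qed
    ultimately show ?thesis by blast
  qed
  show ?thesis using that[OF K] main unfolding \<gamma>_def by blast
qed

text \<open>One factor \<open>1 + \<eta>\<close> of the exponent comes from the power, the other
  from the smaller accuracy. The latter adds at most \<open>\<eta>\<close> to
  \<open>ln (1 + ln (1 / \<epsilon>))\<close>, and since one plus this logarithm is at least one,
  the additive loss becomes a multiplicative one, uniformly for \<open>\<epsilon>\<close> near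
  one.\<close>

lemma exp_qpt_bound_scaled:
  assumes \<eta>: "0 < \<eta>" "\<eta> \<le> 1" and \<epsilon>: "0 < \<epsilon>" "\<epsilon> < 1" and d: "d \<ge> 1" and C: "C > 0" and t: "t \<ge> 0"
  shows "exp_qpt_bound C t d (\<epsilon> / sqrt (1 + \<eta>)) powr (1 + \<eta>) \<le>
    exp_qpt_bound (C powr (1 + \<eta>)) (t * (1 + \<eta>)\<^sup>2) d \<epsilon>"
proof -
  define l where "l = ln (1 / \<epsilon>)"
  define a where "a = 1 + ln (real d)"
  have l: "l \<ge> 0" unfolding l_def using \<epsilon> by simp
  have a: "a \<ge> 0" unfolding a_def using d by simp
  have ln\<eta>: "0 \<le> ln (1 + \<eta>)" "ln (1 + \<eta>) \<le> \<eta>" using \<eta> by (auto intro: ln_add_one_self_le_self)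
  have L: "ln (1 / (\<epsilon> / sqrt (1 + \<eta>))) = l + ln (1 + \<eta>) / 2"
    unfolding l_def using \<epsilon> \<eta> by (simp add: ln_div ln_sqrt)
  have "(1 + l) * (1 + \<eta>) = 1 + l + \<eta> + l * \<eta>" by (simp add: algebra_simps)
  moreover have "0 \<le> l * \<eta>" using l \<eta> by simp
  ultimately have \<delta>: "1 + ln (1 / (\<epsilon> / sqrt (1 + \<eta>))) \<le> (1 + l) * (1 + \<eta>)" "0 < 1 + ln (1 / (\<epsilon> / sqrt (1 + \<eta>)))"
    unfolding L using l ln\<eta> \<eta> by linarith+
  have "ln (1 + ln (1 / (\<epsilon> / sqrt (1 + \<eta>)))) \<le> ln ((1 + l) * (1 + \<eta>))"
    using \<delta> l \<eta> by simp
  also have "\<dots> = ln (1 + l) + ln (1 + \<eta>)" using l \<eta> by (simp add: ln_mult)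
  finally have "1 + ln (1 + ln (1 / (\<epsilon> / sqrt (1 + \<eta>)))) \<le> 1 + ln (1 + l) + \<eta>"
    using ln\<eta> by simp
  also have "\<dots> \<le> (1 + ln (1 + l)) * (1 + \<eta>)"
    using l \<eta> by (simp add: algebra_simps)
  finally have b: "1 + ln (1 + ln (1 / (\<epsilon> / sqrt (1 + \<eta>)))) \<le> (1 + ln (1 + l)) * (1 + \<eta>)" .
  have "exp_qpt_bound C t d (\<epsilon> / sqrt (1 + \<eta>)) powr (1 + \<eta>) =
      C powr (1 + \<eta>) * exp ((t * a * (1 + \<eta>)) * (1 + ln (1 + ln (1 / (\<epsilon> / sqrt (1 + \<eta>))))))"
    unfolding exp_qpt_bound_def a_def[symmetric] using C
    by (simp add: powr_mult exp_powr_real mult_ac)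
  also have "\<dots> \<le> C powr (1 + \<eta>) * exp ((t * a * (1 + \<eta>)) * ((1 + ln (1 + l)) * (1 + \<eta>)))"
    using b a t \<eta> by (intro mult_left_mono) (auto intro!: mult_left_mono)
  also have "\<dots> = exp_qpt_bound (C powr (1 + \<eta>)) (t * (1 + \<eta>)\<^sup>2) d \<epsilon>"
    unfolding exp_qpt_bound_def a_def[symmetric] l_def[symmetric] by (simp add: power2_eq_square mult_ac)
  finally show ?thesis .
qed

text \<open>A finite bound excludes the infimum of the empty set, and the order on
  \<open>enat\<close> is a well-order, so the infimum is a minimum. The comparison takes place in
  the extended reals, as in \<open>exp_qpt_holds\<close>.\<close>

lemma info_compl_attained:
  assumes "ereal_of_enat (info_compl S c crit \<epsilon> d) \<le> ereal B"
  obtains n where "min_err2 S c n d \<le> ennreal (\<epsilon>\<^sup>2) * CRI2 S crit d" "real n \<le> B"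
proof -
  define A where "A = {n. min_err2 S c n d \<le> ennreal (\<epsilon>\<^sup>2) * CRI2 S crit d}"
  have eq: "info_compl S c crit \<epsilon> d = Inf (enat ` A)" by (simp add: info_compl_def A_def)
  have "A \<noteq> {}"
  proof
    assume "A = {}"
    then have "info_compl S c crit \<epsilon> d = \<infinity>" unfolding eq by (simp add: top_enat_def)
    with assms show False by simp
  qed
  then obtain k where "enat k \<in> enat ` A" by blast
  then have "Inf (enat ` A) \<in> enat ` A" by (rule wellorder_InfI)
  then obtain n where "n \<in> A" "Inf (enat ` A) = enat n" by auto
  then show ?thesis using assms that[of n] unfolding eq by (auto simp: A_def)
qed

lemma info_compl_le:
  assumes "min_err2 S c n d \<le> ennreal (\<epsilon>\<^sup>2) * CRI2 S crit d" "real n \<le> B"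
  shows "ereal_of_enat (info_compl S c crit \<epsilon> d) \<le> ereal B"
proof -
  have "info_compl S c crit \<epsilon> d \<le> enat n"
    unfolding info_compl_def using assms(1) by (intro INF_lower) simp
  then have "ereal_of_enat (info_compl S c crit \<epsilon> d) \<le> ereal_of_enat (enat n)"
    by (simp only: ereal_of_enat_le_iff)
  also have "\<dots> \<le> ereal B" using assms(2) by simp
  finally show ?thesis .
qed

lemma exp_qpt_std_imp_all:
  assumes "valid_setting S" "exp_qpt_holds S Info_std crit C t"
  shows "exp_qpt_holds S Info_all crit C t"
  unfolding exp_qpt_holds_def
proof (intro allI impI)
  fix d :: nat and \<epsilon> :: real assume d: "1 \<le> d" and \<epsilon>: "0 < \<epsilon> \<and> \<epsilon> < 1"
  interpret avg_setting_dim S d using assms(1) d by unfold_locales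
  have "ereal_of_enat (info_compl S Info_std crit \<epsilon> d) \<le> ereal (exp_qpt_bound C t d \<epsilon>)"
    using assms(2) d \<epsilon> by (auto simp: exp_qpt_holds_def)
  then obtain n where "min_err2 S Info_std n d \<le> ennreal (\<epsilon>\<^sup>2) * CRI2 S crit d"
    and n: "real n \<le> exp_qpt_bound C t d \<epsilon>"
    by (rule info_compl_attained)
  then show "ereal_of_enat (info_compl S Info_all crit \<epsilon> d) \<le> ereal (exp_qpt_bound C t d \<epsilon>)"
    using order_trans[OF min_err2_all_le_std] by (intro info_compl_le) auto
qed

text \<open>Asking arbitrary functionals for accuracy \<open>\<epsilon> / sqrt (1 + \<eta>)\<close>
  compensates the factor \<open>1 + \<eta>\<close> lost on squared errors. \<open>CRI2\<close> is a
  common factor of both sides and is never evaluated, so one argument serves both criteria.\<close>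

lemma exp_qpt_all_imp_std:
  assumes S: "valid_setting S" and all: "exp_qpt_holds S Info_all crit C t"
    and C: "C > 0" and t: "t \<ge> 0" and \<eta>: "0 < \<eta>" "\<eta> \<le> 1"
  shows "\<exists>C'>0. exp_qpt_holds S Info_std crit C' (t * (1 + \<eta>)\<^sup>2)"
proof -
  obtain K where K: "K > 0" and count: "\<And>m :: nat. m > 0 \<Longrightarrow>
      \<exists>n. real (m + n) \<le> K * real m powr (1 + \<eta>) \<and> (1 - \<eta> / 2 / m) ^ n * m \<le> \<eta> / 2"
    using sample_count[OF \<eta>] by blast
  have "exp_qpt_holds S Info_std crit (K * C powr (1 + \<eta>)) (t * (1 + \<eta>)\<^sup>2)"
    unfolding exp_qpt_holds_def
  proof (intro allI impI)
    fix d :: nat and \<epsilon> :: real assume d: "1 \<le> d" and \<epsilon>: "0 < \<epsilon> \<and> \<epsilon> < 1"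
    interpret avg_setting_dim S d using S d by unfold_locales
    define \<delta> where "\<delta> = \<epsilon> / sqrt (1 + \<eta>)"
    have s1: "1 < sqrt (1 + \<eta>)" using \<eta> by simp
    have "\<delta> \<le> \<epsilon> / 1" unfolding \<delta>_def using \<epsilon> s1 by (intro divide_left_mono) auto
    then have "\<delta> < 1" using \<epsilon> by simp
    moreover have "0 < \<delta>" using \<epsilon> \<eta> by (simp add: \<delta>_def)
    ultimately have \<delta>: "0 < \<delta>" "\<delta> < 1" by auto
    have \<delta>2: "(1 + \<eta>) * \<delta>\<^sup>2 = \<epsilon>\<^sup>2" using \<eta> by (simp add: \<delta>_def power_divide)
    have "ereal_of_enat (info_compl S Info_all crit \<delta> d) \<le> ereal (exp_qpt_bound C t d \<delta>)"
      using all d \<delta> by (auto simp: exp_qpt_holds_def)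
    then obtain m where m: "min_err2 S Info_all m d \<le> ennreal (\<delta>\<^sup>2) * CRI2 S crit d"
      and mB: "real m \<le> exp_qpt_bound C t d \<delta>"
      by (rule info_compl_attained)
    have m': "ennreal (1 + \<eta>) * min_err2 S Info_all m d \<le> ennreal (\<epsilon>\<^sup>2) * CRI2 S crit d"
    proof -
      have "ennreal (1 + \<eta>) * min_err2 S Info_all m d \<le> ennreal (1 + \<eta>) * (ennreal (\<delta>\<^sup>2) * CRI2 S crit d)"
        by (intro mult_left_mono m) simp
      also have "\<dots> = ennreal (\<epsilon>\<^sup>2) * CRI2 S crit d"
      proof -
        have "ennreal (1 + \<eta>) * ennreal (\<delta>\<^sup>2) = ennreal (\<epsilon>\<^sup>2)"
          unfolding \<delta>2[symmetric] using \<eta> by (intro ennreal_mult[symmetric]) auto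
        then show ?thesis by (simp only: mult.assoc[symmetric])
      qed
      finally show ?thesis .
    qed
    have "\<exists>N. min_err2 S Info_std N d \<le> ennreal (1 + \<eta>) * min_err2 S Info_all m d \<and>
        real N \<le> K * real m powr (1 + \<eta>)"
    proof (cases "m = 0")
      \<comment> \<open>Without functionals both classes have the same initial error, so
        \<open>N = 0\<close> serves, in agreement with
        \<open>0 powr (1 + \<eta>) = 0\<close>.\<close>
      case True
      have "1 * min_err2 S Info_all m d \<le> ennreal (1 + \<eta>) * min_err2 S Info_all m d"
        using \<eta> by (intro mult_right_mono) auto
      then show ?thesis using True by (intro exI[of _ 0]) (simp add: min_err2_def)
    next
      case False
      then obtain n where n: "real (m + n) \<le> K * real m powr (1 + \<eta>)" "(1 - \<eta> / 2 / m) ^ n * m \<le> \<eta> / 2"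
        using count[of m] by auto
      have "min_err2 S Info_std (m + n) d \<le> ennreal (1 + (1 - \<eta> / 2 / m) ^ n * m + \<eta> / 2) * min_err2 S Info_all m d"
        using min_err2_std_le_all[of m "\<eta> / 2" n] False \<eta> by simp
      also have "\<dots> \<le> ennreal (1 + \<eta>) * min_err2 S Info_all m d"
        using n(2) by (intro mult_right_mono ennreal_leI) auto
      finally show ?thesis using n(1) by blast
    qed
    then obtain N where N: "min_err2 S Info_std N d \<le> ennreal (\<epsilon>\<^sup>2) * CRI2 S crit d"
      and NK: "real N \<le> K * real m powr (1 + \<eta>)"
      using m' order_trans by blast
    note NK
    also have "K * real m powr (1 + \<eta>) \<le> K * exp_qpt_bound C t d \<delta> powr (1 + \<eta>)"
      using mB K \<eta> by (intro mult_left_mono powr_mono2) auto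
    also have "\<dots> \<le> K * exp_qpt_bound (C powr (1 + \<eta>)) (t * (1 + \<eta>)\<^sup>2) d \<epsilon>"
      unfolding \<delta>_def using exp_qpt_bound_scaled[OF \<eta> _ _ d C t] \<epsilon> K by (intro mult_left_mono) auto
    also have "\<dots> = exp_qpt_bound (K * C powr (1 + \<eta>)) (t * (1 + \<eta>)\<^sup>2) d \<epsilon>"
      by (simp add: exp_qpt_bound_def)
    finally show "ereal_of_enat (info_compl S Info_std crit \<epsilon> d) \<le>
        ereal (exp_qpt_bound (K * C powr (1 + \<eta>)) (t * (1 + \<eta>)\<^sup>2) d \<epsilon>)"
      by (intro info_compl_le[OF N])
  qed
  moreover have "K * C powr (1 + \<eta>) > 0" using K C by simp
  ultimately show ?thesis by blast
qed

theorem theorem5p4: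
  assumes "valid_setting S"
  shows "(EXP_QPT S Info_all ABS \<longleftrightarrow> EXP_QPT S Info_std ABS) \<and>
    (\<forall>crit. EXP_QPT S Info_all crit \<longrightarrow>
       EXP_QPT S Info_std crit \<and> EXP_t S Info_all crit = EXP_t S Info_std crit)"
proof -
  have std_all: "EXP_QPT S Info_all crit" if "EXP_QPT S Info_std crit" for crit
    using that exp_qpt_std_imp_all[OF assms] unfolding EXP_QPT_def by blast
  have all_std: "EXP_QPT S Info_std crit" if all: "EXP_QPT S Info_all crit" for crit
  proof -
    obtain C t where "C > 0" "t \<ge> 0" "exp_qpt_holds S Info_all crit C t"
      using all unfolding EXP_QPT_def by blast
    \<comment> \<open>Any \<open>\<eta>\<close> would do for tractability itself;
      \<open>\<eta> = 1\<close> costs a factor four in the exponent.\<close>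
    then have "\<exists>C'>0. exp_qpt_holds S Info_std crit C' (t * (1 + 1)\<^sup>2)"
      by (intro exp_qpt_all_imp_std[OF assms]) auto
    moreover have "0 \<le> t * (1 + 1)\<^sup>2" using \<open>t \<ge> 0\<close> by simp
    ultimately show ?thesis unfolding EXP_QPT_def by blast
  qed
  have "EXP_t S Info_all crit = EXP_t S Info_std crit" if all: "EXP_QPT S Info_all crit" for crit
  proof (rule antisym)
    let ?T = "\<lambda>c. {t. t \<ge> 0 \<and> (\<exists>C>0. exp_qpt_holds S c crit C t)}"
    \<comment> \<open>The infimum of the empty set of reals carries no information, so both sets
      must be nonempty; this is what tractability provides.\<close>
    have ne: "?T Info_all \<noteq> {}" "?T Info_std \<noteq> {}"
      using all all_std[OF all] unfolding EXP_QPT_def by blast+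
    have bdd: "bdd_below (?T c)" for c by (rule bdd_belowI[of _ 0]) simp
    show "EXP_t S Info_all crit \<le> EXP_t S Info_std crit"
      unfolding EXP_t_def using exp_qpt_std_imp_all[OF assms]
      by (intro cInf_superset_mono ne bdd) blast
    show "EXP_t S Info_std crit \<le> EXP_t S Info_all crit"
      unfolding EXP_t_def
    proof (rule cInf_greatest[OF ne(1)])
      fix t assume "t \<in> ?T Info_all"
      then obtain C where t: "t \<ge> 0" and C: "C > 0" "exp_qpt_holds S Info_all crit C t" by blast
      show "Inf (?T Info_std) \<le> t"
      proof (rule field_le_epsilon)
        fix e :: real assume e: "e > 0"
        \<comment> \<open>Chosen so that \<open>3 * t * \<eta> \<le> e\<close>, given
          \<open>t * (1 + \<eta>)\<^sup>2 \<le> t + 3 * t * \<eta>\<close> for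
          \<open>\<eta> \<le> 1\<close>; the added one keeps the denominator positive at
          \<open>t = 0\<close>.\<close>
        define \<eta> where "\<eta> = min 1 (e / (3 * t + 1))"
        have \<eta>: "0 < \<eta>" "\<eta> \<le> 1" using e t by (auto simp: \<eta>_def)
        have "t * (1 + \<eta>)\<^sup>2 \<in> ?T Info_std"
          using exp_qpt_all_imp_std[OF assms C(2,1) t \<eta>] t by simp
        then have "Inf (?T Info_std) \<le> t * (1 + \<eta>)\<^sup>2"
          by (rule cInf_lower[OF _ bdd])
        also have "\<dots> \<le> t + 3 * t * \<eta>"
        proof -
          have "\<eta>\<^sup>2 \<le> \<eta>" using \<eta> by (simp add: power2_eq_square mult_left_le)
          then have "t * \<eta>\<^sup>2 \<le> t * \<eta>" using t by (rule mult_left_mono)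
          then show ?thesis by (simp add: power2_sum algebra_simps)
        qed
        also have "3 * t * \<eta> \<le> (3 * t + 1) * (e / (3 * t + 1))"
          using t \<eta> e by (intro mult_mono) (auto simp: \<eta>_def)
        also have "\<dots> = e" using t by simp
        finally show "Inf (?T Info_std) \<le> t + e" by simp
      qed
    qed
  qed
  with std_all all_std show ?thesis by blast
qed

end
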